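(* Let $\Omega\subset\mathbb{R}^d$ be a bounded Lipschitz domain, $s\in(0,1)$, $\alpha>0$, $f\in L^2(\Omega)$ and $g\in[L^2_s(\Omega^c)]'$. Let $u\in\mathbb{V}$ be the unique solution of $$\langle u,v\rangle_{\mathbb{X}}+\alpha(u,v)_{L^2(\Omega)}=(f,v)_{L^2(\Omega)}+(g,v)_{L^2(\Omega^c)}\qquad\forall v\in\mathbb{V}.$$ Let $\{\mathcal{T}_h\}_{h>0}$ be a shape-regular family of triangulations, where $\mathcal{T}_h$ is a triangulation of the computational domain $\Lambda_H$, $H=H(h)$, that meshes $\overline\Omega$ exactly and has mesh size $h=\max_{T\in\mathcal{T}_h}h_T$. Let $u_h\in\mathbb{V}_h$ be the finite element solution, that is, the unique $u_h\in\mathbb{V}_h$ with $$\langle u_h,v_h\rangle_{\mathbb{X}}+\alpha(u_h,v_h)_{L^2(\Omega)}=(f,v_h)_{L^2(\Omega)}+(g,v_h)_{L^2(\Omega^c)}\qquad\forall v_h\in\mathbb{V}_h.$$ If $H\to\infty$ as $h\to0$ and if $u\in L^\infty_{loc}(\overline{\Omega^c})$, then $$\lim_{h\to0}\|u-u_h\|_{\mathbb{V}}=0.$$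
   Context: $\Omega^c=\mathbb{R}^d\setminus\overline\Omega$, and $C_{d,s}=\frac{2^{2s}s\,\Gamma(s+d/2)}{\pi^{d/2}\Gamma(1-s)}$. Bilinear form and space. $\langle u,v\rangle_{\mathbb{X}}=\frac{C_{d,s}}{2}\iint_{(\mathbb{R}^d\times\mathbb{R}^d)\setminus(\Omega^c\times\Omega^c)}\frac{(u(x)-u(y))(v(x)-v(y))}{|x-y|^{d+2s}}\,dx\,dy$, $|v|_{\mathbb{X}}=\langle v,v\rangle_{\mathbb{X}}^{1/2}$, $\|v\|_{\mathbb{V}}=(\|v\|_{L^2(\Omega)}^2+|v|_{\mathbb{X}}^2)^{1/2}$, and $\mathbb{V}=\{v:\mathbb{R}^d\to\mathbb{R}\text{ measurable}:\|v\|_{\mathbb{V}}<\infty\}$ (functions identified when equal a.e.). $(\cdot,\cdot)_{L^2(A)}$ denotes the integral over $A$ of the product. Data. $g\in[L^2_s(\Omega^c)]'$ means that $g:\Omega^c\to\mathbb{R}$ is measurable and $\int_{\Omega^c}|g(x)|^2(1+|x|^{d+2s})\,dx<\infty$. $u\in L^\infty_{loc}(\overline{\Omega^c})$ means that $u$ is essentially bounded on every bounded subset of $\overline{\Omega^c}$. Discretization. For $H>0$, $\Lambda_H=\{x\in\mathbb{R}^d:d(x,\partial\Omega)\le H\}$ and $\Lambda_H^c=\mathbb{R}^d\setminus\Lambda_H$; the computational domains $\Lambda_H$ are taken with $H>\mathrm{diam}(\Omega)$, so that $\Omega\subset\Lambda_H$. $\mathcal{T}_h$ is an admissible (conforming)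 triangulation of $\Lambda_H$ into closed simplices, such that $\overline\Omega$ is a union of elements of $\mathcal{T}_h$. Shape regularity means $\sigma:=\sup_{h>0}\max_{T\in\mathcal{T}_h}h_T/\rho_T<\infty$, where $h_T=\mathrm{diam}(T)$ and $\rho_T$ is the diameter of the largest ball contained in $T$. Let $N$ be the number of vertices of $\mathcal{T}_h$ and $\varphi_1,\dots,\varphi_N$ the standard continuous piecewise linear Lagrangian (nodal) basis functions on $\Lambda_H$, extended by zero to $\Lambda_H^c$; let $\varphi_{N+1}=\chi_{\Lambda_H^c}$ be the characteristic function of $\Lambda_H^c$. The discrete space is $\mathbb{V}_h=\mathrm{span}\{\varphi_1,\dots,\varphi_{N+1}\}\subset\mathbb{V}$. *)

theory Defs
  imports "HOL-Analysis.Analysis"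
begin

section \<open>Domains\<close>

text \<open>
  Near each boundary point and after a rigid motion, a Lipschitz domain is the strict
  subgraph, in some unit direction e, of a Lipschitz function on the hyperplane
  orthogonal to e. Boundedness is stated separately.
\<close>

definition lipschitz_domain :: "'a::euclidean_space set \<Rightarrow> bool" where
  "lipschitz_domain \<Omega> \<longleftrightarrow>
     open \<Omega> \<and> connected \<Omega> \<and> \<Omega> \<noteq> {} \<and>
     (\<forall>p\<in>frontier \<Omega>. \<exists>e \<gamma> L U.
        norm e = 1 \<and> L-lipschitz_on {x. e \<bullet> x = 0} \<gamma> \<and> open U \<and> p \<in> U \<and>
        \<Omega> \<inter> U = {x \<in> U. e \<bullet> x < \<gamma> (x - (e \<bullet> x) *\<^sub>R e)})"

definition ext :: "'a::euclidean_space set \<Rightarrow> 'a set" where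
  "ext \<Omega> = - closure \<Omega>"


section \<open>The nonlocal form and its energy space\<close>

definition frac_const :: "nat \<Rightarrow> real \<Rightarrow> real" where
  "frac_const d s =
     2 powr (2 * s) * s * Gamma (s + real d / 2) / (pi powr (real d / 2) * Gamma (1 - s))"

definition L2_inner :: "'a::euclidean_space set \<Rightarrow> ('a \<Rightarrow> real) \<Rightarrow> ('a \<Rightarrow> real) \<Rightarrow> real" where
  "L2_inner A u v = (LINT x:A|lebesgue. u x * v x)"

text \<open>
  On the diagonal, a null set, the quotient is 0 by the convention for division by 0.
\<close>

definition X_integrand ::
    "real \<Rightarrow> ('a::euclidean_space \<Rightarrow> real) \<Rightarrow> ('a \<Rightarrow> real) \<Rightarrow> 'a \<times> 'a \<Rightarrow> real" where
  "X_integrand s u v =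
     (\<lambda>(x, y). (u x - u y) * (v x - v y) / norm (x - y) powr (real DIM('a) + 2 * s))"

definition X_inner ::
    "real \<Rightarrow> 'a::euclidean_space set \<Rightarrow> ('a \<Rightarrow> real) \<Rightarrow> ('a \<Rightarrow> real) \<Rightarrow> real" where
  "X_inner s \<Omega> u v =
     frac_const DIM('a) s / 2 *
       (LINT p:(UNIV \<times> UNIV) - (ext \<Omega> \<times> ext \<Omega>)|lebesgue. X_integrand s u v p)"

definition X_seminorm :: "real \<Rightarrow> 'a::euclidean_space set \<Rightarrow> ('a \<Rightarrow> real) \<Rightarrow> real" where
  "X_seminorm s \<Omega> v = sqrt (X_inner s \<Omega> v v)"

definition V_norm :: "real \<Rightarrow> 'a::euclidean_space set \<Rightarrow> ('a \<Rightarrow> real) \<Rightarrow> real" where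
  "V_norm s \<Omega> v = sqrt (L2_inner \<Omega> v v + (X_seminorm s \<Omega> v)\<^sup>2)"

text \<open>
  Since an undefined Bochner integral has value 0, finiteness of the norm of a measurable
  function is expressed as integrability of the two nonnegative integrands. Elements are
  functions, not classes modulo a.e. equality; all integrals above respect a.e. equality.
\<close>

definition V_space :: "real \<Rightarrow> 'a::euclidean_space set \<Rightarrow> ('a \<Rightarrow> real) set" where
  "V_space s \<Omega> =
     {v. v \<in> borel_measurable lebesgue \<and>
         set_integrable lebesgue \<Omega> (\<lambda>x. (v x)\<^sup>2) \<and>
         set_integrable lebesgue ((UNIV \<times> UNIV) - (ext \<Omega> \<times> ext \<Omega>)) (X_integrand s v v)}"


section \<open>Data\<close>

text \<open>
  Functions given only on a set are total functions whose values off that set are ignored.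
\<close>

definition L2_on :: "'a::euclidean_space set \<Rightarrow> ('a \<Rightarrow> real) set" where
  "L2_on A =
     {f. set_borel_measurable lebesgue A f \<and> set_integrable lebesgue A (\<lambda>x. (f x)\<^sup>2)}"

definition L2s_dual :: "real \<Rightarrow> 'a::euclidean_space set \<Rightarrow> ('a \<Rightarrow> real) set" where
  "L2s_dual s A =
     {g. set_borel_measurable lebesgue A g \<and>
         set_integrable lebesgue A (\<lambda>x. \<bar>g x\<bar>\<^sup>2 * (1 + norm x powr (real DIM('a) + 2 * s)))}"

definition Linf_loc :: "'a::euclidean_space set \<Rightarrow> ('a \<Rightarrow> real) set" where
  "Linf_loc A =
     {u. set_borel_measurable lebesgue A u \<and>
         (\<forall>B. bounded B \<and> B \<subseteq> A \<longrightarrow> (\<exists>C. AE x in lebesgue. x \<in> B \<longrightarrow> \<bar>u x\<bar> \<le> C))}"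

text \<open>
  The (Galerkin) problem posed in W. The continuous problem is the case W = V_space s \<Omega>.
\<close>

definition solves ::
    "real \<Rightarrow> 'a::euclidean_space set \<Rightarrow> real \<Rightarrow> ('a \<Rightarrow> real) \<Rightarrow> ('a \<Rightarrow> real) \<Rightarrow>
     ('a \<Rightarrow> real) set \<Rightarrow> ('a \<Rightarrow> real) \<Rightarrow> bool" where
  "solves s \<Omega> \<alpha> f g W u \<longleftrightarrow>
     u \<in> W \<and>
     (\<forall>v\<in>W. X_inner s \<Omega> u v + \<alpha> * L2_inner \<Omega> u v = L2_inner \<Omega> f v + L2_inner (ext \<Omega>) g v)"


section \<open>Triangulations and finite elements\<close>

definition comp_domain :: "'a::euclidean_space set \<Rightarrow> real \<Rightarrow> 'a set" where
  "comp_domain \<Omega> H = {x. infdist x (frontier \<Omega>) \<le> H}"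

text \<open>
  The library notion triangulation includes finiteness and conformity (two elements meet in a
  common, possibly empty, face); here all elements have full dimension in addition.

  In dimension at least 2, comp_domain \<Omega> H is a finite-radius neighbourhood with curved boundary
  (a union of balls of radius H), never a finite union of simplices, so that demanding
  \<Union>\<T> = comp_domain \<Omega> H would make everything stated about meshes vacuous. Hence a mesh of size h
  has to cover comp_domain \<Omega> H, and may overshoot it by at most a layer of width h. The case
  \<Union>\<T> = comp_domain \<Omega> H is included.
\<close>

definition mesh_size :: "'a::euclidean_space set set \<Rightarrow> real" where
  "mesh_size \<T> = Max (diameter ` \<T>)"

definition is_mesh :: "'a::euclidean_space set \<Rightarrow> real \<Rightarrow> 'a set set \<Rightarrow> bool" where
  "is_mesh \<Omega> H \<T> \<longleftrightarrow>
     triangulation \<T> \<and>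
     (\<forall>T\<in>\<T>. int DIM('a) simplex T) \<and>
     comp_domain \<Omega> H \<subseteq> \<Union>\<T> \<and> \<Union>\<T> \<subseteq> comp_domain \<Omega> (H + mesh_size \<T>) \<and>
     (\<exists>\<S>\<subseteq>\<T>. closure \<Omega> = \<Union>\<S>)"

definition inball_diameter :: "'a::euclidean_space set \<Rightarrow> real" where
  "inball_diameter T = Sup {2 * r | r. 0 \<le> r \<and> (\<exists>x. cball x r \<subseteq> T)}"

definition shape_regular :: "(real \<Rightarrow> 'a::euclidean_space set set) \<Rightarrow> bool" where
  "shape_regular \<T> \<longleftrightarrow>
     (\<exists>\<sigma>. \<forall>h>0. \<forall>T\<in>\<T> h. diameter T / inball_diameter T \<le> \<sigma>)"

definition mesh_vertices :: "'a::euclidean_space set set \<Rightarrow> 'a set" where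
  "mesh_vertices \<T> = {z. \<exists>T\<in>\<T>. z extreme_point_of T}"

definition nodal_basis :: "'a::euclidean_space set set \<Rightarrow> 'a \<Rightarrow> 'a \<Rightarrow> real" where
  "nodal_basis \<T> z =
     (THE \<phi>. continuous_on (\<Union>\<T>) \<phi> \<and>
             (\<forall>T\<in>\<T>. \<exists>a b. \<forall>x\<in>T. \<phi> x = a \<bullet> x + b) \<and>
             (\<forall>z'\<in>mesh_vertices \<T>. \<phi> z' = (if z' = z then 1 else 0)) \<and>
             (\<forall>x. x \<notin> \<Union>\<T> \<longrightarrow> \<phi> x = 0))"

text \<open>
  The linear span of the nodal basis and of the characteristic function of the complement of
  the meshed region (the library's span does not apply, functions not being an instance of
  real_vector).
\<close>

definition V_h_space :: "'a::euclidean_space set set \<Rightarrow> ('a \<Rightarrow> real) set" where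
  "V_h_space \<T> =
     {v. \<exists>c c\<^sub>0. v = (\<lambda>x. (\<Sum>z\<in>mesh_vertices \<T>. c z * nodal_basis \<T> z x)
                         + c\<^sub>0 * indicator (- \<Union>\<T>) x)}"

end

theory Submission
  imports Defs
begin

text \<open>
The form \<open>a(u,v) = \<langle>u,v\<rangle> + \<alpha> (u,v)\<close> is symmetric, and \<open>sqrt (a(v,v))\<close> is equivalent to the norm of
the energy space. The discrete space lies in the energy space, hence \<open>u - u\<^sub>h\<close> is
\<open>a\<close>-orthogonal to it, and by Pythagoras no element of the discrete space is closer to
\<open>u\<close> than \<open>u\<^sub>h\<close>, measured with \<open>a\<close> (\<open>Galerkin_best_approximation\<close>). So only approximability remains
(\<open>V_h_approximation\<close>): every function of finite norm is a limit of discrete functions. This has two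
halves, density of Lipschitz functions and interpolation of Lipschitz functions.

Density (\<open>Lipschitz_functions_dense\<close>). The form does not see pairs of points that both lie outside
\<open>closure \<Omega>\<close>. A translation may carry a pair that it sees to a pair that it does not see, and then
there is no control over the translated difference quotient; so plain mollification need not
converge. The Lipschitz boundary is what repairs this. Near a boundary point there is a whole cone of
small shifts that carry \<open>closure \<Omega>\<close> into \<open>\<Omega>\<close> (\<open>subgraph_shift\<close>), and for these the visible pairs
stay visible. Mollifying with a kernel supported in this cone then means averaging translates of the
square integrable function \<open>(v x - v y) |x - y| powr -(d/2 + s)\<close> on the product space, restricted to
visible pairs at distance less than some \<open>r\<close>. As translations are continuous in the mean square, the
averages converge (\<open>mollification_approximates\<close>). Pairs at distance at least \<open>r\<close> only
cost a multiple of the \<open>L\<^sup>2\<close> norm. Finitely many Lipschitz cutoffs reduce the general case to such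
charts, to balls inside \<open>\<Omega>\<close>, and to functions that vanish near \<open>\<Omega>\<close>
(\<open>approximable_of_finite_cover\<close>). Multiplication by a cutoff preserves finite energy for bounded
functions, which is why values and support are truncated beforehand
(\<open>V_sq_truncation\<close>, \<open>V_sq_cutoff\<close>).

Interpolation (\<open>interpolant_in_V_h\<close>). Let \<open>w\<close> be Lipschitz with constant \<open>L\<close> and with bounded support;
since \<open>H \<rightarrow> \<infinity>\<close>, the mesh eventually covers the support. The nodal interpolant differs from
\<open>w\<close> by at most \<open>L h\<close>, and by shape regularity its gradient is at most \<open>L \<sigma>\<close>. The error is therefore
uniformly small, with Lipschitz constants that stay bounded, and this suffices for small energy: a
function with oscillation \<open>\<eta>\<close> and Lipschitz constant \<open>L\<close> near \<open>\<Omega>\<close> has energy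
\<open>O(\<eta> powr (1 - s) * L powr (1 + s) + \<eta>\<^sup>2)\<close> (\<open>energy_Lipschitz_bound\<close>).

The norm is estimated through nonnegative extended integrals with respect to \<open>lborel\<close> and for Borel
functions, where finiteness is a matter of inequalities and Tonelli's theorem applies. Borel
representatives and the Bochner integrals that define the form come in only at the end.
\<close>

section \<open>Radial power integrals\<close>

lemma powr_annulus_integral:
  fixes p r :: real
  assumes r: "r > 0"
  shows "(\<integral>\<^sup>+t. indicator {t::'a::euclidean_space. r \<le> norm t \<and> norm t < 2 * r} t * ennreal (norm t powr p) \<partial>lborel)
    \<le> ennreal (2 powr \<bar>p\<bar> * unit_ball_vol (real DIM('a)) * 2 ^ DIM('a) * r powr (p + real DIM('a)))"
proof -
  have bd: "norm t powr p \<le> 2 powr \<bar>p\<bar> * r powr p" if "r \<le> norm t" "norm t < 2 * r" for t :: 'a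
  proof -
    have "norm t powr p = (norm t / r) powr p * r powr p"
      using r that by (simp add: powr_divide)
    moreover have "(norm t / r) powr p \<le> (norm t / r) powr \<bar>p\<bar>"
      using r that by (intro powr_mono) (auto simp: field_simps)
    moreover have "(norm t / r) powr \<bar>p\<bar> \<le> 2 powr \<bar>p\<bar>"
      using r that by (intro powr_mono2) (auto simp: field_simps)
    ultimately show ?thesis
      by (simp add: mult_right_mono)
  qed
  have "(\<integral>\<^sup>+t. indicator {t::'a. r \<le> norm t \<and> norm t < 2 * r} t * ennreal (norm t powr p) \<partial>lborel)
    \<le> (\<integral>\<^sup>+t. ennreal (2 powr \<bar>p\<bar> * r powr p) * indicator (ball (0::'a) (2 * r)) t \<partial>lborel)"
    by (intro nn_integral_mono) (auto simp: indicator_def intro!: ennreal_leI bd)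
  also have "\<dots> = ennreal (2 powr \<bar>p\<bar> * r powr p) * ennreal (unit_ball_vol (real DIM('a)) * (2 * r) ^ DIM('a))"
    using r by (subst nn_integral_cmult_indicator) (auto simp: emeasure_ball)
  also have "\<dots> = ennreal (2 powr \<bar>p\<bar> * unit_ball_vol (real DIM('a)) * 2 ^ DIM('a) * r powr (p + real DIM('a)))"
    using r by (subst ennreal_mult' [symmetric]) (auto simp: powr_add powr_realpow power_mult_distrib mult_ac)
  finally show ?thesis .
qed

text \<open>
  Power functions are integrated by cutting space into dyadic annuli; the contributions of the annuli
  form a geometric series.
\<close>

lemma dyadic_integral_bound:
  fixes A :: "nat \<Rightarrow> 'a::euclidean_space set" and F :: "'a \<Rightarrow> ennreal"
  assumes [measurable]: "\<And>k. A k \<in> sets borel" "F \<in> borel_measurable borel"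
    and cov: "\<And>t. t \<in> S \<Longrightarrow> F t \<noteq> 0 \<Longrightarrow> \<exists>k. t \<in> A k"
    and bd: "\<And>k. (\<integral>\<^sup>+t. indicator (A k) t * F t \<partial>lborel) \<le> ennreal (B * q ^ k)"
    and q: "0 \<le> q" "q < 1" and B: "B \<ge> 0"
  shows "(\<integral>\<^sup>+t. indicator S t * F t \<partial>lborel) \<le> ennreal (B / (1 - q))"
proof -
  have "(\<integral>\<^sup>+t. indicator S t * F t \<partial>lborel) \<le> (\<integral>\<^sup>+t. (\<Sum>k. indicator (A k) t * F t) \<partial>lborel)"
  proof (intro nn_integral_mono)
    fix t
    show "indicator S t * F t \<le> (\<Sum>k. indicator (A k) t * F t)"
    proof (cases "t \<in> S \<and> F t \<noteq> 0")
      case True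
      then obtain k where "t \<in> A k" using cov by blast
      then have "indicator S t * F t \<le> (\<Sum>j\<in>{k}. indicator (A j) t * F t)"
        by (auto simp: indicator_def)
      also have "\<dots> \<le> (\<Sum>k. indicator (A k) t * F t)"
        by (intro sum_le_suminf) auto
      finally show ?thesis .
    qed auto
  qed
  also have "\<dots> = (\<Sum>k. \<integral>\<^sup>+t. indicator (A k) t * F t \<partial>lborel)"
    by (rule nn_integral_suminf) measurable
  also have "\<dots> \<le> (\<Sum>k. ennreal (B * q ^ k))"
    by (intro suminf_le bd) auto
  also have "\<dots> = ennreal (\<Sum>k. B * q ^ k)"
    using q B by (intro suminf_ennreal2) (auto intro!: summable_mult summable_geometric)
  also have "(\<Sum>k. B * q ^ k) = B / (1 - q)"
    using q by (subst suminf_mult) (auto simp: suminf_geometric intro!: summable_geometric)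
  finally show ?thesis .
qed

text \<open>
  Integrability of the kernel away from the diagonal, with the rate in the inner radius that makes far
  interactions negligible.
\<close>

lemma powr_tail_integral:
  fixes a :: real
  assumes a: "a > 0"
  shows "\<exists>C\<ge>0. \<forall>r>0. (\<integral>\<^sup>+t. indicator {t::'a::euclidean_space. r \<le> norm t} t *
           ennreal (norm t powr - (real DIM('a) + a)) \<partial>lborel) \<le> ennreal (C * r powr - a)"
proof -
  define B where "B = 2 powr \<bar>- (real DIM('a) + a)\<bar> * unit_ball_vol (real DIM('a)) * 2 ^ DIM('a)"
  have B: "B \<ge> 0" by (simp add: B_def)
  have q: "0 \<le> (2::real) powr - a" "(2::real) powr - a < 1"
    using a by (auto simp: powr_less_one)
  show ?thesis
  proof (intro exI[of _ "B / (1 - 2 powr - a)"] conjI allI impI)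
    show "0 \<le> B / (1 - 2 powr - a)" using B q by simp
    fix r :: real assume r: "r > 0"
    have "(\<integral>\<^sup>+t. indicator {t::'a. r \<le> norm t} t * ennreal (norm t powr - (real DIM('a) + a)) \<partial>lborel)
      \<le> ennreal ((B * r powr - a) / (1 - 2 powr - a))"
    proof (rule dyadic_integral_bound[where A = "\<lambda>k. {t. 2 ^ k * r \<le> norm t \<and> norm t < 2 * (2 ^ k * r)}"])
      fix t :: 'a assume "t \<in> {t. r \<le> norm t}"
      then have t: "r \<le> norm t" by simp
      define k where "k = nat \<lfloor>log 2 (norm t / r)\<rfloor>"
      have l0: "log 2 (norm t / r) \<ge> 0" using t r by (subst zero_le_log_cancel_iff) (auto simp: field_simps)
      then have "real k \<le> log 2 (norm t / r)" "log 2 (norm t / r) < real k + 1"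
        by (auto simp: k_def)
      then have "2 powr real k \<le> norm t / r" "norm t / r < 2 powr (real k + 1)"
        using t r le_log_iff[of 2 "norm t / r" "real k"] log_less_iff[of 2 "norm t / r" "real k + 1"]
          divide_pos_pos[of "norm t" r] by (smt (verit))+
      then show "\<exists>k. t \<in> {t. 2 ^ k * r \<le> norm t \<and> norm t < 2 * (2 ^ k * r)}"
        using r by (intro exI[of _ k]) (auto simp: powr_add powr_realpow field_simps)
    next
      fix k :: nat
      have "(2 ^ k * r) powr - a = r powr - a * (2 powr - a) ^ k"
        using r by (simp add: powr_mult powr_realpow[symmetric] powr_powr mult_ac)
      then show "(\<integral>\<^sup>+t. indicator {t::'a. 2 ^ k * r \<le> norm t \<and> norm t < 2 * (2 ^ k * r)} t *
                ennreal (norm t powr - (real DIM('a) + a)) \<partial>lborel)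
         \<le> ennreal (B * r powr - a * (2 powr - a) ^ k)"
        using powr_annulus_integral[of "2 ^ k * r" "- (real DIM('a) + a)", where 'a = 'a] r
        by (simp add: B_def mult_ac)
    qed (use q B r in auto)
    then show "(\<integral>\<^sup>+t. indicator {t::'a. r \<le> norm t} t * ennreal (norm t powr - (real DIM('a) + a)) \<partial>lborel)
      \<le> ennreal (B / (1 - 2 powr - a) * r powr - a)" by simp
  qed
qed

lemma powr_local_integral:
  fixes a :: real
  assumes a: "a > 0"
  shows "\<exists>C\<ge>0. (\<integral>\<^sup>+t. indicator {t::'a::euclidean_space. norm t < 1} t *
           ennreal (norm t powr (a - real DIM('a))) \<partial>lborel) \<le> ennreal C"
proof -
  define B where "B = 2 powr \<bar>a - real DIM('a)\<bar> * unit_ball_vol (real DIM('a)) * 2 ^ DIM('a)"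
  have B: "B \<ge> 0" by (simp add: B_def)
  have q: "0 \<le> (2::real) powr - a" "(2::real) powr - a < 1"
    using a by (auto simp: powr_less_one)
  show ?thesis
  proof (intro exI[of _ "B / (1 - 2 powr - a)"] conjI)
    show "0 \<le> B / (1 - 2 powr - a)" using B q by simp
    show "(\<integral>\<^sup>+t. indicator {t::'a. norm t < 1} t * ennreal (norm t powr (a - real DIM('a))) \<partial>lborel)
      \<le> ennreal (B / (1 - 2 powr - a))"
    proof (rule dyadic_integral_bound[where A = "\<lambda>k. {t. (1/2) ^ Suc k \<le> norm t \<and> norm t < 2 * ((1/2) ^ Suc k)}"])
      fix t :: 'a assume "t \<in> {t. norm t < 1}" "ennreal (norm t powr (a - real DIM('a))) \<noteq> 0"
      then have t: "norm t < 1" "norm t > 0" by auto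
      then obtain n where n: "(1/2::real) ^ n \<le> norm t"
        using real_arch_pow_inv[of "norm t" "1/2"] by (auto intro: less_imp_le)
      define m where "m = (LEAST n. (1/2::real) ^ n \<le> norm t)"
      have m: "(1/2::real) ^ m \<le> norm t"
        unfolding m_def by (rule LeastI[of _ n]) (use n in auto)
      with t have "m \<noteq> 0" by (cases m) auto
      then obtain k where k: "m = Suc k" by (cases m) auto
      have "\<not> (1/2::real) ^ k \<le> norm t"
        using not_less_Least[of k "\<lambda>n. (1/2::real) ^ n \<le> norm t"] k by (simp add: m_def)
      then show "\<exists>k. t \<in> {t. (1/2) ^ Suc k \<le> norm t \<and> norm t < 2 * ((1/2) ^ Suc k)}"
        using m k by (intro exI[of _ k]) auto
    next
      fix k :: nat
      have "((1/2::real) ^ Suc k) = 2 powr - real (Suc k)"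
        by (simp add: powr_minus_divide powr_realpow power_one_over del: of_nat_Suc power_Suc)
      then have "((1/2::real) ^ Suc k) powr a = (2 powr - a) ^ Suc k"
        by (simp only: powr_powr powr_realpow[symmetric, of "2 powr - a"] powr_gt_zero)
          (simp add: mult_ac powr_minus ring_distribs)
      also have "\<dots> \<le> (2 powr - a) ^ k"
        using q by (intro power_decreasing) auto
      finally have "B * ((1/2::real) ^ Suc k) powr a \<le> B * (2 powr - a) ^ k"
        using B by (intro mult_left_mono) auto
      then show "(\<integral>\<^sup>+t. indicator {t::'a. (1/2) ^ Suc k \<le> norm t \<and> norm t < 2 * ((1/2) ^ Suc k)} t *
                ennreal (norm t powr (a - real DIM('a))) \<partial>lborel)
         \<le> ennreal (B * (2 powr - a) ^ k)"
        using order_trans[OF powr_annulus_integral[of "(1/2) ^ Suc k" "a - real DIM('a)", where 'a = 'a] ennreal_leI]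
        by (simp add: B_def del: power_Suc)
    qed (use q B in auto)
  qed
qed

section \<open>Translations and mollification in the mean square\<close>

definition L2sq :: "('a::euclidean_space \<Rightarrow> real) \<Rightarrow> ennreal" where
  "L2sq F = (\<integral>\<^sup>+x. ennreal ((F x)\<^sup>2) \<partial>lborel)"

lemma ennreal_square_add_le: "ennreal ((a + b)\<^sup>2) \<le> 2 * ennreal (a\<^sup>2) + 2 * ennreal (b\<^sup>2)" for a b :: real
proof -
  have "(a + b)\<^sup>2 \<le> 2 * a\<^sup>2 + 2 * b\<^sup>2"
    using sum_squares_bound[of a b] by (simp add: power2_sum)
  then have "ennreal ((a + b)\<^sup>2) \<le> ennreal (2 * a\<^sup>2 + 2 * b\<^sup>2)" by (rule ennreal_leI)
  also have "\<dots> = 2 * ennreal (a\<^sup>2) + 2 * ennreal (b\<^sup>2)"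
    by (subst ennreal_plus) (auto simp: ennreal_mult)
  finally show ?thesis .
qed

lemma L2sq_add_le:
  assumes [measurable]: "F \<in> borel_measurable borel" "G \<in> borel_measurable borel"
  shows "L2sq (\<lambda>x. F x + G x) \<le> 2 * L2sq F + 2 * L2sq G"
proof -
  have "L2sq (\<lambda>x. F x + G x) \<le> (\<integral>\<^sup>+x. 2 * ennreal ((F x)\<^sup>2) + 2 * ennreal ((G x)\<^sup>2) \<partial>lborel)"
    unfolding L2sq_def by (intro nn_integral_mono ennreal_square_add_le)
  also have "\<dots> = 2 * L2sq F + 2 * L2sq G"
    unfolding L2sq_def by (subst nn_integral_add) (auto simp: nn_integral_cmult)
  finally show ?thesis .
qed

lemma L2sq_translate:
  assumes [measurable]: "F \<in> borel_measurable borel"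
  shows "L2sq (\<lambda>x. F (x - t)) = L2sq F"
proof -
  have "L2sq F = (\<integral>\<^sup>+x. ennreal ((F x)\<^sup>2) \<partial>distr lborel borel ((+) (- t)))"
    by (simp add: L2sq_def lborel_distr_plus)
  also have "\<dots> = L2sq (\<lambda>x. F (x - t))"
    by (subst nn_integral_distr) (auto simp: L2sq_def)
  finally show ?thesis by simp
qed

lemma L2sq_dominated:
  fixes F :: "'a::euclidean_space \<Rightarrow> real" and G :: "nat \<Rightarrow> 'a \<Rightarrow> real"
  assumes [measurable]: "\<And>n. G n \<in> borel_measurable borel" "W \<in> borel_measurable borel"
    and bd: "\<And>n x. \<bar>G n x\<bar> \<le> W x" and W: "L2sq W < \<infinity>"
    and lim: "AE x in lborel. (\<lambda>n. G n x) \<longlonglongrightarrow> 0" and \<epsilon>: "\<epsilon> > 0"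
  shows "\<forall>\<^sub>F n in sequentially. L2sq (G n) < \<epsilon>"
proof -
  have "(\<lambda>n. L2sq (G n)) \<longlonglongrightarrow> (\<integral>\<^sup>+x. 0 \<partial>(lborel :: 'a measure))"
    unfolding L2sq_def
  proof (rule nn_integral_dominated_convergence[where w = "\<lambda>x. ennreal ((W x)\<^sup>2)"])
    show "AE x in lborel. ennreal ((G j x)\<^sup>2) \<le> ennreal ((W x)\<^sup>2)" for j
      using bd by (intro AE_I2 ennreal_leI) (metis abs_ge_zero abs_le_square_iff abs_of_nonneg order_trans)
    show "AE x in lborel. (\<lambda>i. ennreal ((G i x)\<^sup>2)) \<longlonglongrightarrow> 0"
      using lim
    proof eventually_elim
      case (elim x)
      then have "(\<lambda>i. (G i x)\<^sup>2) \<longlonglongrightarrow> 0\<^sup>2" by (rule tendsto_power)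
      then show ?case using tendsto_ennrealI by fastforce
    qed
  qed (use W in \<open>auto simp: L2sq_def\<close>)
  then show ?thesis
    using \<epsilon> by (auto dest: order_tendstoD(2))
qed

lemma L2sq_bounded_le:
  fixes F :: "'a::euclidean_space \<Rightarrow> real"
  assumes "\<And>x. \<bar>F x\<bar> \<le> c" "\<And>x. x \<notin> A \<Longrightarrow> F x = 0" "A \<in> sets borel"
  shows "L2sq F \<le> ennreal (c\<^sup>2) * emeasure lborel A"
proof -
  have "(F x)\<^sup>2 \<le> c\<^sup>2" for x
    using assms(1)[of x] by (metis abs_ge_zero abs_le_square_iff abs_of_nonneg order_trans)
  then have "L2sq F \<le> (\<integral>\<^sup>+x. ennreal (c\<^sup>2) * indicator A x \<partial>lborel)"
    unfolding L2sq_def using assms(2)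
    by (intro nn_integral_mono) (auto simp: indicator_def intro!: ennreal_leI)
  also have "\<dots> = ennreal (c\<^sup>2) * emeasure lborel A"
    using assms(3) by (subst nn_integral_cmult_indicator) auto
  finally show ?thesis .
qed

lemma L2_approx_truncated:
  fixes F :: "'a::euclidean_space \<Rightarrow> real"
  assumes [measurable]: "F \<in> borel_measurable borel" and fin: "L2sq F < \<infinity>" and \<epsilon>: "\<epsilon> > 0"
  shows "\<exists>n::nat. L2sq (\<lambda>x. F x - (if \<bar>F x\<bar> \<le> n \<and> norm x \<le> n then F x else 0)) < \<epsilon>"
proof -
  have "\<forall>\<^sub>F n::nat in sequentially. L2sq (\<lambda>x. F x - (if \<bar>F x\<bar> \<le> n \<and> norm x \<le> n then F x else 0)) < \<epsilon>"
  proof (rule L2sq_dominated[where W = "\<lambda>x. \<bar>F x\<bar>"])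
    show "AE x in lborel. (\<lambda>n. F x - (if \<bar>F x\<bar> \<le> real n \<and> norm x \<le> real n then F x else 0)) \<longlonglongrightarrow> 0"
    proof (rule AE_I2, rule tendsto_eventually)
      fix x :: 'a
      obtain N :: nat where N: "\<bar>F x\<bar> + norm x \<le> N" using real_arch_simple by blast
      have "\<bar>F x\<bar> \<le> real n \<and> norm x \<le> real n" if "n \<ge> N" for n
        using N that norm_ge_zero[of x] abs_ge_zero[of "F x"] by linarith
      then show "\<forall>\<^sub>F n in sequentially. F x - (if \<bar>F x\<bar> \<le> real n \<and> norm x \<le> real n then F x else 0) = 0"
        unfolding eventually_sequentially by (intro exI[of _ N]) auto
    qed
  qed (use fin \<epsilon> in \<open>auto simp: L2sq_def\<close>)
  then show ?thesis using eventually_happens by fastforce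
qed

text \<open>
  A measurable function is an a.e. limit of continuous functions. Clamping these to the range of
  \<open>F\<close> and multiplying by a cutoff makes dominated convergence applicable.
\<close>

lemma L2_approx_continuous_bounded:
  fixes F :: "'a::euclidean_space \<Rightarrow> real"
  assumes [measurable]: "F \<in> borel_measurable borel"
    and M: "\<And>x. \<bar>F x\<bar> \<le> M" and R: "\<And>x. norm x > R \<Longrightarrow> F x = 0" and \<epsilon>: "\<epsilon> > 0"
  shows "\<exists>g. continuous_on UNIV g \<and> (\<forall>x. norm x > R + 1 \<longrightarrow> g x = 0) \<and> L2sq (\<lambda>x. F x - g x) < \<epsilon>"
proof -
  have "F measurable_on UNIV"
    using measurable_completion[of F lborel borel] by (intro lebesgue_measurable_imp_measurable_on) auto
  then obtain N g where N: "negligible N" and gc: "\<And>n. continuous_on UNIV (g n)"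
    and gl: "\<And>x. x \<notin> N \<Longrightarrow> (\<lambda>n. g n x) \<longlonglongrightarrow> F x"
    unfolding measurable_on_def by auto
  \<comment> \<open>the cutoff equals 1 on the ball of radius \<open>R\<close>, which carries \<open>F\<close>\<close>
  define k where "k n x = max (- M) (min M (g n x)) * max 0 (min 1 (R + 1 - norm x))" for n x
  have kc: "continuous_on UNIV (k n)" for n
    unfolding k_def by (intro continuous_intros gc)
  have [measurable]: "k n \<in> borel_measurable borel" for n
    using kc by (rule borel_measurable_continuous_onI)
  have M0: "M \<ge> 0" using M[of 0] by simp
  have ks: "k n x = 0" if "norm x > R + 1" for n x using that by (simp add: k_def)
  have kb: "\<bar>k n x\<bar> \<le> M" for n x
  proof -
    have "\<bar>k n x\<bar> \<le> M * 1"
      unfolding k_def abs_mult using M0 by (intro mult_mono) auto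
    then show ?thesis by simp
  qed
  have "\<forall>\<^sub>F n in sequentially. L2sq (\<lambda>x. F x - k n x) < \<epsilon>"
  proof (rule L2sq_dominated[where W = "\<lambda>x. 2 * M * indicator (cball 0 (R + 1)) x"])
    show "\<bar>F x - k n x\<bar> \<le> 2 * M * indicator (cball 0 (R + 1)) x" for n x
      using M[of x] kb[of n x] R[of x] ks[of x n] by (auto simp: indicator_def)
    have "L2sq (\<lambda>x::'a. 2 * M * indicator (cball 0 (R + 1)) x) \<le> ennreal ((2 * M)\<^sup>2) * emeasure lborel (cball (0::'a) (R + 1))"
      using M0 by (intro L2sq_bounded_le) (auto simp: indicator_def)
    also have "\<dots> < \<infinity>"
      using emeasure_lborel_cball_finite[of "0::'a" "R + 1"] by (simp add: ennreal_mult_less_top)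
    finally show "L2sq (\<lambda>x::'a. 2 * M * indicator (cball 0 (R + 1)) x) < \<infinity>" .
    have "AE x in lebesgue. x \<notin> N"
      using N by (intro AE_not_in) (simp add: negligible_iff_null_sets)
    then have "AE x in lborel. x \<notin> N" by (simp add: AE_completion_iff)
    then show "AE x in lborel. (\<lambda>n. F x - k n x) \<longlonglongrightarrow> 0"
    proof eventually_elim
      case (elim x)
      have "(\<lambda>n. k n x) \<longlonglongrightarrow> max (- M) (min M (F x)) * max 0 (min 1 (R + 1 - norm x))"
        unfolding k_def by (intro tendsto_intros gl elim)
      moreover have "max (- M) (min M (F x)) * max 0 (min 1 (R + 1 - norm x)) = F x"
        using M[of x] R[of x] by (cases "norm x > R") (auto simp: min_def max_def)
      ultimately have "(\<lambda>n. k n x) \<longlonglongrightarrow> F x" by simp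
      then have "(\<lambda>n. F x - k n x) \<longlonglongrightarrow> F x - F x" by (intro tendsto_intros)
      then show ?case by simp
    qed
  qed (use \<epsilon> in \<open>auto intro!: borel_measurable_times borel_measurable_indicator\<close>)
  then obtain n where "L2sq (\<lambda>x. F x - k n x) < \<epsilon>"
    using eventually_happens by fastforce
  then show ?thesis using kc ks by blast
qed

text \<open>
  The usual three-term argument: replace \<open>F\<close> by a continuous function with bounded support, for which
  uniform continuity gives the claim.
\<close>

lemma translation_continuous_L2:
  fixes F :: "'a::euclidean_space \<Rightarrow> real"
  assumes [measurable]: "F \<in> borel_measurable borel" and fin: "L2sq F < \<infinity>" and \<epsilon>: "(\<epsilon>::real) > 0"
  shows "\<exists>\<delta>>0. \<forall>t. norm t < \<delta> \<longrightarrow> L2sq (\<lambda>x. F x - F (x - t)) \<le> ennreal \<epsilon>"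
proof -
  define e where "e = \<epsilon> / 28"
  have e: "e > 0" using \<epsilon> by (simp add: e_def)
  obtain n :: nat where n: "L2sq (\<lambda>x. F x - (if \<bar>F x\<bar> \<le> n \<and> norm x \<le> n then F x else 0)) < ennreal e"
    using L2_approx_truncated[OF assms(1) fin, of "ennreal e"] e by auto
  define F1 where "F1 x = (if \<bar>F x\<bar> \<le> n \<and> norm x \<le> n then F x else 0)" for x
  have F1m[measurable]: "F1 \<in> borel_measurable borel" unfolding F1_def by measurable
  have F1b: "\<bar>F1 x\<bar> \<le> real n" "norm x > real n \<Longrightarrow> F1 x = 0" for x
    by (auto simp: F1_def)
  obtain g where gc: "continuous_on UNIV g" and gs: "\<And>x. norm x > real n + 1 \<Longrightarrow> g x = 0"
    and g: "L2sq (\<lambda>x. F1 x - g x) < ennreal e"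
    using L2_approx_continuous_bounded[OF F1m F1b, where \<epsilon> = "ennreal e"] e by auto
  have [measurable]: "g \<in> borel_measurable borel"
    using gc by (rule borel_measurable_continuous_onI)
  have Fg: "L2sq (\<lambda>x. F x - g x) \<le> ennreal (4 * e)"
  proof -
    have "L2sq (\<lambda>x. F x - g x) = L2sq (\<lambda>x. (F x - F1 x) + (F1 x - g x))" by simp
    also have "\<dots> \<le> 2 * L2sq (\<lambda>x. F x - F1 x) + 2 * L2sq (\<lambda>x. F1 x - g x)"
      by (intro L2sq_add_le) measurable
    also have "\<dots> \<le> 2 * ennreal e + 2 * ennreal e"
      using n g by (intro add_mono mult_left_mono) (auto simp: F1_def)
    also have "\<dots> = ennreal (4 * e)"
      using e by (simp add: ennreal_mult flip: mult_2)
    finally show ?thesis .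
  qed
  define V where "V = measure lborel (cball (0::'a) (real n + 2))"
  have V: "V \<ge> 0" "emeasure lborel (cball (0::'a) (real n + 2)) = ennreal V"
    using emeasure_lborel_cball_finite[of "0::'a" "real n + 2"]
    by (auto simp: V_def less_top[symmetric] intro!: emeasure_eq_ennreal_measure)
  define c where "c = sqrt (e / (V + 1))"
  have c: "c > 0" "c\<^sup>2 * V \<le> e"
    using e V by (auto simp: c_def field_simps)
  have "uniformly_continuous_on (cball 0 (real n + 3)) g"
    by (intro compact_uniformly_continuous continuous_on_subset[OF gc]) auto
  then obtain \<delta> where \<delta>: "\<delta> > 0" "\<And>x y. x \<in> cball 0 (real n + 3) \<Longrightarrow> y \<in> cball 0 (real n + 3) \<Longrightarrow> dist y x < \<delta> \<Longrightarrow> dist (g y) (g x) < c"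
    using c(1) unfolding uniformly_continuous_on_def by meson
  show ?thesis
  proof (intro exI[of _ "min \<delta> 1"] conjI allI impI)
    fix t :: 'a assume t: "norm t < min \<delta> 1"
    have "L2sq (\<lambda>x. g x - g (x - t)) \<le> ennreal (c\<^sup>2) * emeasure lborel (cball (0::'a) (real n + 2))"
    proof (rule L2sq_bounded_le)
      fix x
      show "\<bar>g x - g (x - t)\<bar> \<le> c"
      proof (cases "norm x \<le> real n + 2")
        case True
        then have "x \<in> cball 0 (real n + 3)" "x - t \<in> cball 0 (real n + 3)"
          using t norm_triangle_ineq4[of x t] by auto
        then show ?thesis using \<delta>(2)[of "x - t" x] t by (auto simp: dist_norm)
      next
        case False
        then have "norm (x - t) > real n + 1"
          using t norm_triangle_ineq2[of x t] by auto
        then show ?thesis using False gs[of x] gs[of "x - t"] c by auto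
      qed
      assume "x \<notin> cball 0 (real n + 2)"
      then have "norm (x - t) > real n + 1" "norm x > real n + 1"
        using t norm_triangle_ineq2[of x t] by auto
      then show "g x - g (x - t) = 0" using gs by auto
    qed auto
    also have "\<dots> \<le> ennreal e"
      using c V by (simp add: ennreal_mult[symmetric] ennreal_leI)
    finally have gt: "L2sq (\<lambda>x. g x - g (x - t)) \<le> ennreal e" .
    have tr: "L2sq (\<lambda>x. g (x - t) - F (x - t)) = L2sq (\<lambda>x. F x - g x)"
      using L2sq_translate[of "\<lambda>x. F x - g x" t] by (simp add: L2sq_def power2_commute)
    have "L2sq (\<lambda>x. F x - F (x - t)) = L2sq (\<lambda>x. (F x - g x) + ((g x - g (x - t)) + (g (x - t) - F (x - t))))"
      by simp
    also have "\<dots> \<le> 2 * L2sq (\<lambda>x. F x - g x) + 2 * L2sq (\<lambda>x. (g x - g (x - t)) + (g (x - t) - F (x - t)))"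
      by (intro L2sq_add_le) measurable
    also have "\<dots> \<le> 2 * L2sq (\<lambda>x. F x - g x) + 2 * (2 * L2sq (\<lambda>x. g x - g (x - t)) + 2 * L2sq (\<lambda>x. g (x - t) - F (x - t)))"
      by (intro add_mono mult_left_mono L2sq_add_le order_refl) simp_all
    also have "\<dots> \<le> 2 * ennreal (4 * e) + 2 * (2 * ennreal e + 2 * ennreal (4 * e))"
      unfolding tr by (intro add_mono mult_left_mono Fg gt) auto
    also have "\<dots> = ennreal (28 * e)"
      using e by (simp add: ennreal_mult mult.assoc[symmetric] flip: distrib_right)
    finally show "L2sq (\<lambda>x. F x - F (x - t)) \<le> ennreal \<epsilon>"
      by (simp add: e_def)
  qed (use \<delta> in auto)
qed

text \<open>
  Jensen's inequality for the square, from the nonnegativity of the variance.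
\<close>

lemma square_average_le:
  fixes \<rho> h :: "'a::euclidean_space \<Rightarrow> real"
  assumes [measurable]: "\<rho> \<in> borel_measurable borel" "h \<in> borel_measurable borel"
    and nn: "\<And>z. \<rho> z \<ge> 0" and one: "integrable lborel \<rho>" "(LINT z|lborel. \<rho> z) = 1"
    and bd: "\<And>z. \<bar>h z\<bar> \<le> B"
  shows "ennreal ((LINT z|lborel. \<rho> z * h z)\<^sup>2) \<le> (\<integral>\<^sup>+z. ennreal (\<rho> z) * ennreal ((h z)\<^sup>2) \<partial>lborel)"
proof -
  have B0: "B \<ge> 0" using bd[of 0] by simp
  have i1: "integrable lborel (\<lambda>z. \<rho> z * h z)"
  proof (rule Bochner_Integration.integrable_bound)
    show "integrable lborel (\<lambda>z. B * \<rho> z)" using one by simp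
    show "AE z in lborel. norm (\<rho> z * h z) \<le> norm (B * \<rho> z)"
      using nn bd B0 by (intro AE_I2) (simp add: abs_mult mult.commute[of _ "\<rho> _"] mult_left_mono)
  qed simp
  have i2: "integrable lborel (\<lambda>z. \<rho> z * (h z)\<^sup>2)"
  proof (rule Bochner_Integration.integrable_bound)
    show "integrable lborel (\<lambda>z. B\<^sup>2 * \<rho> z)" using one by simp
    have "(h z)\<^sup>2 \<le> B\<^sup>2" for z
      using bd[of z] by (metis abs_ge_zero abs_le_square_iff abs_of_nonneg order_trans)
    then show "AE z in lborel. norm (\<rho> z * (h z)\<^sup>2) \<le> norm (B\<^sup>2 * \<rho> z)"
      using nn by (intro AE_I2) (simp add: abs_mult mult.commute[of _ "\<rho> _"] mult_left_mono)
  qed simp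
  define m where "m = (LINT z|lborel. \<rho> z * h z)"
  have "0 \<le> (LINT z|lborel. \<rho> z * (h z - m)\<^sup>2)"
    using nn by (intro integral_nonneg_AE AE_I2) simp
  also have "(\<lambda>z. \<rho> z * (h z - m)\<^sup>2) = (\<lambda>z. \<rho> z * (h z)\<^sup>2 - 2 * m * (\<rho> z * h z) + m\<^sup>2 * \<rho> z)"
    by (auto simp: power2_eq_square algebra_simps)
  also have "(LINT z|lborel. \<rho> z * (h z)\<^sup>2 - 2 * m * (\<rho> z * h z) + m\<^sup>2 * \<rho> z)
      = (LINT z|lborel. \<rho> z * (h z)\<^sup>2) - 2 * m * m + m\<^sup>2"
    using i1 i2 one by (simp add: m_def)
  finally have "m\<^sup>2 \<le> (LINT z|lborel. \<rho> z * (h z)\<^sup>2)"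
    by (simp add: power2_eq_square)
  then have "ennreal (m\<^sup>2) \<le> ennreal (LINT z|lborel. \<rho> z * (h z)\<^sup>2)" by (rule ennreal_leI)
  also have "\<dots> = (\<integral>\<^sup>+z. ennreal (\<rho> z * (h z)\<^sup>2) \<partial>lborel)"
    using i2 nn by (intro nn_integral_eq_integral[symmetric]) auto
  also have "\<dots> = (\<integral>\<^sup>+z. ennreal (\<rho> z) * ennreal ((h z)\<^sup>2) \<partial>lborel)"
    using nn by (intro nn_integral_cong) (simp add: ennreal_mult)
  finally show ?thesis by (simp add: m_def)
qed

text \<open>
  An average of the differences \<open>F - F(\<cdot> - t)\<close> is no larger in the mean square than the largest of
  them. The shift \<open>t z\<close> lives in another space than the averaging variable \<open>z\<close>, because differences
  of \<open>v\<close> are averaged over diagonal shifts \<open>(z, z)\<close> of the product space.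
\<close>

lemma L2sq_average_translates:
  fixes \<rho> :: "'a::euclidean_space \<Rightarrow> real" and G :: "'b::euclidean_space \<Rightarrow> real" and t :: "'a \<Rightarrow> 'b"
  assumes [measurable]: "\<rho> \<in> borel_measurable borel" "G \<in> borel_measurable borel" "t \<in> borel_measurable borel"
    and nn: "\<And>z. \<rho> z \<ge> 0" and one: "integrable lborel \<rho>" "(LINT z|lborel. \<rho> z) = 1"
    and bd: "\<And>z. \<rho> z \<noteq> 0 \<Longrightarrow> L2sq (\<lambda>p. G p - G (p - t z)) \<le> e"
    and W: "\<And>p. ennreal ((W p)\<^sup>2) \<le> (\<integral>\<^sup>+z. ennreal (\<rho> z) * ennreal ((G p - G (p - t z))\<^sup>2) \<partial>lborel)"
  shows "L2sq W \<le> e"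
proof -
  have "L2sq W \<le> (\<integral>\<^sup>+p. (\<integral>\<^sup>+z. ennreal (\<rho> z) * ennreal ((G p - G (p - t z))\<^sup>2) \<partial>lborel) \<partial>lborel)"
    unfolding L2sq_def by (intro nn_integral_mono W)
  also have "\<dots> = (\<integral>\<^sup>+z. (\<integral>\<^sup>+p. ennreal (\<rho> z) * ennreal ((G p - G (p - t z))\<^sup>2) \<partial>lborel) \<partial>lborel)"
    by (rule lborel_pair.Fubini') measurable
  also have "\<dots> = (\<integral>\<^sup>+z. ennreal (\<rho> z) * L2sq (\<lambda>p. G p - G (p - t z)) \<partial>lborel)"
    unfolding L2sq_def by (intro nn_integral_cong nn_integral_cmult) measurable
  also have "\<dots> \<le> (\<integral>\<^sup>+z. ennreal (\<rho> z) * e \<partial>lborel)"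
    using bd by (intro nn_integral_mono) (metis ennreal_0 mult_left_mono mult_zero_left zero_le order_refl)
  also have "\<dots> = (\<integral>\<^sup>+z. ennreal (\<rho> z) \<partial>lborel) * e"
    by (rule nn_integral_multc) measurable
  also have "(\<integral>\<^sup>+z. ennreal (\<rho> z) \<partial>lborel) = 1"
    using one nn by (subst nn_integral_eq_integral) auto
  finally show ?thesis by simp
qed

section \<open>The energy as a nonnegative integral\<close>

definition kern :: "real \<Rightarrow> 'a::euclidean_space \<Rightarrow> real" where
  "kern s t = norm t powr - (real DIM('a) + 2 * s)"

lemma kern_nonneg [simp]: "kern s t \<ge> 0"
  by (simp add: kern_def)

lemma kern_minus_commute: "kern s (x - y) = kern s (y - x)"
  by (simp add: kern_def norm_minus_commute)

lemma kern_measurable [measurable]: "kern s \<in> borel_measurable borel"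
  unfolding kern_def by measurable

lemma X_integrand_kern:
  fixes p :: "'a::euclidean_space \<times> 'a"
  shows "X_integrand s u v p = (u (fst p) - u (snd p)) * (v (fst p) - v (snd p)) * kern s (fst p - snd p)"
  using powr_minus_divide[of "norm (fst p - snd p)" "real DIM('a) + 2 * s"]
  by (cases p) (simp add: X_integrand_def kern_def)

definition visible_pairs :: "'a::euclidean_space set \<Rightarrow> ('a \<times> 'a) set" where
  "visible_pairs \<Omega> = (UNIV \<times> UNIV) - (ext \<Omega> \<times> ext \<Omega>)"

lemma in_visible_iff: "p \<in> visible_pairs \<Omega> \<longleftrightarrow> fst p \<in> closure \<Omega> \<or> snd p \<in> closure \<Omega>"
  by (cases p) (auto simp: visible_pairs_def ext_def)

lemma visible_pairs_borel [measurable]: "visible_pairs \<Omega> \<in> sets borel"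
proof -
  have "open (ext \<Omega> \<times> ext \<Omega>)" by (auto simp: ext_def intro!: open_Times)
  then show ?thesis by (auto simp: visible_pairs_def UNIV_Times_UNIV)
qed

text \<open>
  The double integral of the form without its normalizing constant, valued in the extended
  nonnegative reals so that it is meaningful for every function.
\<close>

definition energy :: "real \<Rightarrow> 'a::euclidean_space set \<Rightarrow> ('a \<Rightarrow> real) \<Rightarrow> ennreal" where
  "energy s \<Omega> v = (\<integral>\<^sup>+p. indicator (visible_pairs \<Omega>) p *
     ennreal ((v (fst p) - v (snd p))\<^sup>2 * kern s (fst p - snd p)) \<partial>lborel)"

definition L2sq_on :: "'a::euclidean_space set \<Rightarrow> ('a \<Rightarrow> real) \<Rightarrow> ennreal" where
  "L2sq_on \<Omega> v = (\<integral>\<^sup>+x. indicator \<Omega> x * ennreal ((v x)\<^sup>2) \<partial>lborel)"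

text \<open>
  Up to the factor in front of the energy this is the square of the norm of the energy space; the two
  vanish together in a limit.
\<close>

definition V_sq :: "real \<Rightarrow> 'a::euclidean_space set \<Rightarrow> ('a \<Rightarrow> real) \<Rightarrow> ennreal" where
  "V_sq s \<Omega> v = L2sq_on \<Omega> v + energy s \<Omega> v"

lemma fst_snd_borel [measurable]:
  "(fst :: 'a::euclidean_space \<times> 'a \<Rightarrow> 'a) \<in> borel_measurable borel"
  "(snd :: 'a::euclidean_space \<times> 'a \<Rightarrow> 'a) \<in> borel_measurable borel"
  by (auto intro!: borel_measurable_continuous_onI continuous_intros)

lemma energy_integrand_measurable [measurable]:
  assumes [measurable]: "v \<in> borel_measurable borel"
  shows "(\<lambda>p. (v (fst p) - v (snd p))\<^sup>2 * kern s (fst p - snd p)) \<in> borel_measurable borel"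
  by measurable

lemma V_sq_add_le:
  assumes [measurable]: "u \<in> borel_measurable borel" "v \<in> borel_measurable borel" "\<Omega> \<in> sets borel"
  shows "V_sq s \<Omega> (\<lambda>x. u x + v x) \<le> 2 * V_sq s \<Omega> u + 2 * V_sq s \<Omega> v"
proof -
  have 1: "L2sq_on \<Omega> (\<lambda>x. u x + v x)
     \<le> 2 * L2sq_on \<Omega> u + 2 * L2sq_on \<Omega> v"
  proof -
    have "L2sq_on \<Omega> (\<lambda>x. u x + v x)
      \<le> (\<integral>\<^sup>+x. 2 * (indicator \<Omega> x * ennreal ((u x)\<^sup>2)) + 2 * (indicator \<Omega> x * ennreal ((v x)\<^sup>2)) \<partial>lborel)"
      unfolding L2sq_on_def
      using ennreal_square_add_le by (intro nn_integral_mono) (auto simp: indicator_def)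
    then show ?thesis by (simp add: nn_integral_add nn_integral_cmult L2sq_on_def)
  qed
  have 2: "energy s \<Omega> (\<lambda>x. u x + v x) \<le> 2 * energy s \<Omega> u + 2 * energy s \<Omega> v"
  proof -
    have *: "ennreal ((u x + v x - (u y + v y))\<^sup>2 * k)
      \<le> 2 * ennreal ((u x - u y)\<^sup>2 * k) + 2 * ennreal ((v x - v y)\<^sup>2 * k)" if "k \<ge> 0" for x y k
    proof -
      have e: "u x + v x - (u y + v y) = (u x - u y) + (v x - v y)" by simp
      have "ennreal ((u x + v x - (u y + v y))\<^sup>2) * ennreal k
        \<le> (2 * ennreal ((u x - u y)\<^sup>2) + 2 * ennreal ((v x - v y)\<^sup>2)) * ennreal k"
        unfolding e by (intro mult_right_mono ennreal_square_add_le) auto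
      then show ?thesis using that by (simp add: ennreal_mult distrib_right mult.assoc)
    qed
    have "energy s \<Omega> (\<lambda>x. u x + v x) \<le> (\<integral>\<^sup>+p.
       2 * (indicator (visible_pairs \<Omega>) p * ennreal ((u (fst p) - u (snd p))\<^sup>2 * kern s (fst p - snd p))) +
       2 * (indicator (visible_pairs \<Omega>) p * ennreal ((v (fst p) - v (snd p))\<^sup>2 * kern s (fst p - snd p))) \<partial>lborel)"
      unfolding energy_def using * by (intro nn_integral_mono) (auto simp: indicator_def)
    then show ?thesis unfolding energy_def by (simp add: nn_integral_add nn_integral_cmult)
  qed
  show ?thesis
    unfolding V_sq_def using add_mono[OF 1 2] by (simp add: distrib_left ac_simps)
qed

lemma V_sq_triangle:
  assumes [measurable]: "u \<in> borel_measurable borel" "v \<in> borel_measurable borel" "w \<in> borel_measurable borel" "\<Omega> \<in> sets borel"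
    and "0 \<le> a" "0 \<le> b" "V_sq s \<Omega> (\<lambda>x. u x - v x) \<le> ennreal a" "V_sq s \<Omega> (\<lambda>x. v x - w x) \<le> ennreal b"
  shows "V_sq s \<Omega> (\<lambda>x. u x - w x) \<le> ennreal (2 * a + 2 * b)"
proof -
  have "V_sq s \<Omega> (\<lambda>x. u x - w x) \<le> 2 * V_sq s \<Omega> (\<lambda>x. u x - v x) + 2 * V_sq s \<Omega> (\<lambda>x. v x - w x)"
    using V_sq_add_le[of "\<lambda>x. u x - v x" "\<lambda>x. v x - w x" \<Omega> s] by simp
  also have "\<dots> \<le> 2 * ennreal a + 2 * ennreal b"
    using assms by (intro add_mono mult_left_mono) auto
  also have "\<dots> = ennreal (2 * a + 2 * b)"
    using assms by (simp add: ennreal_mult)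
  finally show ?thesis .
qed

lemma nn_integral_reflect_translate:
  fixes \<phi> :: "'a::euclidean_space \<Rightarrow> ennreal"
  assumes [measurable]: "\<phi> \<in> borel_measurable borel"
  shows "(\<integral>\<^sup>+y. \<phi> (x - y) \<partial>lborel) = (\<integral>\<^sup>+t. \<phi> t \<partial>lborel)"
    and "(\<integral>\<^sup>+y. \<phi> (y - x) \<partial>lborel) = (\<integral>\<^sup>+t. \<phi> t \<partial>lborel)"
proof -
  have 1: "(\<integral>\<^sup>+y. \<phi> (y - x) \<partial>lborel) = (\<integral>\<^sup>+t. \<phi> t \<partial>lborel)"
    if [measurable]: "\<phi> \<in> borel_measurable borel" for x and \<phi> :: "'a \<Rightarrow> ennreal"
  proof -
    have "(\<integral>\<^sup>+t. \<phi> t \<partial>lborel) = (\<integral>\<^sup>+t. \<phi> t \<partial>distr lborel borel ((+) (- x)))"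
      by (simp add: lborel_distr_plus)
    also have "\<dots> = (\<integral>\<^sup>+y. \<phi> (y - x) \<partial>lborel)"
      by (subst nn_integral_distr) auto
    finally show ?thesis by simp
  qed
  have "distr lborel borel uminus = (lborel :: 'a measure)"
    by (subst lborel_affine[of "-1" 0]) (auto simp: density_1 one_ennreal_def[symmetric])
  then have "(\<integral>\<^sup>+t. \<phi> t \<partial>lborel) = (\<integral>\<^sup>+t. \<phi> t \<partial>distr lborel borel uminus)"
    by simp
  also have "\<dots> = (\<integral>\<^sup>+t. \<phi> (- t) \<partial>lborel)"
    by (subst nn_integral_distr) auto
  also have "\<dots> = (\<integral>\<^sup>+y. \<phi> (- (y - x)) \<partial>lborel)"
    by (rule 1[symmetric, of "\<lambda>t. \<phi> (- t)"]) measurable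
  finally show "(\<integral>\<^sup>+y. \<phi> (x - y) \<partial>lborel) = (\<integral>\<^sup>+t. \<phi> t \<partial>lborel)" by simp
  show "(\<integral>\<^sup>+y. \<phi> (y - x) \<partial>lborel) = (\<integral>\<^sup>+t. \<phi> t \<partial>lborel)" by (rule 1) measurable
qed

text \<open>
  Tonelli's theorem and translation invariance.
\<close>

lemma nn_integral_times_difference:
  fixes a \<phi> :: "'a::euclidean_space \<Rightarrow> ennreal"
  assumes [measurable]: "a \<in> borel_measurable borel" "\<phi> \<in> borel_measurable borel"
  shows "(\<integral>\<^sup>+p. a (fst p) * \<phi> (fst p - snd p) \<partial>lborel) = (\<integral>\<^sup>+x. a x \<partial>lborel) * (\<integral>\<^sup>+t. \<phi> t \<partial>lborel)"
    and "(\<integral>\<^sup>+p. a (snd p) * \<phi> (fst p - snd p) \<partial>lborel) = (\<integral>\<^sup>+x. a x \<partial>lborel) * (\<integral>\<^sup>+t. \<phi> t \<partial>lborel)"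
proof -
  have "(\<integral>\<^sup>+p. a (fst p) * \<phi> (fst p - snd p) \<partial>lborel) = (\<integral>\<^sup>+p. a (fst p) * \<phi> (fst p - snd p) \<partial>(lborel \<Otimes>\<^sub>M lborel))"
    by (simp add: lborel_prod)
  also have "\<dots> = (\<integral>\<^sup>+x. \<integral>\<^sup>+y. a x * \<phi> (x - y) \<partial>lborel \<partial>lborel)"
    by (subst lborel.nn_integral_fst[symmetric]) (auto simp: lborel_prod)
  finally show "(\<integral>\<^sup>+p. a (fst p) * \<phi> (fst p - snd p) \<partial>lborel) = (\<integral>\<^sup>+x. a x \<partial>lborel) * (\<integral>\<^sup>+t. \<phi> t \<partial>lborel)"
    by (simp add: nn_integral_cmult nn_integral_multc nn_integral_reflect_translate)
  have "(\<integral>\<^sup>+p. a (snd p) * \<phi> (fst p - snd p) \<partial>lborel) = (\<integral>\<^sup>+p. a (snd p) * \<phi> (fst p - snd p) \<partial>(lborel \<Otimes>\<^sub>M lborel))"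
    by (simp add: lborel_prod)
  also have "\<dots> = (\<integral>\<^sup>+y. \<integral>\<^sup>+x. a y * \<phi> (x - y) \<partial>lborel \<partial>lborel)"
    by (subst lborel_pair.nn_integral_snd[symmetric]) (auto simp: lborel_prod)
  finally show "(\<integral>\<^sup>+p. a (snd p) * \<phi> (fst p - snd p) \<partial>lborel) = (\<integral>\<^sup>+x. a x \<partial>lborel) * (\<integral>\<^sup>+t. \<phi> t \<partial>lborel)"
    by (simp add: nn_integral_cmult nn_integral_multc nn_integral_reflect_translate)
qed

text \<open>
  A bound of the integrand that only depends on \<open>x - y\<close> integrates over one variable in the bounded
  set \<open>closure \<Omega>\<close> and over the difference; the factor 2 accounts for which variable lies there.
\<close>

lemma energy_le_convolution:
  fixes \<phi> :: "'a::euclidean_space \<Rightarrow> ennreal"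
  assumes [measurable]: "\<phi> \<in> borel_measurable borel"
    and bd: "\<And>x y. x \<in> closure \<Omega> \<or> y \<in> closure \<Omega> \<Longrightarrow> ennreal ((v x - v y)\<^sup>2 * kern s (x - y)) \<le> \<phi> (x - y)"
  shows "energy s \<Omega> v \<le> 2 * emeasure lborel (closure \<Omega>) * (\<integral>\<^sup>+t. \<phi> t \<partial>lborel)"
proof -
  have [measurable]: "closure \<Omega> \<in> sets borel" by auto
  have "energy s \<Omega> v \<le> (\<integral>\<^sup>+p. indicator (closure \<Omega>) (fst p) * \<phi> (fst p - snd p)
      + indicator (closure \<Omega>) (snd p) * \<phi> (fst p - snd p) \<partial>lborel)"
    unfolding energy_def
  proof (intro nn_integral_mono)
    fix p :: "'a \<times> 'a"
    show "indicator (visible_pairs \<Omega>) p * ennreal ((v (fst p) - v (snd p))\<^sup>2 * kern s (fst p - snd p))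
      \<le> indicator (closure \<Omega>) (fst p) * \<phi> (fst p - snd p) + indicator (closure \<Omega>) (snd p) * \<phi> (fst p - snd p)"
      using bd[of "fst p" "snd p"]
      by (cases "fst p \<in> closure \<Omega>"; cases "snd p \<in> closure \<Omega>")
        (simp_all add: in_visible_iff add_increasing indicator_def)
  qed
  also have "\<dots> = 2 * emeasure lborel (closure \<Omega>) * (\<integral>\<^sup>+t. \<phi> t \<partial>lborel)"
    by (subst nn_integral_add) (auto simp: nn_integral_times_difference mult_2 distrib_right)
  finally show ?thesis .
qed

text \<open>
  Lipschitz continuity where the kernel is singular. A global condition would exclude the discrete
  functions, which may jump at the boundary of the mesh.
\<close>

definition near_Lipschitz :: "'a::metric_space set \<Rightarrow> real \<Rightarrow> ('a \<Rightarrow> real) \<Rightarrow> bool" where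
  "near_Lipschitz \<Omega> L v \<longleftrightarrow>
     (\<forall>x y. x \<in> closure \<Omega> \<longrightarrow> dist x y < 1 \<longrightarrow> \<bar>v x - v y\<bar> \<le> L * dist x y)"

text \<open>
  Close to the diagonal \<open>\<bar>v x - v y\<bar>\<close> is at most both \<open>\<eta>\<close> and \<open>L \<bar>x - y\<bar>\<close>, so its square is at most
  \<open>\<eta> powr (1 - s) * (L \<bar>x - y\<bar>) powr (1 + s)\<close>: this leaves an integrable singularity, of order
  \<open>1 - s - d\<close>, and a positive power of \<open>\<eta>\<close>. At distance at least 1 the kernel itself is integrable.
\<close>

lemma energy_Lipschitz_bound:
  fixes \<Omega> :: "'a::euclidean_space set"
  assumes \<Omega>: "bounded \<Omega>" and s: "0 < s" "s < 1"
  shows "\<exists>C\<ge>0. \<forall>(v::'a \<Rightarrow> real) L \<eta>. L \<ge> 0 \<longrightarrow>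
     (\<forall>x y. x \<in> closure \<Omega> \<longrightarrow> \<bar>v x - v y\<bar> \<le> \<eta>) \<longrightarrow>
     near_Lipschitz \<Omega> L v \<longrightarrow>
     energy s \<Omega> v \<le> ennreal (C * (\<eta> powr (1 - s) * L powr (1 + s) + \<eta>\<^sup>2))"
proof -
  obtain C1 where C1: "C1 \<ge> 0" "(\<integral>\<^sup>+t. indicator {t::'a. norm t < 1} t *
           ennreal (norm t powr ((1 - s) - real DIM('a))) \<partial>lborel) \<le> ennreal C1"
    using powr_local_integral[of "1 - s", where 'a = 'a] s by auto
  obtain C2 where C2: "C2 \<ge> 0" "(\<integral>\<^sup>+t. indicator {t::'a. 1 \<le> norm t} t *
           ennreal (norm t powr - (real DIM('a) + 2 * s)) \<partial>lborel) \<le> ennreal C2"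
    using powr_tail_integral[of "2 * s", where 'a = 'a] s by (auto dest: spec[of _ 1])
  define V where "V = measure lborel (closure \<Omega>)"
  have "emeasure lborel (closure \<Omega>) < \<infinity>"
    using \<Omega> by (intro emeasure_bounded_finite) auto
  then have V: "V \<ge> 0" "emeasure lborel (closure \<Omega>) = ennreal V"
    by (auto simp: V_def less_top[symmetric] intro!: emeasure_eq_ennreal_measure)
  show ?thesis
  proof (intro exI[of _ "2 * V * (C1 + C2)"] conjI allI impI)
    show "2 * V * (C1 + C2) \<ge> 0" using V C1 C2 by simp
    fix v :: "'a \<Rightarrow> real" and L \<eta> :: real
    assume L: "L \<ge> 0" and \<eta>: "\<forall>x y. x \<in> closure \<Omega> \<longrightarrow> \<bar>v x - v y\<bar> \<le> \<eta>"
      and Lip: "near_Lipschitz \<Omega> L v"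
    define A where "A = \<eta> powr (1 - s) * L powr (1 + s)"
    have A: "A \<ge> 0" by (simp add: A_def)
    define \<phi> where "\<phi> t = ennreal A * (indicator {t. norm t < 1} t * ennreal (norm t powr ((1 - s) - real DIM('a))))
      + ennreal (\<eta>\<^sup>2) * (indicator {t. 1 \<le> norm t} t * ennreal (norm t powr - (real DIM('a) + 2 * s)))" for t :: 'a
    have bd: "(v x - v y)\<^sup>2 * kern s (x - y) \<le> (if norm (x - y) < 1 then A * norm (x - y) powr ((1 - s) - real DIM('a))
        else \<eta>\<^sup>2 * kern s (x - y))" if x: "x \<in> closure \<Omega>" for x y
    proof (cases "norm (x - y) < 1")
      case True
      show ?thesis
      proof (cases "v x = v y")
        case True
        then show ?thesis using A by simp
      next
        case False
        define a where "a = \<bar>v x - v y\<bar>"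
        have a: "a > 0" "a \<le> \<eta>" "a \<le> L * norm (x - y)"
          using False \<eta> Lip[unfolded near_Lipschitz_def] x True by (auto simp: a_def dist_norm)
        have xy: "norm (x - y) > 0" using False by auto
        have "(v x - v y)\<^sup>2 = a powr 2" using a(1) by (simp add: a_def)
        also have "\<dots> = a powr (1 - s) * a powr (1 + s)" by (simp flip: powr_add)
        also have "\<dots> \<le> \<eta> powr (1 - s) * (L * norm (x - y)) powr (1 + s)"
          using a s by (intro mult_mono powr_mono2) auto
        also have "\<dots> = A * norm (x - y) powr (1 + s)"
          using L by (simp add: powr_mult A_def)
        finally have "(v x - v y)\<^sup>2 * kern s (x - y) \<le> A * (norm (x - y) powr (1 + s) * kern s (x - y))"
          by (simp add: mult_right_mono mult.assoc[symmetric])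
        also have "norm (x - y) powr (1 + s) * kern s (x - y) = norm (x - y) powr ((1 - s) - real DIM('a))"
          by (simp add: kern_def algebra_simps flip: powr_add)
        finally show ?thesis using True by simp
      qed
    next
      case False
      have "(v x - v y)\<^sup>2 \<le> \<eta>\<^sup>2"
        using \<eta>[rule_format, OF x, of y] by (simp add: abs_le_square_iff[symmetric])
      then show ?thesis using False by (simp add: mult_right_mono)
    qed
    have bd': "ennreal ((v x - v y)\<^sup>2 * kern s (x - y)) \<le> \<phi> (x - y)" if "x \<in> closure \<Omega> \<or> y \<in> closure \<Omega>" for x y
    proof -
      have "(v x - v y)\<^sup>2 * kern s (x - y) \<le> (if norm (x - y) < 1 then A * norm (x - y) powr ((1 - s) - real DIM('a))
        else \<eta>\<^sup>2 * kern s (x - y))"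
        using that bd[of x y] bd[of y x] by (auto simp: power2_commute norm_minus_commute kern_minus_commute)
      then have "ennreal ((v x - v y)\<^sup>2 * kern s (x - y)) \<le> ennreal (if norm (x - y) < 1 then A * norm (x - y) powr ((1 - s) - real DIM('a))
        else \<eta>\<^sup>2 * kern s (x - y))" by (rule ennreal_leI)
      also have "\<dots> = \<phi> (x - y)"
        using A by (simp add: \<phi>_def kern_def ennreal_mult)
      finally show ?thesis .
    qed
    have "energy s \<Omega> v \<le> 2 * emeasure lborel (closure \<Omega>) * (\<integral>\<^sup>+t. \<phi> t \<partial>lborel)"
      by (rule energy_le_convolution[OF _ bd']) (auto simp: \<phi>_def)
    also have "(\<integral>\<^sup>+t. \<phi> t \<partial>lborel) = ennreal A * (\<integral>\<^sup>+t. indicator {t::'a. norm t < 1} t *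
           ennreal (norm t powr ((1 - s) - real DIM('a))) \<partial>lborel)
       + ennreal (\<eta>\<^sup>2) * (\<integral>\<^sup>+t. indicator {t::'a. 1 \<le> norm t} t *
           ennreal (norm t powr - (real DIM('a) + 2 * s)) \<partial>lborel)"
      unfolding \<phi>_def by (subst nn_integral_add) (auto simp: nn_integral_cmult)
    also have "2 * emeasure lborel (closure \<Omega>) * \<dots> \<le> 2 * ennreal V * (ennreal A * ennreal C1 + ennreal (\<eta>\<^sup>2) * ennreal C2)"
      unfolding V by (intro mult_left_mono add_mono C1 C2) auto
    also have "\<dots> = ennreal (2 * V * (A * C1 + \<eta>\<^sup>2 * C2))"
      using V C1 C2 A by (simp add: ennreal_mult)
    also have "\<dots> \<le> ennreal (2 * V * (C1 + C2) * (A + \<eta>\<^sup>2))"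
    proof (rule ennreal_leI)
      have "A * C1 + \<eta>\<^sup>2 * C2 \<le> (C1 + C2) * (A + \<eta>\<^sup>2)"
        using C1 C2 A by (simp add: algebra_simps)
      then have "2 * V * (A * C1 + \<eta>\<^sup>2 * C2) \<le> 2 * V * ((C1 + C2) * (A + \<eta>\<^sup>2))"
        using V by (intro mult_left_mono) auto
      then show "2 * V * (A * C1 + \<eta>\<^sup>2 * C2) \<le> 2 * V * (C1 + C2) * (A + \<eta>\<^sup>2)" by (simp add: mult.assoc)
    qed
    finally show "energy s \<Omega> v \<le> ennreal (2 * V * (C1 + C2) * (\<eta> powr (1 - s) * L powr (1 + s) + \<eta>\<^sup>2))"
      by (simp add: A_def)
  qed
qed

definition far_energy :: "real \<Rightarrow> real \<Rightarrow> ('a::euclidean_space \<Rightarrow> real) \<Rightarrow> ennreal" where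
  "far_energy s r v = (\<integral>\<^sup>+p. indicator {p. r \<le> norm (fst p - snd p)} p *
     ennreal ((v (fst p) - v (snd p))\<^sup>2 * kern s (fst p - snd p)) \<partial>lborel)"

text \<open>
  Away from the diagonal the kernel is integrable, so the \<open>L\<^sup>2\<close> norm controls everything.
\<close>

lemma far_energy_le:
  assumes r: "r > 0" and s: "s > 0"
  shows "\<exists>C\<ge>0. \<forall>\<phi>::'a::euclidean_space \<Rightarrow> real. \<phi> \<in> borel_measurable borel \<longrightarrow>
     far_energy s r \<phi> \<le> ennreal C * L2sq \<phi>"
proof -
  obtain C where C: "C \<ge> 0" "\<And>r. r > 0 \<Longrightarrow> (\<integral>\<^sup>+t. indicator {t::'a. r \<le> norm t} t *
           ennreal (kern s t) \<partial>lborel) \<le> ennreal (C * r powr - (2 * s))"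
    using powr_tail_integral[of "2 * s", where 'a = 'a] s by (auto simp: kern_def)
  define K where "K t = indicator {t::'a. r \<le> norm t} t * ennreal (kern s t)" for t
  have [measurable]: "K \<in> borel_measurable borel" unfolding K_def by measurable
  show ?thesis
  proof (intro exI[of _ "4 * (C * r powr - (2 * s))"] conjI allI impI)
    fix \<phi> :: "'a \<Rightarrow> real" assume [measurable]: "\<phi> \<in> borel_measurable borel"
    have "far_energy s r \<phi>
      \<le> (\<integral>\<^sup>+p. 2 * (ennreal ((\<phi> (fst p))\<^sup>2) * K (fst p - snd p)) + 2 * (ennreal ((\<phi> (snd p))\<^sup>2) * K (fst p - snd p)) \<partial>lborel)"
      unfolding far_energy_def
    proof (intro nn_integral_mono)
      fix p :: "'a \<times> 'a"
      have "ennreal ((\<phi> (fst p) + - \<phi> (snd p))\<^sup>2) * K (fst p - snd p)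
        \<le> (2 * ennreal ((\<phi> (fst p))\<^sup>2) + 2 * ennreal ((- \<phi> (snd p))\<^sup>2)) * K (fst p - snd p)"
        by (intro mult_right_mono ennreal_square_add_le) auto
      then show "indicator {p. r \<le> norm (fst p - snd p)} p *
        ennreal ((\<phi> (fst p) - \<phi> (snd p))\<^sup>2 * kern s (fst p - snd p))
        \<le> 2 * (ennreal ((\<phi> (fst p))\<^sup>2) * K (fst p - snd p)) + 2 * (ennreal ((\<phi> (snd p))\<^sup>2) * K (fst p - snd p))"
        by (auto simp: K_def indicator_def ennreal_mult distrib_right mult.assoc)
    qed
    also have "\<dots> = 4 * (L2sq \<phi> * (\<integral>\<^sup>+t. K t \<partial>lborel))"
      using nn_integral_times_difference[of "\<lambda>x. ennreal ((\<phi> x)\<^sup>2)" K]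
      by (simp add: nn_integral_add nn_integral_cmult L2sq_def flip: distrib_right)
    also have "\<dots> \<le> 4 * (L2sq \<phi> * ennreal (C * r powr - (2 * s)))"
      using C(2)[OF r] by (intro mult_left_mono) (auto simp: K_def)
    also have "\<dots> = ennreal (4 * (C * r powr - (2 * s))) * L2sq \<phi>"
      using C by (simp add: ennreal_mult' mult_ac)
    finally show "far_energy s r \<phi>
      \<le> ennreal (4 * (C * r powr - (2 * s))) * L2sq \<phi>" .
  qed (use C in auto)
qed

text \<open>
  The square of this function, integrated over the visible pairs, is the energy, so that facts about
  square integrable functions on the product space apply.
\<close>

definition weighted_diff :: "real \<Rightarrow> ('a \<times> 'a) set \<Rightarrow> ('a::euclidean_space \<Rightarrow> real) \<Rightarrow> 'a \<times> 'a \<Rightarrow> real" where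
  "weighted_diff s A v p = indicator A p * (v (fst p) - v (snd p)) * sqrt (kern s (fst p - snd p))"

lemma weighted_diff_measurable [measurable]:
  assumes [measurable]: "v \<in> borel_measurable borel" "A \<in> sets borel"
  shows "weighted_diff s A v \<in> borel_measurable borel"
  unfolding weighted_diff_def[abs_def] by measurable

lemma energy_eq_L2sq:
  "energy s \<Omega> v = L2sq (weighted_diff s (visible_pairs \<Omega>) v)"
  unfolding energy_def L2sq_def weighted_diff_def by (intro nn_integral_cong) (auto simp: indicator_def power_mult_distrib)

section \<open>Mollification in the energy norm\<close>

text \<open>
  Bounded supports are required because large meshes cover them entirely.
\<close>

definition Lipschitz_approximable :: "real \<Rightarrow> 'a::euclidean_space set \<Rightarrow> ('a \<Rightarrow> real) \<Rightarrow> bool" where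
  "Lipschitz_approximable s \<Omega> v \<longleftrightarrow>
     (\<forall>\<epsilon>::real. \<epsilon> > 0 \<longrightarrow> (\<exists>w L R. L-lipschitz_on UNIV w \<and> (\<forall>x. norm x > R \<longrightarrow> w x = 0) \<and>
        V_sq s \<Omega> (\<lambda>x. v x - w x) < ennreal \<epsilon>))"

lemma Lipschitz_kernel_exists:
  fixes c :: "'a::euclidean_space"
  assumes b: "b > 0"
  shows "\<exists>\<rho> K. K-lipschitz_on UNIV \<rho> \<and> (\<forall>z. \<rho> z \<ge> 0) \<and> (\<forall>z. \<rho> z \<noteq> 0 \<longrightarrow> z \<in> ball c b) \<and>
     integrable lborel \<rho> \<and> (LINT z|lborel. \<rho> z) = (1::real)"
proof -
  define k where "k z = max 0 (b - dist c z)" for z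
  have k0: "k z \<ge> 0" "k z \<le> b" for z using b by (auto simp: k_def)
  have ks: "z \<in> ball c b" if "k z \<noteq> 0" for z using that by (auto simp: k_def max_def split: if_splits)
  have kl: "\<bar>k x - k y\<bar> \<le> dist x y" for x y
    using dist_triangle[of c x y] dist_triangle[of c y x] by (auto simp: k_def max_def dist_commute)
  have [measurable]: "k \<in> borel_measurable borel"
    unfolding k_def by measurable
  have ki: "integrable lborel k"
  proof (rule Bochner_Integration.integrable_bound)
    show "integrable lborel (\<lambda>z. b * indicator (ball c b) z :: real)"
      using emeasure_bounded_finite[of "ball c b"] by (intro integrable_mult_right integrable_real_indicator) auto
    show "AE z in lborel. norm (k z) \<le> norm (b * indicator (ball c b) z)"
    proof (rule AE_I2)
      fix z show "norm (k z) \<le> norm (b * indicator (ball c b) z)"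
        using k0[of z] ks[of z] b by (cases "k z = 0") auto
    qed
  qed simp
  define I where "I = (LINT z|lborel. k z)"
  have "(LINT z|lborel. b / 2 * indicator (ball c (b / 2)) z) \<le> I"
    unfolding I_def
  proof (rule Bochner_Integration.integral_mono)
    show "integrable lborel (\<lambda>z. b / 2 * indicator (ball c (b / 2)) z)"
      using emeasure_bounded_finite[of "ball c (b / 2)"] by (intro integrable_mult_right integrable_real_indicator) auto
    show "b / 2 * indicator (ball c (b / 2)) z \<le> k z" for z
      using le_max_iff_disj[of "b / 2" 0 "b - dist c z"] by (auto simp: k_def indicator_def simp del: max.bounded_iff)
  qed (rule ki)
  moreover have "(LINT z|lborel. b / 2 * indicator (ball c (b / 2)) z) > 0"
    using b by (simp add: content_ball_pos)
  ultimately have I: "I > 0" by linarith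
  show ?thesis
  proof (intro exI conjI allI impI)
    show "(1 / I)-lipschitz_on UNIV (\<lambda>z. k z / I)"
      using I kl by (intro lipschitz_onI) (auto simp: dist_real_def divide_right_mono simp flip: diff_divide_distrib)
    show "integrable lborel (\<lambda>z. k z / I)" using ki by simp
    show "(LINT z|lborel. k z / I) = 1" using I by (simp add: I_def)
  qed (use I k0 ks in auto)
qed

text \<open>
  Reflecting the variable moves the argument \<open>x\<close> into the kernel, which is Lipschitz.
\<close>

lemma convolution_Lipschitz:
  fixes \<rho> v :: "'a::euclidean_space \<Rightarrow> real"
  assumes \<rho>: "K-lipschitz_on UNIV \<rho>" and [measurable]: "v \<in> borel_measurable borel"
    and M: "\<And>x. \<bar>v x\<bar> \<le> M" and R: "\<And>x. norm x > R \<Longrightarrow> v x = 0"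
  shows "\<exists>L. L-lipschitz_on UNIV (\<lambda>x. LINT z|lborel. \<rho> z * v (x - z))"
proof -
  have M0: "M \<ge> 0" using M[of 0] by simp
  have K0: "K \<ge> 0" using \<rho> by (rule lipschitz_on_nonneg)
  have \<rho>c: "continuous_on UNIV \<rho>" using \<rho> by (rule lipschitz_on_continuous_on)
  then have [measurable]: "\<rho> \<in> borel_measurable borel" by (rule borel_measurable_continuous_onI)
  define V where "V = measure lborel (cball (0::'a) R)"
  have iV: "integrable lborel (\<lambda>z. c * indicator (cball (0::'a) R) z)" for c :: real
    using emeasure_bounded_finite[of "cball (0::'a) R"] by (intro integrable_mult_right integrable_real_indicator) auto
  have eq: "(LINT z|lborel. \<rho> z * v (x - z)) = (LINT z|lborel. \<rho> (x - z) * v z)" for x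
  proof -
    have d: "distr lborel borel (\<lambda>z. x - z) = (lborel :: 'a measure)"
      using lborel_affine[of "-1" x] by (simp add: density_1 one_ennreal_def[symmetric])
    have "(LINT z|lborel. \<rho> z * v (x - z)) = (LINT z|distr lborel borel (\<lambda>z. x - z). \<rho> z * v (x - z))"
      by (simp add: d)
    also have "\<dots> = (LINT z|lborel. \<rho> (x - z) * v z)"
      by (subst integral_distr) auto
    finally show ?thesis .
  qed
  have int: "integrable lborel (\<lambda>z. \<rho> (x - z) * v z)" for x
  proof -
    have "compact ((\<lambda>z. \<rho> (x - z)) ` cball 0 R)"
      by (intro compact_continuous_image continuous_on_compose2[OF \<rho>c] continuous_intros) auto
    then obtain B where B: "\<And>z. z \<in> cball 0 R \<Longrightarrow> \<bar>\<rho> (x - z)\<bar> \<le> B" and B0: "B > 0"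
      by (metis (no_types, lifting) bounded_pos compact_imp_bounded image_eqI real_norm_def)
    show ?thesis
    proof (rule Bochner_Integration.integrable_bound[OF iV[of "B * M"]])
      show "AE z in lborel. norm (\<rho> (x - z) * v z) \<le> norm (B * M * indicator (cball 0 R) z)"
        using R M M0 B0 B by (intro AE_I2) (auto simp: indicator_def abs_mult intro!: mult_mono)
    qed simp
  qed
  show ?thesis
  proof (intro exI[of _ "K * M * V"] lipschitz_onI)
    fix x y :: 'a
    have "dist (LINT z|lborel. \<rho> z * v (x - z)) (LINT z|lborel. \<rho> z * v (y - z))
      = \<bar>LINT z|lborel. \<rho> (x - z) * v z - \<rho> (y - z) * v z\<bar>"
      unfolding eq dist_real_def by (subst Bochner_Integration.integral_diff) (auto intro: int)
    also have "\<dots> \<le> (LINT z|lborel. norm (\<rho> (x - z) * v z - \<rho> (y - z) * v z))"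
      using integral_norm_bound[of lborel "\<lambda>z. \<rho> (x - z) * v z - \<rho> (y - z) * v z"] by simp
    also have "\<dots> \<le> (LINT z|lborel. K * dist x y * M * indicator (cball (0::'a) R) z)"
    proof (rule Bochner_Integration.integral_mono)
      show "integrable lborel (\<lambda>z. norm (\<rho> (x - z) * v z - \<rho> (y - z) * v z))"
        by (intro integrable_norm Bochner_Integration.integrable_diff int)
      fix z
      have "\<bar>\<rho> (x - z) - \<rho> (y - z)\<bar> \<le> K * dist x y"
        using lipschitz_onD[OF \<rho>, of "x - z" "y - z"] by (simp add: dist_norm)
      then have "\<bar>\<rho> (x - z) - \<rho> (y - z)\<bar> * \<bar>v z\<bar> \<le> K * dist x y * (M * indicator (cball 0 R) z)"
        using M[of z] R[of z] K0 by (intro mult_mono) (auto simp: indicator_def)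
      then show "norm (\<rho> (x - z) * v z - \<rho> (y - z) * v z) \<le> K * dist x y * M * indicator (cball 0 R) z"
        by (simp add: abs_mult mult.assoc flip: left_diff_distrib)
    qed (rule iV)
    also have "\<dots> = K * M * V * dist x y" by (simp add: V_def)
    finally show "dist (LINT z|lborel. \<rho> z * v (x - z)) (LINT z|lborel. \<rho> z * v (y - z)) \<le> K * M * V * dist x y" .
  qed (use K0 M0 in \<open>simp add: V_def\<close>)
qed

text \<open>
  The mollifying kernel is supported in the ball of radius \<open>\<tau> \<eta>\<close> about \<open>\<tau> e\<close>. The assumption \<open>shift\<close>
  says that for these shifts a visible pair \<open>(x, y)\<close> at distance less than \<open>r\<close> is carried to a visible
  pair, unless the difference of \<open>v\<close> at the shifted pair vanishes anyway. Hence the weighted difference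
  of \<open>v(\<cdot> - z)\<close> is on visible close pairs the translate by \<open>(z, z)\<close> of a single square integrable
  function \<open>G\<close>, and \<open>translation_continuous_L2\<close> applies on the product space.
\<close>

lemma mollification_approximates:
  fixes \<Omega> :: "'a::euclidean_space set" and v :: "'a \<Rightarrow> real"
  assumes s: "0 < s" and \<Omega>: "open \<Omega>"
    and v[measurable]: "v \<in> borel_measurable borel" and M: "\<And>x. \<bar>v x\<bar> \<le> M"
    and R: "\<And>x. norm x > R \<Longrightarrow> v x = 0" and fin: "energy s \<Omega> v < \<infinity>"
    and r: "r > 0" and e: "norm e \<le> 1" and \<eta>: "0 < \<eta>" "\<eta> \<le> 1" and tmax: "tmax > 0"
    and shift: "\<And>\<tau> z x y. 0 < \<tau> \<Longrightarrow> \<tau> < tmax \<Longrightarrow> z \<in> ball (\<tau> *\<^sub>R e) (\<tau> * \<eta>) \<Longrightarrow> x \<in> closure \<Omega> \<Longrightarrow> dist x y < r \<Longrightarrow>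
       v (x - z) = v (y - z) \<or> x - z \<in> closure \<Omega> \<or> y - z \<in> closure \<Omega>"
  shows "Lipschitz_approximable s \<Omega> v"
  unfolding Lipschitz_approximable_def
proof (intro allI impI)
  fix \<epsilon> :: real assume \<epsilon>: "\<epsilon> > 0"
  have M0: "M \<ge> 0" using M[of 0] by simp
  have [measurable]: "\<Omega> \<in> sets borel" using \<Omega> by auto
  obtain C where C: "C \<ge> 0" "\<And>\<phi>::'a \<Rightarrow> real. \<phi> \<in> borel_measurable borel \<Longrightarrow>
     far_energy s r \<phi> \<le> ennreal C * L2sq \<phi>"
    using far_energy_le[OF r s, where 'a = 'a] by auto
  define N where "N = {p \<in> visible_pairs \<Omega>. norm (fst p - snd p) < r}"
  have [measurable]: "N \<in> sets borel"
  proof -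
    have "N = visible_pairs \<Omega> \<inter> {p. norm (fst p - snd p) < r}" by (auto simp: N_def)
    then show ?thesis by simp
  qed
  define G where "G = weighted_diff s N v"
  have G[measurable]: "G \<in> borel_measurable borel" unfolding G_def by measurable
  have "L2sq G \<le> energy s \<Omega> v"
    unfolding L2sq_def energy_def
    by (intro nn_integral_mono) (auto simp: G_def weighted_diff_def N_def indicator_def power_mult_distrib)
  with fin have Gfin: "L2sq G < \<infinity>" by auto
  have "L2sq v \<le> ennreal (M\<^sup>2) * emeasure lborel (cball (0::'a) R)"
    using M R by (intro L2sq_bounded_le) auto
  also have "\<dots> < \<infinity>"
    using emeasure_lborel_cball_finite[of "0::'a" R] by (simp add: ennreal_mult_less_top)
  finally have vfin: "L2sq v < \<infinity>" .
  define \<epsilon>' where "\<epsilon>' = \<epsilon> / (2 * (C + 2))"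
  have \<epsilon>': "\<epsilon>' > 0" "(C + 2) * \<epsilon>' < \<epsilon>" using \<epsilon> C(1) by (auto simp: \<epsilon>'_def field_simps add_nonneg_pos)
  obtain \<delta>1 where \<delta>1: "\<delta>1 > 0" "\<And>t. norm t < \<delta>1 \<Longrightarrow> L2sq (\<lambda>p. G p - G (p - t)) \<le> ennreal \<epsilon>'"
    using translation_continuous_L2[OF G Gfin \<epsilon>'(1)] by blast
  obtain \<delta>2 where \<delta>2: "\<delta>2 > 0" "\<And>t. norm t < \<delta>2 \<Longrightarrow> L2sq (\<lambda>p. v p - v (p - t)) \<le> ennreal \<epsilon>'"
    using translation_continuous_L2[OF v vfin \<epsilon>'(1)] by blast
  define \<tau> where "\<tau> = min (tmax / 2) (min 1 (min (\<delta>1 / 4) (\<delta>2 / 4)))"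
  have \<tau>: "\<tau> > 0" "\<tau> < tmax" "\<tau> \<le> 1" "\<tau> \<le> \<delta>1 / 4" "\<tau> \<le> \<delta>2 / 4"
    using tmax \<delta>1 \<delta>2 by (auto simp: \<tau>_def)
  obtain \<rho> K where \<rho>: "K-lipschitz_on UNIV \<rho>" "\<And>z. \<rho> z \<ge> 0" "\<And>z. \<rho> z \<noteq> 0 \<Longrightarrow> z \<in> ball (\<tau> *\<^sub>R e) (\<tau> * \<eta>)"
     "integrable lborel \<rho>" "(LINT z|lborel. \<rho> z) = (1::real)"
    using Lipschitz_kernel_exists[of "\<tau> * \<eta>" "\<tau> *\<^sub>R e"] \<tau> \<eta> by auto
  have [measurable]: "\<rho> \<in> borel_measurable borel"
    using \<rho>(4) by auto
  have nz: "norm z < 2 * \<tau>" if "\<rho> z \<noteq> 0" for z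
  proof -
    have "norm (z - \<tau> *\<^sub>R e) < \<tau> * \<eta>" using \<rho>(3)[OF that] by (simp add: dist_norm norm_minus_commute)
    moreover have "\<tau> * \<eta> \<le> \<tau>" "norm (\<tau> *\<^sub>R e) \<le> \<tau>" using \<tau> \<eta> e by (auto simp: mult_left_le)
    ultimately show ?thesis using norm_triangle_ineq2[of z "\<tau> *\<^sub>R e"] by linarith
  qed
  define w where "w x = (LINT z|lborel. \<rho> z * v (x - z))" for x
  obtain L where L: "L-lipschitz_on UNIV w"
    using convolution_Lipschitz[OF \<rho>(1) v M R] unfolding w_def by blast
  then have [measurable]: "w \<in> borel_measurable borel"
    by (intro borel_measurable_continuous_onI lipschitz_on_continuous_on)
  have ws: "w x = 0" if "norm x > R + 2" for x
  proof -
    have "\<rho> z * v (x - z) = 0" for z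
    proof (cases "\<rho> z = 0")
      case False
      then have "norm (x - z) > R"
        using nz[OF False] \<tau> that norm_triangle_ineq2[of x z] by linarith
      then show ?thesis using R by simp
    qed simp
    then have *: "(\<lambda>z. \<rho> z * v (x - z)) = (\<lambda>z. 0)" by (rule ext)
    show ?thesis unfolding w_def * by simp
  qed
  have int: "integrable lborel (\<lambda>z. \<rho> z * v (x - z))" for x
  proof (rule Bochner_Integration.integrable_bound)
    show "integrable lborel (\<lambda>z. M * \<rho> z)" using \<rho>(4) by simp
    show "AE z in lborel. norm (\<rho> z * v (x - z)) \<le> norm (M * \<rho> z)"
      using \<rho>(2) M M0 by (intro AE_I2) (simp add: abs_mult mult.commute[of _ "\<rho> _"] mult_left_mono)
  qed simp
  define \<phi> where "\<phi> x = v x - w x" for x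
  have [measurable]: "\<phi> \<in> borel_measurable borel" unfolding \<phi>_def by measurable
  have int': "integrable lborel (\<lambda>z. \<rho> z * (v x - v (x - z)))" for x
    using \<rho>(4) int[of x] by (simp add: right_diff_distrib)
  have \<phi>: "\<phi> x = (LINT z|lborel. \<rho> z * (v x - v (x - z)))" for x
    using \<rho>(4,5) int[of x] by (simp add: right_diff_distrib \<phi>_def w_def)
  have L2: "L2sq \<phi> \<le> ennreal \<epsilon>'"
  proof (rule L2sq_average_translates[where \<rho> = \<rho> and G = v and t = "\<lambda>z. z"])
    show "L2sq (\<lambda>p. v p - v (p - z)) \<le> ennreal \<epsilon>'" if "\<rho> z \<noteq> 0" for z
      using nz[OF that] \<tau> by (intro \<delta>2) auto
    show "ennreal ((\<phi> p)\<^sup>2) \<le> (\<integral>\<^sup>+ z. ennreal (\<rho> z) * ennreal ((v p - v (p - z))\<^sup>2) \<partial>lborel)" for p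
      unfolding \<phi>
    proof (rule square_average_le[where B = "2 * M"])
      show "\<bar>v p - v (p - z)\<bar> \<le> 2 * M" for z using M[of p] M[of "p - z"] by linarith
    qed (use \<rho> in auto)
  qed (use \<rho> in auto)
  define W where "W = weighted_diff s N \<phi>"
  have [measurable]: "W \<in> borel_measurable borel" unfolding W_def by measurable
  have near: "L2sq W \<le> ennreal \<epsilon>'"
  proof (rule L2sq_average_translates[where \<rho> = \<rho> and G = G and t = "\<lambda>z. (z, z)"])
    show "(\<lambda>z::'a. (z, z)) \<in> borel_measurable borel"
      by (intro borel_measurable_continuous_onI continuous_intros)
    show "L2sq (\<lambda>p. G p - G (p - (z, z))) \<le> ennreal \<epsilon>'" if "\<rho> z \<noteq> 0" for z
    proof (rule \<delta>1)
      have "norm (z, z) \<le> norm z + norm z" by (rule norm_Pair_le)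
      then show "norm (z, z) < \<delta>1" using nz[OF that] \<tau> by linarith
    qed
    show "ennreal ((W p)\<^sup>2) \<le> (\<integral>\<^sup>+ z. ennreal (\<rho> z) * ennreal ((G p - G (p - (z, z)))\<^sup>2) \<partial>lborel)" for p
    proof (cases "p \<in> N")
      case False
      then show ?thesis by (simp add: W_def weighted_diff_def)
    next
      case True
      obtain x y where p: "p = (x, y)" by (cases p)
      define h where "h z = ((v x - v (x - z)) - (v y - v (y - z))) * sqrt (kern s (x - y))" for z
      have [measurable]: "h \<in> borel_measurable borel" unfolding h_def by measurable
      \<comment> \<open>diagonal shifts preserve \<open>x - y\<close>, hence the kernel and the condition on the distance\<close>
      have hG: "h z = G p - G (p - (z, z))" if "\<rho> z \<noteq> 0" for z
      proof -
        have d: "dist x y < r" "dist y x < r" and c: "x \<in> closure \<Omega> \<or> y \<in> closure \<Omega>"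
          using True by (auto simp: p N_def in_visible_iff dist_norm norm_minus_commute)
        have "v (x - z) = v (y - z) \<or> x - z \<in> closure \<Omega> \<or> y - z \<in> closure \<Omega>"
          using c
        proof
          assume "x \<in> closure \<Omega>"
          then show ?thesis using shift[OF \<tau>(1,2) \<rho>(3)[OF that] _ d(1)] by blast
        next
          assume "y \<in> closure \<Omega>"
          from shift[OF \<tau>(1,2) \<rho>(3)[OF that] this d(2)] show ?thesis by auto
        qed
        then have "v (x - z) = v (y - z) \<or> p - (z, z) \<in> N"
          using d by (auto simp: p N_def in_visible_iff dist_norm)
        then have "G (p - (z, z)) = (v (x - z) - v (y - z)) * sqrt (kern s (x - y))"
          by (auto simp: G_def weighted_diff_def p)
        moreover have "G p = (v x - v y) * sqrt (kern s (x - y))"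
          using True by (simp add: G_def weighted_diff_def p)
        moreover have "(a - b - (c - d)) * k = (a - c) * k - (b - d) * k" for a b c d k :: real
          by (simp add: algebra_simps)
        ultimately show ?thesis
          by (simp only: h_def)
      qed
      have "W p = (LINT z|lborel. \<rho> z * h z)"
      proof -
        have "(LINT z|lborel. \<rho> z * h z) =
          (LINT z|lborel. (\<rho> z * (v x - v (x - z)) - \<rho> z * (v y - v (y - z))) * sqrt (kern s (x - y)))"
          unfolding h_def by (intro Bochner_Integration.integral_cong refl) (simp only: right_diff_distrib mult.assoc left_diff_distrib)
        also have "\<dots> = (\<phi> x - \<phi> y) * sqrt (kern s (x - y))"
          using int'[of x] int'[of y] by (simp add: \<phi>)
        finally show ?thesis using True by (simp add: W_def weighted_diff_def p)
      qed
      then have "ennreal ((W p)\<^sup>2) = ennreal ((LINT z|lborel. \<rho> z * h z)\<^sup>2)" by simp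
      also have "\<dots> \<le> (\<integral>\<^sup>+ z. ennreal (\<rho> z) * ennreal ((h z)\<^sup>2) \<partial>lborel)"
      proof (rule square_average_le[where B = "4 * M * sqrt (kern s (x - y))"])
        fix z
        have "\<bar>(v x - v (x - z)) - (v y - v (y - z))\<bar> \<le> 4 * M"
          using M[of x] M[of "x - z"] M[of y] M[of "y - z"] by linarith
        then show "\<bar>h z\<bar> \<le> 4 * M * sqrt (kern s (x - y))"
          by (simp add: h_def abs_mult mult_right_mono)
      qed (use \<rho> in auto)
      also have "\<dots> = (\<integral>\<^sup>+ z. ennreal (\<rho> z) * ennreal ((G p - G (p - (z, z)))\<^sup>2) \<partial>lborel)"
      proof (intro nn_integral_cong)
        fix z
        show "ennreal (\<rho> z) * ennreal ((h z)\<^sup>2) = ennreal (\<rho> z) * ennreal ((G p - G (p - (z, z)))\<^sup>2)"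
          using hG[of z] by (cases "\<rho> z = 0") simp_all
      qed
      finally show ?thesis .
    qed
  qed (use \<rho> in auto)
  have "energy s \<Omega> \<phi> \<le> (\<integral>\<^sup>+p. ennreal ((W p)\<^sup>2) + indicator {p. r \<le> norm (fst p - snd p)} p *
        ennreal ((\<phi> (fst p) - \<phi> (snd p))\<^sup>2 * kern s (fst p - snd p)) \<partial>lborel)"
    unfolding energy_def
    by (intro nn_integral_mono) (auto simp: W_def weighted_diff_def N_def indicator_def power_mult_distrib)
  also have "\<dots> = L2sq W + far_energy s r \<phi>"
    unfolding L2sq_def far_energy_def by (rule nn_integral_add) measurable
  also have "\<dots> \<le> ennreal \<epsilon>' + ennreal C * ennreal \<epsilon>'"
  proof (rule add_mono[OF near order_trans[OF C(2)]])
    show "ennreal C * L2sq \<phi> \<le> ennreal C * ennreal \<epsilon>'"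
      by (intro mult_left_mono L2) simp
  qed measurable
  finally have en: "energy s \<Omega> \<phi> \<le> ennreal \<epsilon>' + ennreal C * ennreal \<epsilon>'" .
  have "L2sq_on \<Omega> \<phi> \<le> L2sq \<phi>"
    unfolding L2sq_on_def L2sq_def by (intro nn_integral_mono) (auto simp: indicator_def)
  then have "V_sq s \<Omega> \<phi> \<le> ennreal \<epsilon>' + (ennreal \<epsilon>' + ennreal C * ennreal \<epsilon>')"
    unfolding V_sq_def by (intro add_mono en) (use L2 in auto)
  also have "\<dots> = ennreal ((C + 2) * \<epsilon>')"
  proof -
    have "(C + 2) * \<epsilon>' = \<epsilon>' + (\<epsilon>' + C * \<epsilon>')" by (simp add: algebra_simps)
    moreover have "ennreal (\<epsilon>' + (\<epsilon>' + C * \<epsilon>')) = ennreal \<epsilon>' + (ennreal \<epsilon>' + ennreal (C * \<epsilon>'))"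
      using C(1) \<epsilon>'(1) by (subst ennreal_plus, simp, simp, subst ennreal_plus) simp_all
    ultimately show ?thesis using C(1) \<epsilon>'(1) by (simp only: ennreal_mult less_imp_le)
  qed
  also have "\<dots> < ennreal \<epsilon>" using \<epsilon>' C(1) by (intro ennreal_lessI) (use \<epsilon> in auto)
  finally show "\<exists>w L R. L-lipschitz_on UNIV w \<and> (\<forall>x. norm x > R \<longrightarrow> w x = 0) \<and>
        V_sq s \<Omega> (\<lambda>x. v x - w x) < ennreal \<epsilon>"
    using L ws unfolding \<phi>_def by blast
qed

section \<open>Localization to charts\<close>

text \<open>
  The shift \<open>z\<close> descends by at least \<open>\<tau> - \<bar>b\<bar>\<close> in direction \<open>e\<close>, where \<open>b = z - \<tau> e\<close>, whereas the graph
  descends by at most \<open>L \<bar>b\<bar>\<close>. The radius \<open>\<tau> / (L + 2)\<close> makes \<open>(L + 1) \<bar>b\<bar> < \<tau>\<close>.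
\<close>

lemma subgraph_shift:
  fixes e x z :: "'a::euclidean_space"
  assumes e: "norm e = 1" and \<gamma>: "L-lipschitz_on {x. e \<bullet> x = 0} \<gamma>"
    and \<tau>: "\<tau> > 0" and z: "z \<in> ball (\<tau> *\<^sub>R e) (\<tau> * (1 / (L + 2)))"
    and x: "e \<bullet> x \<le> \<gamma> (x - (e \<bullet> x) *\<^sub>R e)"
  shows "e \<bullet> (x - z) < \<gamma> ((x - z) - (e \<bullet> (x - z)) *\<^sub>R e)"
proof -
  define P where "P y = y - (e \<bullet> y) *\<^sub>R e" for y
  have L: "L \<ge> 0" using \<gamma> by (rule lipschitz_on_nonneg)
  have ee: "e \<bullet> e = 1" using e by (simp add: norm_eq_1)
  have P0: "e \<bullet> P y = 0" for y by (simp add: P_def inner_diff_right ee)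
  define b where "b = z - \<tau> *\<^sub>R e"
  have b: "norm b < \<tau> / (L + 2)"
    using z by (simp add: b_def dist_norm norm_minus_commute)
  have Pz: "P x - P (x - z) = P b"
    by (simp add: P_def b_def algebra_simps inner_diff_right ee)
  have "(norm (P b))\<^sup>2 = (norm b)\<^sup>2 - (e \<bullet> b)\<^sup>2"
    by (simp only: P_def power2_norm_eq_inner inner_diff_left inner_diff_right inner_scaleR_left inner_scaleR_right ee)
       (simp add: inner_commute power2_eq_square)
  then have "(norm (P b))\<^sup>2 \<le> (norm b)\<^sup>2" by simp
  then have Pb: "norm (P b) \<le> norm b" by (rule power2_le_imp_le) simp
  have "dist (\<gamma> (P x)) (\<gamma> (P (x - z))) \<le> L * dist (P x) (P (x - z))"
    by (rule lipschitz_onD[OF \<gamma>]) (auto simp: P0)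
  also have "\<dots> \<le> L * norm b"
    unfolding dist_norm Pz by (intro mult_left_mono Pb L)
  finally have 1: "\<gamma> (P x) - L * norm b \<le> \<gamma> (P (x - z))" by (simp add: dist_real_def)
  have "\<bar>e \<bullet> b\<bar> \<le> norm b" using Cauchy_Schwarz_ineq2[of e b] e by simp
  then have 2: "e \<bullet> (x - z) \<le> e \<bullet> x - \<tau> + norm b"
    by (simp add: b_def inner_diff_right ee)
  have "(L + 1) * norm b \<le> (L + 2) * norm b" using L by (intro mult_right_mono) auto
  also have "\<dots> < \<tau>" using b L by (simp add: field_simps)
  finally have "norm b + L * norm b < \<tau>" by (simp add: algebra_simps)
  with 1 2 x show ?thesis unfolding P_def by linarith
qed

text \<open>
  Strictly above the graph there is an open set without points of \<open>\<Omega>\<close>.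
\<close>

lemma closure_below_graph:
  fixes e x :: "'a::euclidean_space"
  assumes e: "norm e = 1" and \<gamma>: "L-lipschitz_on {x. e \<bullet> x = 0} \<gamma>" and U: "open U"
    and \<Omega>: "\<Omega> \<inter> U = {x \<in> U. e \<bullet> x < \<gamma> (x - (e \<bullet> x) *\<^sub>R e)}"
    and x: "x \<in> closure \<Omega>" "x \<in> U"
  shows "e \<bullet> x \<le> \<gamma> (x - (e \<bullet> x) *\<^sub>R e)"
proof (rule ccontr)
  assume n: "\<not> ?thesis"
  have ee: "e \<bullet> e = 1" using e by (simp add: norm_eq_1)
  have \<gamma>c: "continuous_on {x. e \<bullet> x = 0} \<gamma>" using \<gamma> by (rule lipschitz_on_continuous_on)
  have 1: "continuous_on U (\<lambda>x. x - (e \<bullet> x) *\<^sub>R e)" by (intro continuous_intros)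
  have 2: "continuous_on U (\<lambda>x. \<gamma> (x - (e \<bullet> x) *\<^sub>R e))"
    by (rule continuous_on_compose2[OF \<gamma>c 1]) (auto simp: inner_diff_right ee)
  have c: "continuous_on U (\<lambda>x. \<gamma> (x - (e \<bullet> x) *\<^sub>R e) - e \<bullet> x)"
    by (rule continuous_on_diff[OF 2]) (intro continuous_intros)
  define W where "W = U \<inter> (\<lambda>x. \<gamma> (x - (e \<bullet> x) *\<^sub>R e) - e \<bullet> x) -` {..<0}"
  have "open W" unfolding W_def by (rule continuous_open_preimage[OF c U]) auto
  moreover have "x \<in> W" using n x by (auto simp: W_def)
  ultimately have "\<Omega> \<inter> W \<noteq> {}" using x(1) open_Int_closure_eq_empty[of W \<Omega>] by blast
  then obtain y where y: "y \<in> \<Omega>" "y \<in> W" by blast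
  then have "y \<in> \<Omega> \<inter> U" by (simp add: W_def)
  then have "e \<bullet> y < \<gamma> (y - (e \<bullet> y) *\<^sub>R e)" unfolding \<Omega> by simp
  then show False using y by (simp add: W_def)
qed

text \<open>
  For a point of \<open>\<Omega>\<close> all small shifts do, so \<open>e = 0\<close>; for a boundary point the shifts are taken
  along the axis of a graph chart.
\<close>

lemma inward_shift_exists:
  fixes p :: "'a::euclidean_space"
  assumes \<Omega>: "lipschitz_domain \<Omega>" and p: "p \<in> closure \<Omega>"
  shows "\<exists>r e \<eta>. r > 0 \<and> norm e \<le> 1 \<and> 0 < \<eta> \<and> \<eta> \<le> 1 \<and>
    (\<forall>\<tau> z x. 0 < \<tau> \<longrightarrow> \<tau> < r / 2 \<longrightarrow> z \<in> ball (\<tau> *\<^sub>R e) (\<tau> * \<eta>) \<longrightarrow> x \<in> closure \<Omega> \<longrightarrow> dist p x < 4 * r \<longrightarrow>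
       x - z \<in> closure \<Omega>)"
proof (cases "p \<in> \<Omega>")
  case True
  have "open \<Omega>" using \<Omega> by (simp add: lipschitz_domain_def)
  then obtain d where d: "d > 0" "ball p d \<subseteq> \<Omega>" using True by (auto simp: open_contains_ball)
  show ?thesis
  proof (rule exI[of _ "d / 5"], rule exI[of _ "0::'a"], rule exI[of _ "1::real"], intro conjI allI impI)
    fix \<tau> z x assume a: "0 < \<tau>" "\<tau> < d / 5 / 2" "z \<in> ball (\<tau> *\<^sub>R (0::'a)) (\<tau> * 1)" "dist p x < 4 * (d / 5)"
    have "dist p (x - z) \<le> dist p x + norm z"
      using norm_triangle_ineq[of "p - x" z] by (simp add: dist_norm algebra_simps)
    then have "x - z \<in> ball p d" using a by auto
    then show "x - z \<in> closure \<Omega>" using d closure_subset by blast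
  qed (use d in auto)
next
  case False
  have "open \<Omega>" using \<Omega> by (simp add: lipschitz_domain_def)
  with False p have "p \<in> frontier \<Omega>" by (simp add: frontier_def interior_open)
  then obtain e \<gamma> L U where c: "norm e = 1" "L-lipschitz_on {x. e \<bullet> x = 0} \<gamma>" "open U" "p \<in> U"
      "\<Omega> \<inter> U = {x \<in> U. e \<bullet> x < \<gamma> (x - (e \<bullet> x) *\<^sub>R e)}"
    using \<Omega> unfolding lipschitz_domain_def by blast
  have L: "L \<ge> 0" using c(2) by (rule lipschitz_on_nonneg)
  obtain d where d: "d > 0" "ball p d \<subseteq> U" using c by (auto simp: open_contains_ball)
  show ?thesis
  proof (rule exI[of _ "d / 5"], rule exI[of _ e], rule exI[of _ "1 / (L + 2)"], intro conjI allI impI)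
    fix \<tau> z x assume a: "0 < \<tau>" "\<tau> < d / 5 / 2" "z \<in> ball (\<tau> *\<^sub>R e) (\<tau> * (1 / (L + 2)))" "x \<in> closure \<Omega>" "dist p x < 4 * (d / 5)"
    have "norm (z - \<tau> *\<^sub>R e) < \<tau> * (1 / (L + 2))" using a(3) by (simp add: dist_norm norm_minus_commute)
    also have "\<dots> \<le> \<tau> * 1" using a L by (intro mult_left_mono) auto
    finally have "norm z \<le> 2 * \<tau>" using norm_triangle_ineq2[of z "\<tau> *\<^sub>R e"] a c by simp
    moreover have "dist p (x - z) \<le> dist p x + norm z"
      using norm_triangle_ineq[of "p - x" z] by (simp add: dist_norm algebra_simps)
    ultimately have "x - z \<in> ball p d" using a by auto
    then have xz: "x - z \<in> U" using d by auto
    have xU: "x \<in> U" using a d by auto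
    have "e \<bullet> (x - z) < \<gamma> ((x - z) - (e \<bullet> (x - z)) *\<^sub>R e)"
      by (rule subgraph_shift[OF c(1,2) a(1,3) closure_below_graph[OF c(1,2,3,5) a(4) xU]])
    then have "x - z \<in> \<Omega>" using c(5) xz by blast
    then show "x - z \<in> closure \<Omega>" using closure_subset by blast
  qed (use d c L in auto)
qed

definition approximable_near :: "real \<Rightarrow> 'a::euclidean_space set \<Rightarrow> 'a \<Rightarrow> real \<Rightarrow> bool" where
  "approximable_near s \<Omega> p r \<longleftrightarrow> (\<forall>v M R. v \<in> borel_measurable borel \<longrightarrow> (\<forall>x. \<bar>v x\<bar> \<le> M) \<longrightarrow> (\<forall>x. norm x > R \<longrightarrow> v x = 0) \<longrightarrow>
    energy s \<Omega> v < \<infinity> \<longrightarrow> (\<forall>x. dist p x > 2 * r \<longrightarrow> v x = 0) \<longrightarrow> Lipschitz_approximable s \<Omega> v)"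

text \<open>
  If the point of \<open>closure \<Omega>\<close> in a close pair is within distance \<open>4 r\<close> of \<open>p\<close>, the shift keeps it in
  \<open>closure \<Omega>\<close>; otherwise both shifted points are farther than \<open>2 r\<close> from \<open>p\<close>, where \<open>v\<close> vanishes.
\<close>

lemma approximable_in_chart:
  fixes p :: "'a::euclidean_space"
  assumes \<Omega>: "lipschitz_domain \<Omega>" and p: "p \<in> closure \<Omega>" and s: "0 < s"
  shows "\<exists>r>0. approximable_near s \<Omega> p r"
proof -
  have o: "open \<Omega>" using \<Omega> by (simp add: lipschitz_domain_def)
  obtain r e \<eta> where r: "r > 0" and e: "norm e \<le> 1" and \<eta>: "0 < \<eta>" "\<eta> \<le> 1"
    and sh: "\<And>\<tau> z x. 0 < \<tau> \<Longrightarrow> \<tau> < r / 2 \<Longrightarrow> z \<in> ball (\<tau> *\<^sub>R e) (\<tau> * \<eta>) \<Longrightarrow> x \<in> closure \<Omega> \<Longrightarrow> dist p x < 4 * r \<Longrightarrow>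
       x - z \<in> closure \<Omega>"
    using inward_shift_exists[OF \<Omega> p] by blast
  show ?thesis
    unfolding approximable_near_def
  proof (intro exI[of _ r] conjI allI impI r)
    fix v :: "'a \<Rightarrow> real" and M R
    assume v: "v \<in> borel_measurable borel" "\<forall>x. \<bar>v x\<bar> \<le> M" "\<forall>x. norm x > R \<longrightarrow> v x = 0"
      "energy s \<Omega> v < \<infinity>" and sup: "\<forall>x. dist p x > 2 * r \<longrightarrow> v x = 0"
    show "Lipschitz_approximable s \<Omega> v"
    proof (rule mollification_approximates[OF s o v(1) _ _ v(4) r e \<eta>, where tmax = "r / 2" and M = M and R = R])
      fix \<tau> z x y assume a: "0 < \<tau>" "\<tau> < r / 2" "z \<in> ball (\<tau> *\<^sub>R e) (\<tau> * \<eta>)" "x \<in> closure \<Omega>" "dist x y < r"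
      show "v (x - z) = v (y - z) \<or> x - z \<in> closure \<Omega> \<or> y - z \<in> closure \<Omega>"
      proof (cases "dist p x < 4 * r")
        case True
        then show ?thesis using sh[OF a(1-4)] by blast
      next
        case False
        have "norm (z - \<tau> *\<^sub>R e) < \<tau> * \<eta>" using a(3) by (simp add: dist_norm norm_minus_commute)
        also have "\<dots> \<le> \<tau> * 1" using a \<eta> by (intro mult_left_mono) auto
        finally have "norm (z - \<tau> *\<^sub>R e) < \<tau>" by simp
        moreover have "norm (\<tau> *\<^sub>R e) \<le> \<tau>" using a e by (simp add: mult_left_le)
        ultimately have nz: "norm z < r" using norm_triangle_ineq2[of z "\<tau> *\<^sub>R e"] a by linarith
        have "dist p x \<le> dist p (x - z) + norm z" "dist p y \<le> dist p (y - z) + norm z"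
          using norm_triangle_ineq4[of "p - (x - z)" z] norm_triangle_ineq4[of "p - (y - z)" z]
          by (simp_all add: dist_norm algebra_simps)
        moreover have "dist p x \<le> dist p y + dist x y" by (metis dist_commute dist_triangle)
        ultimately have "dist p (x - z) > 2 * r" "dist p (y - z) > 2 * r"
          using False nz a by linarith+
        then show ?thesis using sup by simp
      qed
    qed (use v r in auto)
  qed
qed

text \<open>
  Visible close pairs lie near \<open>closure \<Omega>\<close>, where \<open>v\<close> and its small translates are zero.
\<close>

lemma approximable_away_from_domain:
  fixes \<Omega> :: "'a::euclidean_space set"
  assumes s: "0 < s" and o: "open \<Omega>" and v: "v \<in> borel_measurable borel" "\<And>x. \<bar>v x\<bar> \<le> M"
    "\<And>x. norm x > R \<Longrightarrow> v x = 0" and fin: "energy s \<Omega> v < \<infinity>" and \<delta>: "\<delta> > 0"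
    and zero: "\<And>x y. x \<in> closure \<Omega> \<Longrightarrow> dist x y < \<delta> \<Longrightarrow> v y = 0"
  shows "Lipschitz_approximable s \<Omega> v"
proof (rule mollification_approximates[OF s o v fin, where r = "\<delta> / 2" and tmax = "\<delta> / 4" and e = "0::'a" and \<eta> = 1])
  fix \<tau> and z x y :: 'a assume a: "0 < \<tau>" "\<tau> < \<delta> / 4" "z \<in> ball (\<tau> *\<^sub>R 0) (\<tau> * 1)" "x \<in> closure \<Omega>" "dist x y < \<delta> / 2"
  have "dist x (x - z) < \<delta>" using a by (simp add: dist_norm)
  moreover have "dist x (y - z) < \<delta>"
    using norm_triangle_ineq[of "x - y" z] a by (simp add: dist_norm algebra_simps)
  ultimately show "v (x - z) = v (y - z) \<or> x - z \<in> closure \<Omega> \<or> y - z \<in> closure \<Omega>"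
    using zero[OF a(4)] by simp
qed (use \<delta> in auto)

lemma approximable_add:
  assumes [measurable]: "u \<in> borel_measurable borel" "v \<in> borel_measurable borel" "\<Omega> \<in> sets borel"
    and u: "Lipschitz_approximable s \<Omega> u" and v: "Lipschitz_approximable s \<Omega> v"
  shows "Lipschitz_approximable s \<Omega> (\<lambda>x. u x + v x)"
  unfolding Lipschitz_approximable_def
proof (intro allI impI)
  fix \<epsilon> :: real assume \<epsilon>: "\<epsilon> > 0"
  obtain w1 L1 R1 where w1: "L1-lipschitz_on UNIV w1" "\<forall>x. norm x > R1 \<longrightarrow> w1 x = 0" "V_sq s \<Omega> (\<lambda>x. u x - w1 x) < ennreal (\<epsilon> / 4)"
    using u[unfolded Lipschitz_approximable_def, rule_format, of "\<epsilon> / 4"] \<epsilon> by auto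
  obtain w2 L2 R2 where w2: "L2-lipschitz_on UNIV w2" "\<forall>x. norm x > R2 \<longrightarrow> w2 x = 0" "V_sq s \<Omega> (\<lambda>x. v x - w2 x) < ennreal (\<epsilon> / 4)"
    using v[unfolded Lipschitz_approximable_def, rule_format, of "\<epsilon> / 4"] \<epsilon> by auto
  have [measurable]: "w1 \<in> borel_measurable borel" "w2 \<in> borel_measurable borel"
    using w1(1) w2(1) by (auto intro!: borel_measurable_continuous_onI lipschitz_on_continuous_on)
  have "V_sq s \<Omega> (\<lambda>x. u x + v x - (w1 x + w2 x)) = V_sq s \<Omega> (\<lambda>x. (u x - w1 x) + (v x - w2 x))"
    by (simp add: algebra_simps)
  also have "\<dots> \<le> 2 * V_sq s \<Omega> (\<lambda>x. u x - w1 x) + 2 * V_sq s \<Omega> (\<lambda>x. v x - w2 x)"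
    by (rule V_sq_add_le) measurable
  also have "\<dots> < 2 * ennreal (\<epsilon> / 4) + 2 * ennreal (\<epsilon> / 4)"
    using w1 w2 by (intro add_strict_mono ennreal_mult_strict_left_mono) auto
  also have "\<dots> = ennreal \<epsilon>"
  proof -
    have "2 * ennreal (\<epsilon> / 4) = ennreal (\<epsilon> / 2)"
      using \<epsilon> ennreal_mult[of 2 "\<epsilon> / 4"] by simp
    moreover have "ennreal (\<epsilon> / 2) + ennreal (\<epsilon> / 2) = ennreal \<epsilon>"
      using \<epsilon> by (subst ennreal_plus[symmetric]) auto
    ultimately show ?thesis by (simp only:)
  qed
  finally have *: "V_sq s \<Omega> (\<lambda>x. u x + v x - (w1 x + w2 x)) < ennreal \<epsilon>" .
  have "(L1 + L2)-lipschitz_on UNIV (\<lambda>x. w1 x + w2 x)" using w1 w2 by (intro lipschitz_intros) auto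
  then show "\<exists>w L R. L-lipschitz_on UNIV w \<and> (\<forall>x. norm x > R \<longrightarrow> w x = 0) \<and>
        V_sq s \<Omega> (\<lambda>x. u x + v x - w x) < ennreal \<epsilon>"
    using * w1(2) w2(2) by (intro exI[of _ "\<lambda>x. w1 x + w2 x"] exI[of _ "L1 + L2"] exI[of _ "max R1 R2"]) auto
qed

text \<open>
  In \<open>\<theta> x * v x - \<theta> y * v y = \<theta> x * (v x - v y) + v y * (\<theta> x - \<theta> y)\<close> the first term has the energy of \<open>v\<close>
  and the second, \<open>v\<close> being bounded, at most a multiple of the energy of the Lipschitz function \<open>\<theta>\<close>.
\<close>

lemma energy_times_cutoff:
  fixes \<theta> :: "'a::euclidean_space \<Rightarrow> real"
  assumes \<Omega>: "bounded \<Omega>" and s: "0 < s" "s < 1"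
    and [measurable]: "v \<in> borel_measurable borel" and M: "\<And>x. \<bar>v x\<bar> \<le> M" and fin: "energy s \<Omega> v < \<infinity>"
    and \<theta>: "L-lipschitz_on UNIV \<theta>" "\<And>x. 0 \<le> \<theta> x" "\<And>x. \<theta> x \<le> 1"
  shows "energy s \<Omega> (\<lambda>x. \<theta> x * v x) < \<infinity>"
proof -
  have [measurable]: "\<theta> \<in> borel_measurable borel"
    using \<theta>(1) by (auto intro!: borel_measurable_continuous_onI lipschitz_on_continuous_on)
  have M0: "M \<ge> 0" using M[of 0] by simp
  have L0: "L \<ge> 0" using \<theta>(1) by (rule lipschitz_on_nonneg)
  obtain C where C: "C \<ge> 0" "\<forall>(v::'a \<Rightarrow> real) L \<eta>. L \<ge> 0 \<longrightarrow>
     (\<forall>x y. x \<in> closure \<Omega> \<longrightarrow> \<bar>v x - v y\<bar> \<le> \<eta>) \<longrightarrow>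
     near_Lipschitz \<Omega> L v \<longrightarrow>
     energy s \<Omega> v \<le> ennreal (C * (\<eta> powr (1 - s) * L powr (1 + s) + \<eta>\<^sup>2))"
    using energy_Lipschitz_bound[OF \<Omega> s] by blast
  have "energy s \<Omega> \<theta> \<le> ennreal (C * (1 powr (1 - s) * L powr (1 + s) + 1\<^sup>2))"
  proof (rule C(2)[rule_format, OF L0])
    show "\<bar>\<theta> x - \<theta> y\<bar> \<le> 1" for x y using \<theta>(2,3)[of x] \<theta>(2,3)[of y] by linarith
    show "near_Lipschitz \<Omega> L \<theta>"
      unfolding near_Lipschitz_def using lipschitz_onD[OF \<theta>(1)] by (simp add: dist_real_def)
  qed
  then have \<theta>fin: "energy s \<Omega> \<theta> < \<infinity>" by (rule le_less_trans) simp
  have pw: "ennreal ((\<theta> x * v x - \<theta> y * v y)\<^sup>2 * k) \<le> 2 * ennreal ((v x - v y)\<^sup>2 * k) + 2 * (ennreal (M\<^sup>2) * ennreal ((\<theta> x - \<theta> y)\<^sup>2 * k))"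
    if k: "k \<ge> 0" for x y k
  proof -
    have e: "\<theta> x * v x - \<theta> y * v y = \<theta> x * (v x - v y) + v y * (\<theta> x - \<theta> y)" by (simp add: algebra_simps)
    have "(\<theta> x * (v x - v y))\<^sup>2 \<le> (v x - v y)\<^sup>2"
      using \<theta>(2,3)[of x] by (simp add: power_mult_distrib mult_left_le_one_le power_le_one)
    moreover have "(v y * (\<theta> x - \<theta> y))\<^sup>2 \<le> M\<^sup>2 * (\<theta> x - \<theta> y)\<^sup>2"
      unfolding power_mult_distrib using M[of y] M0
      by (intro mult_right_mono) (auto simp: abs_le_square_iff[symmetric])
    ultimately have "2 * ennreal ((\<theta> x * (v x - v y))\<^sup>2) + 2 * ennreal ((v y * (\<theta> x - \<theta> y))\<^sup>2)
       \<le> 2 * ennreal ((v x - v y)\<^sup>2) + 2 * ennreal (M\<^sup>2 * (\<theta> x - \<theta> y)\<^sup>2)"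
      by (intro add_mono mult_left_mono ennreal_leI) auto
    then have "ennreal ((\<theta> x * v x - \<theta> y * v y)\<^sup>2) \<le> 2 * ennreal ((v x - v y)\<^sup>2) + 2 * ennreal (M\<^sup>2 * (\<theta> x - \<theta> y)\<^sup>2)"
      unfolding e by (rule order_trans[OF ennreal_square_add_le])
    then have "ennreal ((\<theta> x * v x - \<theta> y * v y)\<^sup>2) * ennreal k \<le> (2 * ennreal ((v x - v y)\<^sup>2) + 2 * ennreal (M\<^sup>2 * (\<theta> x - \<theta> y)\<^sup>2)) * ennreal k"
      by (rule mult_right_mono) simp
    then show ?thesis using k by (simp add: ennreal_mult distrib_right mult.assoc)
  qed
  have "energy s \<Omega> (\<lambda>x. \<theta> x * v x) \<le> (\<integral>\<^sup>+p.
      2 * (indicator (visible_pairs \<Omega>) p * ennreal ((v (fst p) - v (snd p))\<^sup>2 * kern s (fst p - snd p))) +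
      2 * (ennreal (M\<^sup>2) * (indicator (visible_pairs \<Omega>) p * ennreal ((\<theta> (fst p) - \<theta> (snd p))\<^sup>2 * kern s (fst p - snd p)))) \<partial>lborel)"
    unfolding energy_def using pw by (intro nn_integral_mono) (auto simp: indicator_def)
  also have "\<dots> = 2 * energy s \<Omega> v + 2 * (ennreal (M\<^sup>2) * energy s \<Omega> \<theta>)"
    unfolding energy_def by (subst nn_integral_add) (auto simp: nn_integral_cmult)
  also have "\<dots> < \<infinity>"
    using fin \<theta>fin by (simp add: ennreal_mult_less_top)
  finally show ?thesis .
qed

text \<open>
  Induction on the cover takes the place of a partition of unity. A cutoff \<open>\<theta>\<close> that is 1 on the ball of
  \<open>p\<close> splits \<open>v\<close> into \<open>\<theta> v\<close>, which lives in the chart of \<open>p\<close>, and \<open>(1 - \<theta>) v\<close>, which vanishes near \<open>\<Omega>\<close>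
  outside the remaining balls. With no balls left, \<open>v\<close> vanishes near \<open>\<Omega>\<close>.
\<close>

lemma approximable_of_finite_cover:
  fixes \<Omega> :: "'a::euclidean_space set"
  assumes \<Omega>: "bounded \<Omega>" "open \<Omega>" and s: "0 < s" "s < 1" and P: "finite P"
    and r: "\<And>p. p \<in> P \<Longrightarrow> \<rho> p > 0"
    and loc: "\<And>p. p \<in> P \<Longrightarrow> approximable_near s \<Omega> p (\<rho> p)"
    and \<delta>: "\<delta> > 0"
    and v: "v \<in> borel_measurable borel" "\<And>x. \<bar>v x\<bar> \<le> M" "\<And>x. norm x > R \<Longrightarrow> v x = 0" "energy s \<Omega> v < \<infinity>"
    and zero: "\<And>x y. x \<in> closure \<Omega> \<Longrightarrow> dist x y < \<delta> \<Longrightarrow> y \<notin> (\<Union>p\<in>P. ball p (\<rho> p)) \<Longrightarrow> v y = 0"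
  shows "Lipschitz_approximable s \<Omega> v"
  using P r loc v zero
proof (induction P arbitrary: v rule: finite_induct)
  case empty
  show ?case
    by (rule approximable_away_from_domain[OF s(1) \<Omega>(2) empty(3-6) \<delta>]) (use empty(7) in auto)
next
  case (insert p P)
  note [measurable] = insert.prems(3)
  have rp: "\<rho> p > 0" using insert.prems(1) by simp
  \<comment> \<open>1 on the ball of radius \<open>\<rho> p\<close>, 0 outside the ball of twice this radius\<close>
  define \<theta> where "\<theta> x = max 0 (min 1 (2 - dist p x / \<rho> p))" for x
  have \<theta>: "0 \<le> \<theta> x" "\<theta> x \<le> 1" for x by (auto simp: \<theta>_def)
  have \<theta>L: "(1 / \<rho> p)-lipschitz_on UNIV \<theta>"
  proof (rule lipschitz_onI)
    fix x y
    have "\<bar>dist p x - dist p y\<bar> \<le> dist x y"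
      using dist_triangle[of p x y] dist_triangle[of p y x] by (auto simp: dist_commute)
    then have "\<bar>dist p x / \<rho> p - dist p y / \<rho> p\<bar> \<le> dist x y / \<rho> p"
      using rp by (simp add: divide_right_mono flip: diff_divide_distrib)
    then show "dist (\<theta> x) (\<theta> y) \<le> 1 / \<rho> p * dist x y"
      by (auto simp: \<theta>_def dist_real_def max_def min_def)
  qed (use rp in simp)
  have \<theta>L': "(1 / \<rho> p)-lipschitz_on UNIV (\<lambda>x. 1 - \<theta> x)"
    using \<theta>L by (auto simp: lipschitz_on_def dist_real_def abs_minus_commute)
  have [measurable]: "\<theta> \<in> borel_measurable borel"
    using \<theta>L by (auto intro!: borel_measurable_continuous_onI lipschitz_on_continuous_on)
  have bd: "\<bar>t * v x\<bar> \<le> M" if "0 \<le> t" "t \<le> 1" for t x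
    using that insert.prems(4)[of x] mult_left_le_one_le[of "\<bar>v x\<bar>" t] by (simp add: abs_mult)
  have 1: "Lipschitz_approximable s \<Omega> (\<lambda>x. \<theta> x * v x)"
  proof (rule insert.prems(2)[of p, unfolded approximable_near_def, rule_format])
    show "energy s \<Omega> (\<lambda>x. \<theta> x * v x) < \<infinity>"
      by (rule energy_times_cutoff[OF \<Omega>(1) s insert.prems(3,4,6) \<theta>L \<theta>])
    show "\<theta> x * v x = 0" if "dist p x > 2 * \<rho> p" for x
      using that rp by (simp add: \<theta>_def field_simps)
    show "\<bar>\<theta> x * v x\<bar> \<le> M" for x using \<theta> by (intro bd)
    show "\<theta> x * v x = 0" if "norm x > R" for x using insert.prems(5)[OF that] by simp
  qed auto
  have 2: "Lipschitz_approximable s \<Omega> (\<lambda>x. (1 - \<theta> x) * v x)"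
  proof (rule insert.IH)
    show "energy s \<Omega> (\<lambda>x. (1 - \<theta> x) * v x) < \<infinity>"
      by (rule energy_times_cutoff[OF \<Omega>(1) s insert.prems(3,4,6) \<theta>L']) (use \<theta> in auto)
    show "\<bar>(1 - \<theta> x) * v x\<bar> \<le> M" for x using \<theta>[of x] by (intro bd) auto
    show "(1 - \<theta> x) * v x = 0" if "norm x > R" for x using insert.prems(5)[OF that] by simp
    show "(1 - \<theta> y) * v y = 0" if "x \<in> closure \<Omega>" "dist x y < \<delta>" "y \<notin> (\<Union>p\<in>P. ball p (\<rho> p))" for x y
    proof (cases "y \<in> ball p (\<rho> p)")
      case True
      then have "dist p y / \<rho> p < 1" using rp by simp
      then have "\<theta> y = 1" by (simp add: \<theta>_def)
      then show ?thesis by simp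
    next
      case False
      then show ?thesis using insert.prems(7)[OF that(1,2)] that(3) by simp
    qed
  qed (use insert.prems(1,2) in auto)
  have "Lipschitz_approximable s \<Omega> (\<lambda>x. \<theta> x * v x + (1 - \<theta> x) * v x)"
    by (rule approximable_add[OF _ _ _ 1 2]) (use \<Omega> in auto)
  then show ?case by (simp add: algebra_simps)
qed

lemma approximable_of_bounded:
  fixes \<Omega> :: "'a::euclidean_space set"
  assumes \<Omega>: "lipschitz_domain \<Omega>" "bounded \<Omega>" and s: "0 < s" "s < 1"
    and v: "v \<in> borel_measurable borel" "\<And>x. \<bar>v x\<bar> \<le> M" "\<And>x. norm x > R \<Longrightarrow> v x = 0" "energy s \<Omega> v < \<infinity>"
  shows "Lipschitz_approximable s \<Omega> v"
proof -
  have o: "open \<Omega>" using \<Omega> by (simp add: lipschitz_domain_def)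
  have "\<forall>p\<in>closure \<Omega>. \<exists>r>0. approximable_near s \<Omega> p r"
    using approximable_in_chart[OF \<Omega>(1) _ s(1)] by blast
  then obtain \<rho> where \<rho>: "\<And>p. p \<in> closure \<Omega> \<Longrightarrow> \<rho> p > 0 \<and> approximable_near s \<Omega> p (\<rho> p)"
    by metis
  have comp: "compact (closure \<Omega>)" using \<Omega> by simp
  obtain P where P: "P \<subseteq> closure \<Omega>" "finite P" "closure \<Omega> \<subseteq> (\<Union>p\<in>P. ball p (\<rho> p))"
  proof (rule compactE_image[OF comp, of "closure \<Omega>" "\<lambda>p. ball p (\<rho> p)"])
    show "closure \<Omega> \<subseteq> (\<Union>p\<in>closure \<Omega>. ball p (\<rho> p))" using \<rho> by force
  qed auto
  have "open (\<Union>p\<in>P. ball p (\<rho> p))" by auto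
  then obtain \<delta> where \<delta>: "\<delta> > 0" "(\<Union>x\<in>closure \<Omega>. ball x \<delta>) \<subseteq> (\<Union>p\<in>P. ball p (\<rho> p))"
    using compact_subset_open_imp_ball_epsilon_subset[OF comp _ P(3)] by blast
  show ?thesis
  proof (rule approximable_of_finite_cover[OF \<Omega>(2) o s P(2) _ _ \<delta>(1) v, where \<rho> = \<rho>])
    show "v y = 0" if "x \<in> closure \<Omega>" "dist x y < \<delta>" "y \<notin> (\<Union>p\<in>P. ball p (\<rho> p))" for x y
    proof -
      have "y \<in> (\<Union>x\<in>closure \<Omega>. ball x \<delta>)" using that by auto
      then show ?thesis using that \<delta>(2) by blast
    qed
  qed (use \<rho> P in auto)
qed

section \<open>Density of Lipschitz functions\<close>

definition clamp_real :: "real \<Rightarrow> real \<Rightarrow> real" where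
  "clamp_real c t = max (- c) (min c t)"

lemma clamp_real_bounds:
  assumes "c \<ge> 0"
  shows "\<bar>clamp_real c a\<bar> \<le> c" "\<bar>clamp_real c a - clamp_real c b\<bar> \<le> \<bar>a - b\<bar>"
    "\<bar>(a - clamp_real c a) - (b - clamp_real c b)\<bar> \<le> \<bar>a - b\<bar>" "\<bar>a - clamp_real c a\<bar> \<le> \<bar>a\<bar>"
  using assms by (auto simp: clamp_real_def max_def min_def)

lemma clamp_real_measurable [measurable]: "clamp_real c \<in> borel_measurable borel"
  unfolding clamp_real_def by measurable

lemma clamp_real_eventually: "\<forall>\<^sub>F n::nat in sequentially. clamp_real (real n) t = t"
proof -
  obtain N :: nat where "\<bar>t\<bar> \<le> N" using real_arch_simple by blast
  then have "clamp_real (real n) t = t" if "n \<ge> N" for n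
    using that by (auto simp: clamp_real_def max_def min_def)
  then show ?thesis unfolding eventually_sequentially by blast
qed

text \<open>
  Clamping does not increase differences, so the energy density of \<open>v\<close> dominates those of the errors.
\<close>

lemma V_sq_truncation:
  assumes v[measurable]: "v \<in> borel_measurable borel" and [measurable]: "\<Omega> \<in> sets borel"
    and fin: "V_sq s \<Omega> v < \<infinity>" and \<epsilon>: "(\<epsilon>::real) > 0"
  shows "\<exists>n::nat. V_sq s \<Omega> (\<lambda>x. v x - clamp_real n (v x)) < ennreal \<epsilon>"
proof -
  define T where "T n x = v x - clamp_real (real n) (v x)" for n :: nat and x
  have [measurable]: "T n \<in> borel_measurable borel" for n unfolding T_def by measurable
  have Tlim: "(\<lambda>n. T n x) \<longlonglongrightarrow> 0" for x
    using clamp_real_eventually[of "v x"] by (intro tendsto_eventually) (auto simp: T_def elim: eventually_mono)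
  have fin1: "L2sq_on \<Omega> v < \<infinity>" and fin2: "energy s \<Omega> v < \<infinity>"
    using fin by (auto simp: V_sq_def)
  have L: "L2sq_on \<Omega> u = L2sq (\<lambda>x. indicator \<Omega> x * u x)" for u
    unfolding L2sq_on_def L2sq_def by (intro nn_integral_cong) (auto simp: indicator_def)
  have 1: "\<forall>\<^sub>F n in sequentially. L2sq (\<lambda>x. indicator \<Omega> x * T n x) < ennreal (\<epsilon> / 2)"
  proof (rule L2sq_dominated[where W = "\<lambda>x. indicator \<Omega> x * \<bar>v x\<bar>"])
    show "\<bar>indicator \<Omega> x * T n x\<bar> \<le> indicator \<Omega> x * \<bar>v x\<bar>" for n x
      using clamp_real_bounds(4)[of "real n" "v x"] by (simp add: T_def indicator_def)
    show "L2sq (\<lambda>x. indicator \<Omega> x * \<bar>v x\<bar>) < \<infinity>"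
      using fin1 L[of "\<lambda>x. \<bar>v x\<bar>"] by (simp add: L2sq_on_def)
    show "AE x in lborel. (\<lambda>n. indicator \<Omega> x * T n x) \<longlonglongrightarrow> 0"
      using tendsto_mult[OF tendsto_const Tlim] by simp
  qed (use \<epsilon> in auto)
  have 2: "\<forall>\<^sub>F n in sequentially. L2sq (weighted_diff s (visible_pairs \<Omega>) (T n)) < ennreal (\<epsilon> / 2)"
  proof (rule L2sq_dominated[where W = "\<lambda>p. \<bar>weighted_diff s (visible_pairs \<Omega>) v p\<bar>"])
    show "\<bar>weighted_diff s (visible_pairs \<Omega>) (T n) p\<bar>
      \<le> \<bar>weighted_diff s (visible_pairs \<Omega>) v p\<bar>" for n p
      unfolding weighted_diff_def abs_mult T_def
      by (intro mult_right_mono mult_left_mono clamp_real_bounds) auto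
    show "L2sq (\<lambda>p. \<bar>weighted_diff s (visible_pairs \<Omega>) v p\<bar>) < \<infinity>"
      using fin2 unfolding energy_eq_L2sq by (simp add: L2sq_def)
    show "AE p in lborel. (\<lambda>n. weighted_diff s (visible_pairs \<Omega>) (T n) p) \<longlonglongrightarrow> 0"
    proof (rule AE_I2)
      fix p :: "'a \<times> 'a"
      have "(\<lambda>n. weighted_diff s (visible_pairs \<Omega>) (T n) p)
        \<longlonglongrightarrow> indicator (visible_pairs \<Omega>) p * (0 - 0) * sqrt (kern s (fst p - snd p))"
        unfolding weighted_diff_def by (intro tendsto_intros Tlim)
      then show "(\<lambda>n. weighted_diff s (visible_pairs \<Omega>) (T n) p) \<longlonglongrightarrow> 0"
        by simp
    qed
  qed (use \<epsilon> in auto)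
  obtain n where n: "L2sq (\<lambda>x. indicator \<Omega> x * T n x) < ennreal (\<epsilon> / 2)"
    "L2sq (weighted_diff s (visible_pairs \<Omega>) (T n)) < ennreal (\<epsilon> / 2)"
    using eventually_happens[OF eventually_conj[OF 1 2]] by auto
  have "V_sq s \<Omega> (T n) < ennreal (\<epsilon> / 2) + ennreal (\<epsilon> / 2)"
    unfolding V_sq_def energy_eq_L2sq L by (rule add_strict_mono[OF n])
  also have "\<dots> = ennreal \<epsilon>" using \<epsilon> by (subst ennreal_plus[symmetric]) auto
  finally show ?thesis unfolding T_def by blast
qed

text \<open>
  The part that is cut off interacts with \<open>\<Omega>\<close> only over long distances.
\<close>

lemma V_sq_cutoff:
  fixes \<Omega> :: "'a::euclidean_space set"
  assumes \<Omega>: "bounded \<Omega>" and s: "0 < s" and v: "\<And>x. \<bar>v x\<bar> \<le> M" and \<epsilon>: "(\<epsilon>::real) > 0"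
  shows "\<exists>k. V_sq s \<Omega> (\<lambda>x. v x - (if norm x \<le> k then v x else 0)) < ennreal \<epsilon>"
proof -
  obtain R where R: "\<And>x. x \<in> closure \<Omega> \<Longrightarrow> norm x \<le> R"
    using bounded_closure[OF \<Omega>] by (auto simp: bounded_iff)
  obtain C where C: "C \<ge> 0" "\<And>r. r > 0 \<Longrightarrow> (\<integral>\<^sup>+t. indicator {t::'a. r \<le> norm t} t *
           ennreal (kern s t) \<partial>lborel) \<le> ennreal (C * r powr - (2 * s))"
    using powr_tail_integral[of "2 * s", where 'a = 'a] s by (auto simp: kern_def)
  define V where "V = measure lborel (closure \<Omega>)"
  have "emeasure lborel (closure \<Omega>) < \<infinity>"
    using \<Omega> by (intro emeasure_bounded_finite) auto
  then have V: "V \<ge> 0" "emeasure lborel (closure \<Omega>) = ennreal V"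
    by (auto simp: V_def less_top[symmetric] intro!: emeasure_eq_ennreal_measure)
  have "((\<lambda>r. 2 * V * (M\<^sup>2 * (C * r powr - (2 * s)))) \<longlongrightarrow> 2 * V * (M\<^sup>2 * (C * 0))) at_top"
    using s by (intro tendsto_intros tendsto_neg_powr filterlim_ident) auto
  then have "\<forall>\<^sub>F r in at_top. 2 * V * (M\<^sup>2 * (C * r powr - (2 * s))) < \<epsilon>"
    using \<epsilon> by (auto dest: order_tendstoD(2))
  then have "\<forall>\<^sub>F r in at_top. r > 0 \<and> 2 * V * (M\<^sup>2 * (C * r powr - (2 * s))) < \<epsilon>"
    by (intro eventually_conj eventually_gt_at_top)
  then obtain r where r: "r > 0" "2 * V * (M\<^sup>2 * (C * r powr - (2 * s))) < \<epsilon>"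
    using eventually_happens[of _ "at_top :: real filter"] by force
  define d where "d x = v x - (if norm x \<le> R + r then v x else 0)" for x
  have d0: "d x = 0" if "norm x \<le> R + r" for x using that by (simp add: d_def)
  have db: "\<bar>d x\<bar> \<le> M" for x using v[of x] by (auto simp: d_def)
  have dz: "d x = 0" if "x \<in> closure \<Omega>" for x using R[OF that] r by (intro d0) simp
  have pw: "ennreal ((d x - d y)\<^sup>2 * kern s (x - y)) \<le> ennreal (M\<^sup>2) * (indicator {t. r \<le> norm t} (x - y) * ennreal (kern s (x - y)))"
    if x: "x \<in> closure \<Omega> \<or> y \<in> closure \<Omega>" for x y
  proof (cases "d x = 0 \<and> d y = 0")
    case False
    have "r \<le> norm (x - y)"
    proof (cases "d x = 0")
      case True
      with False have "norm y > R + r" "x \<in> closure \<Omega>" using d0[of y] dz[of y] x by force+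
      then show ?thesis using R[of x] norm_triangle_ineq2[of y x] by (simp add: norm_minus_commute)
    next
      case False
      then have "norm x > R + r" "y \<in> closure \<Omega>" using d0[of x] dz[of x] x by force+
      then show ?thesis using R[of y] norm_triangle_ineq2[of x y] by simp
    qed
    moreover have "\<bar>d x - d y\<bar> \<le> M" using db[of x] db[of y] dz x by fastforce
    then have "(d x - d y)\<^sup>2 \<le> M\<^sup>2" by (simp add: abs_le_square_iff[symmetric])
    then have "(d x - d y)\<^sup>2 * kern s (x - y) \<le> M\<^sup>2 * kern s (x - y)" by (intro mult_right_mono) auto
    ultimately show ?thesis by (simp add: ennreal_mult[symmetric] ennreal_leI)
  qed simp
  have "L2sq_on \<Omega> d = (\<integral>\<^sup>+x. 0 \<partial>(lborel :: 'a measure))"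
    unfolding L2sq_on_def using dz closure_subset[of \<Omega>] by (intro nn_integral_cong) (auto simp: indicator_def)
  then have "V_sq s \<Omega> d = energy s \<Omega> d" by (simp add: V_sq_def)
  also have "\<dots> \<le> 2 * emeasure lborel (closure \<Omega>) * (\<integral>\<^sup>+t. ennreal (M\<^sup>2) * (indicator {t::'a. r \<le> norm t} t * ennreal (kern s t)) \<partial>lborel)"
    by (rule energy_le_convolution[OF _ pw]) measurable
  also have "\<dots> \<le> 2 * ennreal V * (ennreal (M\<^sup>2) * ennreal (C * r powr - (2 * s)))"
    unfolding V using C(2)[OF r(1)] by (subst nn_integral_cmult) (auto intro!: mult_left_mono)
  also have "\<dots> = ennreal (2 * V * (M\<^sup>2 * (C * r powr - (2 * s))))"
    using V C by (simp add: ennreal_mult)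
  also have "\<dots> < ennreal \<epsilon>" using r \<epsilon> by (intro ennreal_lessI)
  finally show ?thesis unfolding d_def by blast
qed

text \<open>
  Truncate the values, then the support, and treat the result chart by chart.
\<close>

theorem Lipschitz_functions_dense:
  fixes \<Omega> :: "'a::euclidean_space set"
  assumes \<Omega>: "lipschitz_domain \<Omega>" "bounded \<Omega>" and s: "0 < s" "s < 1"
    and v[measurable]: "v \<in> borel_measurable borel" and fin: "V_sq s \<Omega> v < \<infinity>"
  shows "Lipschitz_approximable s \<Omega> v"
  unfolding Lipschitz_approximable_def
proof (intro allI impI)
  fix \<epsilon> :: real assume \<epsilon>: "\<epsilon> > 0"
  have "open \<Omega>" using \<Omega> by (simp add: lipschitz_domain_def)
  then have [measurable]: "\<Omega> \<in> sets borel" by auto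
  have e16: "\<epsilon> / 16 > 0" using \<epsilon> by simp
  obtain n :: nat where n: "V_sq s \<Omega> (\<lambda>x. v x - clamp_real n (v x)) < ennreal (\<epsilon> / 16)"
    using V_sq_truncation[OF v _ fin e16] by auto
  define v1 where "v1 x = clamp_real (real n) (v x)" for x
  have [measurable]: "v1 \<in> borel_measurable borel" unfolding v1_def by measurable
  have v1: "\<bar>v1 x\<bar> \<le> real n" for x using clamp_real_bounds(1)[of "real n"] by (simp add: v1_def)
  obtain k where k: "V_sq s \<Omega> (\<lambda>x. v1 x - (if norm x \<le> k then v1 x else 0)) < ennreal (\<epsilon> / 16)"
    using V_sq_cutoff[OF \<Omega>(2) s(1), of v1 "real n" "\<epsilon> / 16"] v1 e16 by blast
  define v2 where "v2 x = (if norm x \<le> k then v1 x else 0)" for x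
  have [measurable]: "v2 \<in> borel_measurable borel" unfolding v2_def by measurable
  have neg: "V_sq s \<Omega> (\<lambda>x. a x - b x) = V_sq s \<Omega> (\<lambda>x. b x - a x)" for a b
  proof -
    have "(a x - b x - (a y - b y))\<^sup>2 = (b x - a x - (b y - a y))\<^sup>2" for x y
      by (metis (no_types) diff_diff_eq2 minus_diff_eq power2_commute diff_diff_add add_diff_eq add.commute)
    then show ?thesis by (simp add: V_sq_def L2sq_on_def energy_def power2_commute[of "a _" "b _"])
  qed
  have "V_sq s \<Omega> v2 \<le> 2 * V_sq s \<Omega> v1 + 2 * V_sq s \<Omega> (\<lambda>x. v2 x - v1 x)"
    using V_sq_add_le[of v1 "\<lambda>x. v2 x - v1 x" \<Omega> s] by simp
  also have "V_sq s \<Omega> (\<lambda>x. v2 x - v1 x) = V_sq s \<Omega> (\<lambda>x. v1 x - v2 x)" by (rule neg)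
  also have "V_sq s \<Omega> v1 \<le> 2 * V_sq s \<Omega> v + 2 * V_sq s \<Omega> (\<lambda>x. v1 x - v x)"
    using V_sq_add_le[of v "\<lambda>x. v1 x - v x" \<Omega> s] by simp
  also have "V_sq s \<Omega> (\<lambda>x. v1 x - v x) = V_sq s \<Omega> (\<lambda>x. v x - v1 x)" by (rule neg)
  finally have "V_sq s \<Omega> v2 \<le> 2 * (2 * V_sq s \<Omega> v + 2 * V_sq s \<Omega> (\<lambda>x. v x - v1 x)) + 2 * V_sq s \<Omega> (\<lambda>x. v1 x - v2 x)"
    by (simp add: mult_left_mono add_right_mono)
  also have "\<dots> < \<infinity>"
    using fin n k unfolding v1_def[symmetric] v2_def[symmetric]
    by (auto simp: ennreal_mult_less_top less_top intro: order.strict_trans)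
  finally have "energy s \<Omega> v2 < \<infinity>" by (simp add: V_sq_def)
  then have "Lipschitz_approximable s \<Omega> v2"
    by (intro approximable_of_bounded[OF \<Omega> s, where M = "real n" and R = k]) (use v1 in \<open>auto simp: v2_def\<close>)
  then obtain w L R where w: "L-lipschitz_on UNIV w" "\<forall>x. norm x > R \<longrightarrow> w x = 0" "V_sq s \<Omega> (\<lambda>x. v2 x - w x) < ennreal (\<epsilon> / 16)"
    using e16 unfolding Lipschitz_approximable_def by blast
  have [measurable]: "w \<in> borel_measurable borel"
    using w(1) by (auto intro!: borel_measurable_continuous_onI lipschitz_on_continuous_on)
  have "V_sq s \<Omega> (\<lambda>x. v1 x - w x) \<le> ennreal (2 * (\<epsilon> / 16) + 2 * (\<epsilon> / 16))"
    by (rule V_sq_triangle[where v = v2]) (use k w e16 in \<open>auto simp: v2_def[symmetric]\<close>)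
  note v1w = this
  have "V_sq s \<Omega> (\<lambda>x. v x - w x) \<le> ennreal (2 * (\<epsilon> / 16) + 2 * (2 * (\<epsilon> / 16) + 2 * (\<epsilon> / 16)))"
    by (rule V_sq_triangle[where v = v1, OF _ _ _ _ _ _ _ v1w]) (use n e16 in \<open>auto simp: v1_def[symmetric]\<close>)
  also have "\<dots> < ennreal \<epsilon>" using \<epsilon> by (intro ennreal_lessI) auto
  finally show "\<exists>w L R. L-lipschitz_on UNIV w \<and> (\<forall>x. norm x > R \<longrightarrow> w x = 0) \<and>
        V_sq s \<Omega> (\<lambda>x. v x - w x) < ennreal \<epsilon>"
    using w by blast
qed

section \<open>Piecewise affine functions on triangulations\<close>

text \<open>
  Seen from one of the points the others are linearly independent, so a linear functional may be
  prescribed on them.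
\<close>

lemma affine_interpolation:
  fixes C :: "'a::euclidean_space set" and c :: "'a \<Rightarrow> real"
  assumes C: "\<not> affine_dependent C"
  shows "\<exists>a b. \<forall>z\<in>C. a \<bullet> z + b = c z"
proof (cases "C = {}")
  case False
  then obtain z0 where z0: "z0 \<in> C" by blast
  define B where "B = (\<lambda>x. - z0 + x) ` (C - {z0})"
  have "independent B"
    using C affine_dependent_iff_dependent2[OF z0] by (simp add: B_def)
  then obtain g where g: "linear g" "\<forall>x\<in>B. g x = c (x + z0) - c z0"
    using linear_independent_extend[of B "\<lambda>x. c (x + z0) - c z0"] by blast
  define a where "a = adjoint g (1::real)"
  have ag: "a \<bullet> x = g x" for x
    using adjoint_works[OF g(1), of x 1] by (simp add: a_def inner_commute)
  have "a \<bullet> z + (c z0 - a \<bullet> z0) = c z" if "z \<in> C" for z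
  proof (cases "z = z0")
    case False
    then have "- z0 + z \<in> B" using that by (auto simp: B_def)
    then have "a \<bullet> (- z0 + z) = c z - c z0" using g(2) by (simp add: ag)
    then show ?thesis by (simp add: inner_diff_right)
  qed simp
  then show ?thesis by blast
qed auto

lemma convex_affine_agreement:
  fixes a a' :: "'a::euclidean_space"
  shows "convex {x. a \<bullet> x + b = a' \<bullet> x + (b'::real)}"
proof -
  have "{x. a \<bullet> x + b = a' \<bullet> x + b'} = {x. (a - a') \<bullet> x = b' - b}"
    by (auto simp: inner_diff_left)
  then show ?thesis by (simp add: convex_hyperplane)
qed

lemma simplex_interior_nonempty:
  fixes T :: "'a::euclidean_space set"
  assumes "int DIM('a) simplex T"
  shows "interior T \<noteq> {}"
proof -
  obtain C where C: "\<not> affine_dependent C" "int (card C) = int DIM('a) + 1" "T = convex hull C"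
    using assms by (auto simp: simplex_def)
  have "aff_dim T = int DIM('a)"
    using C by (simp add: aff_dim_convex_hull aff_dim_affine_independent)
  then have "rel_interior T = interior T" by (rule interior_rel_interior)
  moreover have "T \<noteq> {}" using C by auto
  ultimately show ?thesis using convex_simplex[OF assms] by (metis rel_interior_eq_empty)
qed

lemma triangulation_element:
  assumes "triangulation \<T>" "T \<in> \<T>"
  shows "compact T" "convex T" "closed T" "T = convex hull {z. z extreme_point_of T}"
    and "\<not> affine_dependent {z. z extreme_point_of T}" "finite {z. z extreme_point_of T}"
proof -
  obtain n where "n simplex T" using assms by (auto simp: triangulation_def)
  then obtain C where C: "finite C" "\<not> affine_dependent C" "T = convex hull C"
    by (auto simp: simplex)
  have E: "{z. z extreme_point_of T} = C"
    using extreme_point_of_convex_hull_affine_independent[OF C(2)] C(3) by auto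
  show "compact T" "convex T" "closed T" using \<open>n simplex T\<close> compact_simplex convex_simplex closed_simplex by auto
  show "T = convex hull {z. z extreme_point_of T}" "\<not> affine_dependent {z. z extreme_point_of T}"
    "finite {z. z extreme_point_of T}"
    using C E by auto
qed

definition piecewise_affine :: "'a::euclidean_space set set \<Rightarrow> ('a \<Rightarrow> real) \<Rightarrow> bool" where
  "piecewise_affine \<T> \<phi> \<longleftrightarrow> continuous_on (\<Union>\<T>) \<phi> \<and> (\<forall>T\<in>\<T>. \<exists>a b. \<forall>x\<in>T. \<phi> x = a \<bullet> x + b)"

text \<open>
  The affine interpolants of two elements agree at the extreme points of the common face, hence on the
  face by Krein--Milman, and so fit together to a continuous function.
\<close>

lemma nodal_interpolant_exists:
  fixes \<T> :: "'a::euclidean_space set set" and c :: "'a \<Rightarrow> real"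
  assumes tri: "triangulation \<T>"
  shows "\<exists>\<phi>. piecewise_affine \<T> \<phi> \<and> (\<forall>z\<in>mesh_vertices \<T>. \<phi> z = c z) \<and> (\<forall>x. x \<notin> \<Union>\<T> \<longrightarrow> \<phi> x = 0)"
proof -
  have "\<forall>T\<in>\<T>. \<exists>a b. \<forall>z. z extreme_point_of T \<longrightarrow> a \<bullet> z + b = c z"
    using affine_interpolation[OF triangulation_element(5)[OF tri]] by fastforce
  then obtain a b where ab: "\<And>T z. T \<in> \<T> \<Longrightarrow> z extreme_point_of T \<Longrightarrow> a T \<bullet> z + b T = c z"
    by metis
  have agree: "a T \<bullet> x + b T = a T' \<bullet> x + b T'" if T: "T \<in> \<T>" "T' \<in> \<T>" and x: "x \<in> T" "x \<in> T'" for T T' x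
  proof -
    have f: "(T \<inter> T') face_of T" "(T' \<inter> T) face_of T'"
      using tri T by (auto simp: triangulation_def)
    have F: "compact (T \<inter> T')" "convex (T \<inter> T')"
      using triangulation_element[OF tri] T by (auto intro!: compact_Int convex_Int)
    have "z \<in> {x. a T \<bullet> x + b T = a T' \<bullet> x + b T'}" if "z extreme_point_of (T \<inter> T')" for z
    proof -
      have "z extreme_point_of T" "z extreme_point_of T'"
        using that extreme_point_of_face[OF f(1)] extreme_point_of_face[OF f(2)] by (auto simp: Int_commute)
      then show ?thesis using ab T by simp
    qed
    then have "convex hull {z. z extreme_point_of (T \<inter> T')} \<subseteq> {x. a T \<bullet> x + b T = a T' \<bullet> x + b T'}"
      by (intro hull_minimal convex_affine_agreement) auto
    then show ?thesis using Krein_Milman_Minkowski[OF F] x by auto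
  qed
  define \<phi> where "\<phi> x = (if x \<in> \<Union>\<T> then a (SOME T. T \<in> \<T> \<and> x \<in> T) \<bullet> x + b (SOME T. T \<in> \<T> \<and> x \<in> T) else 0)" for x
  have \<phi>: "\<phi> x = a T \<bullet> x + b T" if "T \<in> \<T>" "x \<in> T" for T x
  proof -
    define S where "S = (SOME T. T \<in> \<T> \<and> x \<in> T)"
    have "S \<in> \<T> \<and> x \<in> S" unfolding S_def by (rule someI[of _ T]) (use that in blast)
    then show ?thesis using agree[of S T x] that by (auto simp: \<phi>_def S_def[symmetric])
  qed
  have "continuous_on (\<Union>T\<in>\<T>. T) \<phi>"
  proof (rule continuous_on_closed_Union)
    show "finite \<T>" using tri by (simp add: triangulation_def)
    show "closed T" if "T \<in> \<T>" for T using triangulation_element[OF tri that] by simp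
    show "continuous_on T \<phi>" if "T \<in> \<T>" for T
    proof -
      have "continuous_on T (\<lambda>x. a T \<bullet> x + b T)" by (intro continuous_intros)
      then show ?thesis using \<phi>[OF that] by (simp cong: continuous_on_cong)
    qed
  qed
  moreover have "\<phi> z = c z" if z: "z \<in> mesh_vertices \<T>" for z
  proof -
    obtain T where T: "T \<in> \<T>" "z extreme_point_of T" using z by (auto simp: mesh_vertices_def)
    then have "z \<in> T" by (simp add: extreme_point_of_def)
    then show ?thesis using \<phi> ab T by simp
  qed
  moreover have "\<forall>T\<in>\<T>. \<exists>a b. \<forall>x\<in>T. \<phi> x = a \<bullet> x + b" using \<phi> by blast
  moreover have "\<phi> x = 0" if "x \<notin> \<Union>\<T>" for x using that by (simp add: \<phi>_def)
  ultimately show ?thesis unfolding piecewise_affine_def by (intro exI[of _ \<phi>]) auto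
qed

lemma piecewise_affine_unique:
  assumes tri: "triangulation \<T>" and "piecewise_affine \<T> \<phi>" "piecewise_affine \<T> \<psi>"
    and eq: "\<And>z. z \<in> mesh_vertices \<T> \<Longrightarrow> \<phi> z = \<psi> z" and x: "x \<in> \<Union>\<T>"
  shows "\<phi> x = \<psi> x"
proof -
  obtain T where T: "T \<in> \<T>" "x \<in> T" using x by blast
  obtain a b where ab: "\<And>x. x \<in> T \<Longrightarrow> \<phi> x = a \<bullet> x + b" using assms(2) T unfolding piecewise_affine_def by blast
  obtain a' b' where ab': "\<And>x. x \<in> T \<Longrightarrow> \<psi> x = a' \<bullet> x + b'" using assms(3) T unfolding piecewise_affine_def by blast
  have "z \<in> {x. a \<bullet> x + b = a' \<bullet> x + b'}" if "z extreme_point_of T" for z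
  proof -
    have "z \<in> T" using that by (simp add: extreme_point_of_def)
    moreover have "z \<in> mesh_vertices \<T>" using that T by (auto simp: mesh_vertices_def)
    ultimately show ?thesis using ab ab' eq by force
  qed
  then have "convex hull {z. z extreme_point_of T} \<subseteq> {x. a \<bullet> x + b = a' \<bullet> x + b'}"
    by (intro hull_minimal convex_affine_agreement) auto
  then show ?thesis using triangulation_element(4)[OF tri T(1)] T ab ab' by auto
qed

text \<open>
  The description that defines \<open>nodal_basis\<close> has exactly one solution.
\<close>

lemma nodal_basis_props:
  assumes tri: "triangulation \<T>"
  shows "piecewise_affine \<T> (nodal_basis \<T> z)"
    and "z' \<in> mesh_vertices \<T> \<Longrightarrow> nodal_basis \<T> z z' = (if z' = z then 1 else 0)"
    and "x \<notin> \<Union>\<T> \<Longrightarrow> nodal_basis \<T> z x = 0"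
proof -
  define P where "P \<phi> \<longleftrightarrow> continuous_on (\<Union>\<T>) \<phi> \<and>
             (\<forall>T\<in>\<T>. \<exists>a b. \<forall>x\<in>T. \<phi> x = a \<bullet> x + b) \<and>
             (\<forall>z'\<in>mesh_vertices \<T>. \<phi> z' = (if z' = z then 1 else 0)) \<and>
             (\<forall>x. x \<notin> \<Union>\<T> \<longrightarrow> \<phi> x = 0)" for \<phi> :: "'a \<Rightarrow> real"
  have Pa: "P \<phi> \<longleftrightarrow> piecewise_affine \<T> \<phi> \<and> (\<forall>z'\<in>mesh_vertices \<T>. \<phi> z' = (if z' = z then 1 else 0)) \<and>
             (\<forall>x. x \<notin> \<Union>\<T> \<longrightarrow> \<phi> x = 0)" for \<phi>
    by (auto simp: P_def piecewise_affine_def)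
  obtain \<phi> where \<phi>: "P \<phi>" unfolding Pa using nodal_interpolant_exists[OF tri, of "\<lambda>z'. if z' = z then 1 else 0"] by blast
  have "\<psi> = \<phi>" if "P \<psi>" for \<psi>
  proof (rule ext)
    fix x show "\<psi> x = \<phi> x"
      using that \<phi> piecewise_affine_unique[OF tri, of \<psi> \<phi> x] unfolding Pa by (cases "x \<in> \<Union>\<T>") auto
  qed
  then have "P (THE \<phi>. P \<phi>)" using \<phi> by (intro theI[of P \<phi>])
  then have "P (nodal_basis \<T> z)" by (simp add: nodal_basis_def P_def)
  then show "piecewise_affine \<T> (nodal_basis \<T> z)"
    "z' \<in> mesh_vertices \<T> \<Longrightarrow> nodal_basis \<T> z z' = (if z' = z then 1 else 0)"
    "x \<notin> \<Union>\<T> \<Longrightarrow> nodal_basis \<T> z x = 0"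
    unfolding Pa by auto
qed

lemma finite_mesh_vertices:
  assumes "triangulation \<T>"
  shows "finite (mesh_vertices \<T>)"
proof -
  have "mesh_vertices \<T> = (\<Union>T\<in>\<T>. {z. z extreme_point_of T})" by (auto simp: mesh_vertices_def)
  then show ?thesis using assms triangulation_element(6)[OF assms] by (auto simp: triangulation_def)
qed

lemma V_h_function:
  fixes c :: "'a::euclidean_space \<Rightarrow> real" and c\<^sub>0 :: real
  assumes tri: "triangulation \<T>"
  defines "v \<equiv> (\<lambda>x. (\<Sum>z\<in>mesh_vertices \<T>. c z * nodal_basis \<T> z x) + c\<^sub>0 * indicator (- \<Union>\<T>) x)"
  shows "piecewise_affine \<T> v" and "z \<in> mesh_vertices \<T> \<Longrightarrow> v z = c z" and "x \<notin> \<Union>\<T> \<Longrightarrow> v x = c\<^sub>0"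
proof -
  define w where "w x = (\<Sum>z\<in>mesh_vertices \<T>. c z * nodal_basis \<T> z x)" for x
  have vw: "v x = w x" if "x \<in> \<Union>\<T>" for x using that by (simp add: v_def w_def)
  note pa = nodal_basis_props(1)[OF tri, unfolded piecewise_affine_def]
  have "continuous_on (\<Union>\<T>) w"
    unfolding w_def using pa by (intro continuous_on_sum continuous_on_mult continuous_on_const) blast
  then have "continuous_on (\<Union>\<T>) v" by (rule continuous_on_eq) (simp only: vw)
  moreover have "\<exists>a b. \<forall>x\<in>T. v x = a \<bullet> x + b" if T: "T \<in> \<T>" for T
  proof -
    have "\<forall>z. \<exists>a b. \<forall>x\<in>T. nodal_basis \<T> z x = a \<bullet> x + b" using pa T by blast
    then obtain a b where ab: "\<And>z x. x \<in> T \<Longrightarrow> nodal_basis \<T> z x = a z \<bullet> x + b z" by metis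
    have "v x = (\<Sum>z\<in>mesh_vertices \<T>. c z *\<^sub>R a z) \<bullet> x + (\<Sum>z\<in>mesh_vertices \<T>. c z * b z)" if "x \<in> T" for x
    proof -
      have "x \<in> \<Union>\<T>" using that T by blast
      then have "v x = w x" by (rule vw)
      then show ?thesis using ab[OF that] by (simp add: w_def inner_sum_left sum.distrib distrib_left)
    qed
    then show ?thesis by blast
  qed
  ultimately show "piecewise_affine \<T> v" by (auto simp: piecewise_affine_def)
  show "v z = c z" if z: "z \<in> mesh_vertices \<T>" for z
  proof -
    have "z \<in> \<Union>\<T>" using z by (auto simp: mesh_vertices_def extreme_point_of_def)
    then have "v z = w z" by (rule vw)
    also have "\<dots> = (\<Sum>y\<in>mesh_vertices \<T>. if z = y then c y else 0)"
      unfolding w_def using nodal_basis_props(2)[OF tri z] by (intro sum.cong) auto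
    also have "\<dots> = c z" using finite_mesh_vertices[OF tri] z by simp
    finally show ?thesis .
  qed
  show "v x = c\<^sub>0" if "x \<notin> \<Union>\<T>" for x
    using nodal_basis_props(3)[OF tri that] that by (simp add: v_def)
qed

text \<open>
  Along a segment that the mesh covers, the bounds of the pieces combine to a bound of the increment.
  Segments outside the mesh are not controlled: the values may jump at the boundary of the mesh.
\<close>

lemma piecewise_affine_Lipschitz_on_segment:
  fixes v :: "'a::euclidean_space \<Rightarrow> real"
  assumes tri: "triangulation \<T>" and K: "K \<ge> 0"
    and v: "\<And>T. T \<in> \<T> \<Longrightarrow> \<exists>a b. norm a \<le> K \<and> (\<forall>x\<in>T. v x = a \<bullet> x + b)"
    and seg: "closed_segment x y \<subseteq> \<Union>\<T>"
  shows "\<bar>v x - v y\<bar> \<le> K * dist x y"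
proof -
  define \<gamma> where "\<gamma> t = x + t *\<^sub>R (y - x)" for t
  have \<gamma>s: "\<gamma> t \<in> closed_segment x y" if "0 \<le> t" "t \<le> 1" for t
    using that by (auto simp: \<gamma>_def closed_segment_def algebra_simps intro!: exI[of _ t])
  have L: "(K * dist x y)-lipschitz_on {0..1} (\<lambda>t. v (\<gamma> t))"
  proof (rule lipschitz_on_closed_Union[where I = \<T> and U = "\<lambda>T. \<gamma> -` T"])
    fix T assume T: "T \<in> \<T>"
    obtain a b where ab: "norm a \<le> K" "\<And>x. x \<in> T \<Longrightarrow> v x = a \<bullet> x + b" using v[OF T] by blast
    show "(K * dist x y)-lipschitz_on (\<gamma> -` T) (\<lambda>t. v (\<gamma> t))"
    proof (rule lipschitz_onI)
      fix t t' assume "t \<in> \<gamma> -` T" "t' \<in> \<gamma> -` T"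
      then have "v (\<gamma> t) - v (\<gamma> t') = (t - t') * (a \<bullet> (y - x))"
        using ab(2)[of "\<gamma> t"] ab(2)[of "\<gamma> t'"] by (simp add: \<gamma>_def inner_add_right algebra_simps)
      then have "dist (v (\<gamma> t)) (v (\<gamma> t')) = \<bar>a \<bullet> (y - x)\<bar> * dist t t'"
        by (simp add: dist_real_def abs_mult mult.commute)
      also have "\<bar>a \<bullet> (y - x)\<bar> \<le> norm a * norm (y - x)" by (rule Cauchy_Schwarz_ineq2)
      also have "\<dots> \<le> K * dist x y"
        using ab(1) by (simp add: dist_norm norm_minus_commute mult_right_mono)
      finally show "dist (v (\<gamma> t)) (v (\<gamma> t')) \<le> K * dist x y * dist t t'" by (simp add: mult_right_mono)
    qed (use K in simp)
    show "closed (\<gamma> -` T)"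
      using triangulation_element(3)[OF tri T] unfolding \<gamma>_def
      by (intro closed_vimage) (auto intro!: continuous_intros)
  next
    show "{0..1} \<subseteq> (\<Union>T\<in>\<T>. \<gamma> -` T)"
    proof
      fix t :: real assume "t \<in> {0..1}"
      then have "\<gamma> t \<in> \<Union>\<T>" using \<gamma>s[of t] seg by auto
      then show "t \<in> (\<Union>T\<in>\<T>. \<gamma> -` T)" by auto
    qed
  qed (use tri K in \<open>auto simp: triangulation_def\<close>)
  have "dist (v (\<gamma> 0)) (v (\<gamma> 1)) \<le> K * dist x y * dist (0::real) 1"
    by (rule lipschitz_onD[OF L]) auto
  then show ?thesis by (simp add: \<gamma>_def dist_real_def)
qed

lemma affine_oscillation_le:
  fixes a :: "'a::euclidean_space"
  assumes tri: "triangulation \<T>" and T: "T \<in> \<T>"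
    and D: "\<And>z z'. z extreme_point_of T \<Longrightarrow> z' extreme_point_of T \<Longrightarrow> a \<bullet> z - a \<bullet> z' \<le> D"
    and x: "x \<in> T" "y \<in> T"
  shows "a \<bullet> x - a \<bullet> y \<le> D"
proof -
  have hull: "T = convex hull {z. z extreme_point_of T}" by (rule triangulation_element(4)[OF tri T])
  have 1: "a \<bullet> x - a \<bullet> z \<le> D" if z: "z extreme_point_of T" for z
  proof -
    have "convex hull {z. z extreme_point_of T} \<subseteq> {x. a \<bullet> x \<le> D + a \<bullet> z}"
      using D[OF _ z] by (intro hull_minimal convex_halfspace_le) (auto simp: algebra_simps)
    then show ?thesis using x(1) hull by (auto simp: algebra_simps)
  qed
  have "convex hull {z. z extreme_point_of T} \<subseteq> {y. a \<bullet> y \<ge> a \<bullet> x - D}"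
    using 1 by (intro hull_minimal convex_halfspace_ge) (auto simp: algebra_simps)
  then show ?thesis using x(2) hull by (auto simp: algebra_simps)
qed

text \<open>
  An affine function with gradient \<open>a\<close> oscillates by \<open>2 r \<bar>a\<bar>\<close> on a ball of radius \<open>r\<close>.
\<close>

lemma gradient_le_oscillation:
  fixes a :: "'a::euclidean_space"
  assumes T: "T \<noteq> {}" and D: "\<And>x y. x \<in> T \<Longrightarrow> y \<in> T \<Longrightarrow> a \<bullet> x - a \<bullet> y \<le> D"
  shows "norm a * inball_diameter T \<le> D"
proof (cases "a = 0")
  case True
  then show ?thesis using T D by force
next
  case False
  obtain x0 where x0: "x0 \<in> T" using T by blast
  have "inball_diameter T \<le> D / norm a"
    unfolding inball_diameter_def
  proof (rule cSup_least)
    show "{2 * r |r. 0 \<le> r \<and> (\<exists>x. cball x r \<subseteq> T)} \<noteq> {}" using x0 by (auto intro!: exI[of _ 0] exI[of _ x0])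
    fix d assume "d \<in> {2 * r |r. 0 \<le> r \<and> (\<exists>x. cball x r \<subseteq> T)}"
    then obtain r x where r: "d = 2 * r" "0 \<le> r" "cball x r \<subseteq> T" by blast
    define e where "e = (r / norm a) *\<^sub>R a"
    have ne: "norm e = r" using False r by (simp add: e_def)
    have "x + e \<in> T" "x - e \<in> T" using r ne by (auto simp: subset_iff dist_norm)
    then have "a \<bullet> (x + e) - a \<bullet> (x - e) \<le> D" by (rule D)
    moreover have "a \<bullet> (x + e) - a \<bullet> (x - e) = 2 * (r * norm a)"
      using False by (simp add: e_def inner_add_right inner_diff_right flip: power2_norm_eq_inner) (simp add: power2_eq_square)
    ultimately show "d \<le> D / norm a" using r False by (simp add: field_simps)
  qed
  then show ?thesis using False by (simp add: field_simps)
qed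

lemma inball_diameter_pos:
  fixes T :: "'a::euclidean_space set"
  assumes "int DIM('a) simplex T"
  shows "inball_diameter T > 0"
proof -
  obtain x r where r: "r > 0" "cball x r \<subseteq> T"
    using simplex_interior_nonempty[OF assms] by (meson all_not_in_conv mem_interior_cball)
  have bT: "bounded T" using compact_simplex[OF assms] by (rule compact_imp_bounded)
  have "2 * r \<le> inball_diameter T"
    unfolding inball_diameter_def
  proof (rule cSup_upper)
    show "2 * r \<in> {2 * r |r. 0 \<le> r \<and> (\<exists>x. cball x r \<subseteq> T)}" using r by auto
    show "bdd_above {2 * r |r. 0 \<le> r \<and> (\<exists>x. cball x r \<subseteq> T)}"
    proof (rule bdd_aboveI[of _ "diameter T"])
      fix d assume "d \<in> {2 * r |r. 0 \<le> r \<and> (\<exists>x. cball x r \<subseteq> T)}"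
      then obtain r x where r: "d = 2 * r" "0 \<le> r" "cball x r \<subseteq> T" by blast
      then show "d \<le> diameter T" using diameter_subset[OF r(3) bT] by simp
    qed
  qed
  then show ?thesis using r by simp
qed

text \<open>
  The interpolant oscillates on \<open>T\<close> by at most \<open>L * diameter T\<close>, its extremes being attained at vertices;
  shape regularity compares the diameter with that of an inscribed ball.
\<close>

lemma interpolant_gradient_bound:
  fixes a :: "'a::euclidean_space" and w :: "'a \<Rightarrow> real"
  assumes tri: "triangulation \<T>" and T: "T \<in> \<T>" "int DIM('a) simplex T"
    and \<sigma>: "diameter T / inball_diameter T \<le> \<sigma>" and w: "L-lipschitz_on UNIV w"
    and ab: "\<And>z. z extreme_point_of T \<Longrightarrow> a \<bullet> z + b = w z"
  shows "norm a \<le> L * \<sigma>"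
proof -
  have L: "L \<ge> 0" using w by (rule lipschitz_on_nonneg)
  have bT: "bounded T" using compact_simplex[OF T(2)] by (rule compact_imp_bounded)
  have "a \<bullet> z - a \<bullet> z' \<le> L * diameter T" if z: "z extreme_point_of T" "z' extreme_point_of T" for z z'
  proof -
    have "a \<bullet> z - a \<bullet> z' = w z - w z'" using ab[OF z(1)] ab[OF z(2)] by simp
    also have "\<dots> \<le> L * dist z z'" using lipschitz_onD[OF w, of z z'] by (simp add: dist_real_def)
    also have "\<dots> \<le> L * diameter T"
      using z L by (intro mult_left_mono diameter_bounded_bound[OF bT]) (auto simp: extreme_point_of_def)
    finally show ?thesis .
  qed
  then have "a \<bullet> x - a \<bullet> y \<le> L * diameter T" if "x \<in> T" "y \<in> T" for x y
    using affine_oscillation_le[OF tri T(1) _ that] by blast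
  moreover have "T \<noteq> {}" using simplex_interior_nonempty[OF T(2)] by auto
  ultimately have "norm a * inball_diameter T \<le> L * diameter T" by (intro gradient_le_oscillation)
  then have "norm a \<le> L * (diameter T / inball_diameter T)"
    using inball_diameter_pos[OF T(2)] by (simp add: field_simps)
  also have "\<dots> \<le> L * \<sigma>" using \<sigma> L by (rule mult_left_mono)
  finally show ?thesis .
qed

lemma interpolant_error:
  fixes a :: "'a::euclidean_space" and w :: "'a \<Rightarrow> real"
  assumes tri: "triangulation \<T>" and T: "T \<in> \<T>" and w: "L-lipschitz_on UNIV w"
    and ab: "\<And>z. z extreme_point_of T \<Longrightarrow> a \<bullet> z + b = w z" and x: "x \<in> T"
  shows "\<bar>w x - (a \<bullet> x + b)\<bar> \<le> L * diameter T"
proof -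
  have L: "L \<ge> 0" using w by (rule lipschitz_on_nonneg)
  have bT: "bounded T" using triangulation_element(1)[OF tri T] by (rule compact_imp_bounded)
  have z: "\<bar>w z - w x\<bar> \<le> L * diameter T" if "z extreme_point_of T" for z
  proof -
    have "\<bar>w z - w x\<bar> \<le> L * dist z x" using lipschitz_onD[OF w, of z x] by (simp add: dist_real_def)
    also have "\<dots> \<le> L * diameter T"
      using that x L by (intro mult_left_mono diameter_bounded_bound[OF bT]) (auto simp: extreme_point_of_def)
    finally show ?thesis .
  qed
  have "convex hull {z. z extreme_point_of T} \<subseteq> {y. a \<bullet> y \<le> w x + L * diameter T - b}"
    using ab z by (intro hull_minimal convex_halfspace_le) (force simp: abs_le_iff)
  moreover have "convex hull {z. z extreme_point_of T} \<subseteq> {y. a \<bullet> y \<ge> w x - L * diameter T - b}"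
    using ab z by (intro hull_minimal convex_halfspace_ge) (force simp: abs_le_iff)
  moreover have "x \<in> convex hull {z. z extreme_point_of T}"
    using triangulation_element(4)[OF tri T] x by simp
  ultimately have "a \<bullet> x \<le> w x + L * diameter T - b" "a \<bullet> x \<ge> w x - L * diameter T - b" by auto
  then show ?thesis by (auto simp: abs_le_iff)
qed

text \<open>
  A point outside \<open>\<Omega>\<close> is at least as close to the boundary as to any point of \<open>closure \<Omega>\<close>, and a point
  of \<open>\<Omega>\<close> is within \<open>diameter \<Omega>\<close> of the boundary; so the computational domain contains the whole
  \<open>H\<close>-neighbourhood of \<open>closure \<Omega>\<close>.
\<close>

lemma mem_comp_domain:
  fixes \<Omega> :: "'a::euclidean_space set"
  assumes \<Omega>: "open \<Omega>" "bounded \<Omega>" and H: "diameter \<Omega> < H" and x: "x \<in> closure \<Omega>" "dist x y \<le> H"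
  shows "y \<in> comp_domain \<Omega> H"
proof -
  have "\<exists>w\<in>frontier \<Omega>. dist y w \<le> H"
  proof (cases "y \<in> \<Omega>")
    case True
    have "\<Omega> \<noteq> UNIV" using \<Omega> not_bounded_UNIV by metis
    then have "frontier \<Omega> \<noteq> {}" using True by (simp add: frontier_eq_empty) blast
    then obtain w where w: "w \<in> frontier \<Omega>" by blast
    have "dist y w \<le> diameter (closure \<Omega>)"
      using \<Omega> True w closure_subset by (intro diameter_bounded_bound) (auto simp: frontier_def)
    then show ?thesis using w H \<Omega> by (auto simp: diameter_closure intro!: bexI[of _ w])
  next
    case False
    show ?thesis
    proof (cases "x \<in> \<Omega>")
      case True
      then have "closed_segment x y \<inter> frontier \<Omega> \<noteq> {}"
        using False by (intro connected_Int_frontier) auto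
      then obtain w where w: "w \<in> closed_segment x y" "w \<in> frontier \<Omega>" by blast
      have "dist y w \<le> dist x y"
        using segment_bound(2)[OF w(1)] by (simp add: dist_norm norm_minus_commute)
      then show ?thesis using w x by (intro bexI[of _ w]) auto
    next
      case nx: False
      then have "x \<in> frontier \<Omega>" using x \<Omega> by (simp add: frontier_def interior_open)
      then show ?thesis using x by (intro bexI[of _ x]) (auto simp: dist_commute)
    qed
  qed
  then show ?thesis unfolding comp_domain_def using infdist_le order_trans by blast
qed

section \<open>Finite element approximation\<close>

lemma is_mesh_facts:
  fixes \<Omega> :: "'a::euclidean_space set"
  assumes "is_mesh \<Omega> H \<T>"
  shows "triangulation \<T>" "\<And>T. T \<in> \<T> \<Longrightarrow> int DIM('a) simplex T" "comp_domain \<Omega> H \<subseteq> \<Union>\<T>" "finite \<T>" "compact (\<Union>\<T>)"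
proof -
  show t: "triangulation \<T>" "\<And>T. T \<in> \<T> \<Longrightarrow> int DIM('a) simplex T" "comp_domain \<Omega> H \<subseteq> \<Union>\<T>"
    using assms by (auto simp: is_mesh_def)
  show "finite \<T>" using t by (simp add: triangulation_def)
  then show "compact (\<Union>\<T>)" using triangulation_element(1)[OF t(1)] by (intro compact_Union) auto
qed

lemma segment_in_mesh:
  assumes \<Omega>: "open \<Omega>" "bounded \<Omega>" and H: "diameter \<Omega> < H" and mesh: "is_mesh \<Omega> H \<T>"
    and x: "x \<in> closure \<Omega>" "dist x y \<le> H"
  shows "closed_segment x y \<subseteq> \<Union>\<T>"
proof
  fix w assume "w \<in> closed_segment x y"
  then have "dist x w \<le> H" using segment_bound(1)[of w x y] x(2) by (simp add: dist_norm norm_minus_commute)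
  then show "w \<in> \<Union>\<T>" using mem_comp_domain[OF \<Omega> H x(1)] is_mesh_facts(3)[OF mesh] by blast
qed

lemma V_sq_Lipschitz_bound:
  fixes \<Omega> :: "'a::euclidean_space set"
  assumes \<Omega>: "bounded \<Omega>" "open \<Omega>" and s: "0 < s" "s < 1"
  shows "\<exists>C\<ge>0. \<forall>(v::'a \<Rightarrow> real) L m. L \<ge> 0 \<longrightarrow> (\<forall>x. \<bar>v x\<bar> \<le> m) \<longrightarrow>
     near_Lipschitz \<Omega> L v \<longrightarrow>
     V_sq s \<Omega> v \<le> ennreal (C * ((2 * m) powr (1 - s) * L powr (1 + s) + (2 * m)\<^sup>2))"
proof -
  obtain C where C: "C \<ge> 0" "\<And>(v::'a \<Rightarrow> real) L \<eta>. L \<ge> 0 \<Longrightarrow>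
     (\<forall>x y. x \<in> closure \<Omega> \<longrightarrow> \<bar>v x - v y\<bar> \<le> \<eta>) \<Longrightarrow>
     near_Lipschitz \<Omega> L v \<Longrightarrow>
     energy s \<Omega> v \<le> ennreal (C * (\<eta> powr (1 - s) * L powr (1 + s) + \<eta>\<^sup>2))"
    using energy_Lipschitz_bound[OF \<Omega>(1) s] by blast
  define V where "V = measure lborel \<Omega>"
  have "emeasure lborel \<Omega> < \<infinity>"
    using \<Omega> by (intro emeasure_bounded_finite) auto
  then have V: "V \<ge> 0" "emeasure lborel \<Omega> = ennreal V"
    by (auto simp: V_def less_top[symmetric] intro!: emeasure_eq_ennreal_measure)
  show ?thesis
  proof (intro exI[of _ "C + V"] conjI allI impI)
    fix v :: "'a \<Rightarrow> real" and L m :: real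
    assume L: "L \<ge> 0" and m: "\<forall>x. \<bar>v x\<bar> \<le> m"
      and Lip: "near_Lipschitz \<Omega> L v"
    have m0: "m \<ge> 0" using m abs_ge_zero order_trans by blast
    define A where "A = (2 * m) powr (1 - s) * L powr (1 + s)"
    have A: "A \<ge> 0" by (simp add: A_def)
    have "\<bar>v x - v y\<bar> \<le> 2 * m" for x y
      using m[rule_format, of x] m[rule_format, of y] by linarith
    then have en: "energy s \<Omega> v \<le> ennreal (C * (A + (2 * m)\<^sup>2))"
      unfolding A_def by (intro C(2) L Lip) auto
    have "L2sq_on \<Omega> v \<le> (\<integral>\<^sup>+x. ennreal (m\<^sup>2) * indicator \<Omega> x \<partial>lborel)"
      unfolding L2sq_on_def
      using m m0 by (intro nn_integral_mono) (auto simp: indicator_def abs_le_square_iff[symmetric] intro!: ennreal_leI)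
    also have "\<dots> = ennreal (m\<^sup>2) * emeasure lborel \<Omega>"
      using \<Omega> by (intro nn_integral_cmult_indicator) auto
    also have "\<dots> = ennreal (m\<^sup>2 * V)" using V by (simp add: ennreal_mult)
    finally have "V_sq s \<Omega> v \<le> ennreal (m\<^sup>2 * V) + ennreal (C * (A + (2 * m)\<^sup>2))"
      unfolding V_sq_def by (intro add_mono en)
    also have "\<dots> = ennreal (m\<^sup>2 * V + C * (A + (2 * m)\<^sup>2))"
      using V C A by (intro ennreal_plus[symmetric]) auto
    also have "\<dots> \<le> ennreal ((C + V) * (A + (2 * m)\<^sup>2))"
    proof (rule ennreal_leI)
      have "m\<^sup>2 * V \<le> (A + (2 * m)\<^sup>2) * V" using V A by (intro mult_right_mono) (auto simp: power_mult_distrib)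
      then show "m\<^sup>2 * V + C * (A + (2 * m)\<^sup>2) \<le> (C + V) * (A + (2 * m)\<^sup>2)" by (simp add: algebra_simps)
    qed
    finally show "V_sq s \<Omega> v \<le> ennreal ((C + V) * ((2 * m) powr (1 - s) * L powr (1 + s) + (2 * m)\<^sup>2))"
      by (simp add: A_def)
  qed (use V C in auto)
qed

text \<open>
  Discrete functions jump only at the boundary of the mesh. Its distance from \<open>\<Omega>\<close> is at least \<open>H > 0\<close>,
  so near \<open>closure \<Omega>\<close> they are Lipschitz.
\<close>

lemma V_h_finite_energy:
  fixes \<Omega> :: "'a::euclidean_space set"
  assumes \<Omega>: "open \<Omega>" "bounded \<Omega>" and s: "0 < s" "s < 1" and H: "diameter \<Omega> < H"
    and mesh: "is_mesh \<Omega> H \<T>" and v: "v \<in> V_h_space \<T>"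
  shows "v \<in> borel_measurable borel" "V_sq s \<Omega> v < \<infinity>"
proof -
  note m = is_mesh_facts[OF mesh]
  obtain c c\<^sub>0 where v_eq: "v = (\<lambda>x. (\<Sum>z\<in>mesh_vertices \<T>. c z * nodal_basis \<T> z x) + c\<^sub>0 * indicator (- \<Union>\<T>) x)"
    using v by (auto simp: V_h_space_def)
  have pa: "piecewise_affine \<T> v" and out: "\<And>x. x \<notin> \<Union>\<T> \<Longrightarrow> v x = c\<^sub>0"
    unfolding v_eq by (rule V_h_function[OF m(1)])+
  have cont: "continuous_on (\<Union>\<T>) v" using pa by (simp add: piecewise_affine_def)
  have "closed (\<Union>\<T>)" using m(5) by (rule compact_imp_closed)
  then have "(\<lambda>x. if x \<in> \<Union>\<T> then v x else c\<^sub>0) \<in> borel_measurable borel"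
    by (intro borel_measurable_continuous_on_if cont) auto
  moreover have "(\<lambda>x. if x \<in> \<Union>\<T> then v x else c\<^sub>0) = v" using out by (intro ext) (simp split: if_splits)
  ultimately show "v \<in> borel_measurable borel" by simp
  have "bounded (v ` \<Union>\<T>)" by (intro compact_imp_bounded compact_continuous_image cont m)
  then obtain M0 where M0: "\<And>x. x \<in> \<Union>\<T> \<Longrightarrow> \<bar>v x\<bar> \<le> M0" by (auto simp: bounded_iff)
  define M where "M = max M0 \<bar>c\<^sub>0\<bar>"
  have M: "\<bar>v x\<bar> \<le> M" for x using M0[of x] out[of x] by (cases "x \<in> \<Union>\<T>") (auto simp: M_def)
  have M00: "M \<ge> 0" by (simp add: M_def)
  have "\<forall>T\<in>\<T>. \<exists>a b. \<forall>x\<in>T. v x = a \<bullet> x + b" using pa by (simp add: piecewise_affine_def)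
  then obtain a b where ab: "\<And>T x. T \<in> \<T> \<Longrightarrow> x \<in> T \<Longrightarrow> v x = a T \<bullet> x + b T" by metis
  define K where "K = (\<Sum>T\<in>\<T>. norm (a T))"
  have K: "K \<ge> 0" by (simp add: K_def sum_nonneg)
  have aK: "norm (a T) \<le> K" if "T \<in> \<T>" for T unfolding K_def using m(4) that by (intro member_le_sum) auto
  have H0: "H > 0" using diameter_ge_0[OF \<Omega>(2)] H by linarith
  obtain C where C: "C \<ge> 0" "\<forall>(v::'a \<Rightarrow> real) L m. L \<ge> 0 \<longrightarrow> (\<forall>x. \<bar>v x\<bar> \<le> m) \<longrightarrow>
     near_Lipschitz \<Omega> L v \<longrightarrow>
     V_sq s \<Omega> v \<le> ennreal (C * ((2 * m) powr (1 - s) * L powr (1 + s) + (2 * m)\<^sup>2))"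
    using V_sq_Lipschitz_bound[OF \<Omega>(2,1) s] by blast
  have near: "\<bar>v x - v y\<bar> \<le> max K (2 * M / H) * dist x y" if x: "x \<in> closure \<Omega>" for x y
  proof (cases "dist x y \<le> H")
    case True
    have "\<bar>v x - v y\<bar> \<le> K * dist x y"
      using ab aK by (intro piecewise_affine_Lipschitz_on_segment[OF m(1) K _ segment_in_mesh[OF \<Omega> H mesh x True]]) blast
    also have "\<dots> \<le> max K (2 * M / H) * dist x y" by (intro mult_right_mono) auto
    finally show ?thesis .
  next
    case False
    have "\<bar>v x - v y\<bar> \<le> 2 * M / H * H" using M[of x] M[of y] H0 by simp
    also have "\<dots> \<le> max K (2 * M / H) * dist x y" using False M00 H0 K by (intro mult_mono) (auto simp: le_max_iff_disj)
    finally show ?thesis .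
  qed
  have "V_sq s \<Omega> v \<le> ennreal (C * ((2 * M) powr (1 - s) * (max K (2 * M / H)) powr (1 + s) + (2 * M)\<^sup>2))"
    by (rule C(2)[rule_format]) (use K M near in \<open>auto simp: near_Lipschitz_def\<close>)
  then show "V_sq s \<Omega> v < \<infinity>" by (rule le_less_trans) simp
qed

lemma interpolant_in_V_h:
  fixes \<Omega> :: "'a::euclidean_space set"
  assumes \<Omega>: "open \<Omega>" "bounded \<Omega>" and H: "diameter \<Omega> < H" "1 \<le> H" and mesh: "is_mesh \<Omega> H \<T>"
    and size: "0 \<le> mesh_size \<T>"
    and \<sigma>: "\<And>T. T \<in> \<T> \<Longrightarrow> diameter T / inball_diameter T \<le> \<sigma>" "\<sigma> \<ge> 0"
    and w: "L-lipschitz_on UNIV w" and out: "\<And>x. x \<notin> comp_domain \<Omega> H \<Longrightarrow> w x = 0"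
  shows "\<exists>v\<in>V_h_space \<T>. (\<forall>x. \<bar>w x - v x\<bar> \<le> L * mesh_size \<T>) \<and>
     near_Lipschitz \<Omega> (L + L * \<sigma>) (\<lambda>x. w x - v x)"
proof -
  note m = is_mesh_facts[OF mesh]
  have L: "L \<ge> 0" using w by (rule lipschitz_on_nonneg)
  define v where "v = (\<lambda>x. (\<Sum>z\<in>mesh_vertices \<T>. w z * nodal_basis \<T> z x) + 0 * indicator (- \<Union>\<T>) x)"
  have vV: "v \<in> V_h_space \<T>" unfolding V_h_space_def v_def by blast
  have pa: "piecewise_affine \<T> v" and nodal: "\<And>z. z \<in> mesh_vertices \<T> \<Longrightarrow> v z = w z" and vout: "\<And>x. x \<notin> \<Union>\<T> \<Longrightarrow> v x = 0"
    unfolding v_def by (rule V_h_function[OF m(1)]; assumption)+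
  have "\<forall>T\<in>\<T>. \<exists>a b. \<forall>x\<in>T. v x = a \<bullet> x + b" using pa by (simp add: piecewise_affine_def)
  then obtain a b where ab: "\<And>T x. T \<in> \<T> \<Longrightarrow> x \<in> T \<Longrightarrow> v x = a T \<bullet> x + b T" by metis
  have abz: "a T \<bullet> z + b T = w z" if "T \<in> \<T>" "z extreme_point_of T" for T z
  proof -
    have "z \<in> T" using that by (simp add: extreme_point_of_def)
    then show ?thesis using ab[OF that(1)] nodal[of z] that by (auto simp: mesh_vertices_def)
  qed
  have grad: "norm (a T) \<le> L * \<sigma>" if T: "T \<in> \<T>" for T
    using interpolant_gradient_bound[OF m(1) T m(2)[OF T] \<sigma>(1)[OF T] w abz[OF T]] .
  have err: "\<bar>w x - v x\<bar> \<le> L * mesh_size \<T>" if x: "x \<in> \<Union>\<T>" for x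
  proof -
    obtain T where T: "T \<in> \<T>" "x \<in> T" using x by blast
    have "\<bar>w x - v x\<bar> \<le> L * diameter T"
      using interpolant_error[OF m(1) T(1) w abz[OF T(1)] T(2)] ab[OF T] by simp
    also have "\<dots> \<le> L * mesh_size \<T>"
      unfolding mesh_size_def using T m(4) L by (intro mult_left_mono Max_ge) auto
    finally show ?thesis .
  qed
  have err': "\<bar>w x - v x\<bar> \<le> L * mesh_size \<T>" for x
  proof (cases "x \<in> \<Union>\<T>")
    case False
    then have "w x - v x = 0" using vout[of x] out[of x] m(3) by auto
    then show ?thesis using L size by simp
  qed (rule err)
  have near: "\<bar>(w x - v x) - (w y - v y)\<bar> \<le> (L + L * \<sigma>) * dist x y" if x: "x \<in> closure \<Omega>" "dist x y < 1" for x y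
  proof -
    have "dist x y \<le> H" using x(2) H by simp
    then have "\<bar>v x - v y\<bar> \<le> L * \<sigma> * dist x y"
      using ab grad L \<sigma>(2) by (intro piecewise_affine_Lipschitz_on_segment[OF m(1) _ _ segment_in_mesh[OF \<Omega> H(1) mesh x(1)]]) (simp, blast, simp)
    moreover have "\<bar>w x - w y\<bar> \<le> L * dist x y" using lipschitz_onD[OF w, of x y] by (simp add: dist_real_def)
    ultimately show ?thesis by (simp add: distrib_right)
  qed
  show ?thesis using err' near vV unfolding near_Lipschitz_def by blast
qed

text \<open>
  For the interpolation error \<open>m = L h\<close> tends to 0 and \<open>L + L \<sigma>\<close> is fixed in
  \<open>V_sq_Lipschitz_bound\<close>; here \<open>1 - s > 0\<close> is used.
\<close>

lemma V_h_approximation: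
  fixes \<Omega> :: "'a::euclidean_space set"
  assumes \<Omega>: "lipschitz_domain \<Omega>" "bounded \<Omega>" and s: "0 < s" "s < 1"
    and u: "u \<in> borel_measurable borel" "V_sq s \<Omega> u < \<infinity>"
    and H: "\<And>h. h > 0 \<Longrightarrow> H h > diameter \<Omega>" "filterlim H at_top (at_right 0)"
    and mesh: "\<And>h. h > 0 \<Longrightarrow> is_mesh \<Omega> (H h) (\<T> h)" "\<And>h. h > 0 \<Longrightarrow> mesh_size (\<T> h) = h"
    and reg: "shape_regular \<T>" and \<epsilon>: "(\<epsilon>::real) > 0"
  shows "\<forall>\<^sub>F h in at_right 0. \<exists>v\<in>V_h_space (\<T> h). V_sq s \<Omega> (\<lambda>x. u x - v x) \<le> ennreal \<epsilon>"
proof -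
  have o: "open \<Omega>" "\<Omega> \<noteq> {}" using \<Omega> by (auto simp: lipschitz_domain_def)
  obtain x0 where x0: "x0 \<in> \<Omega>" using o by blast
  obtain \<sigma>0 where \<sigma>0: "\<And>h T. h > 0 \<Longrightarrow> T \<in> \<T> h \<Longrightarrow> diameter T / inball_diameter T \<le> \<sigma>0"
    using reg unfolding shape_regular_def by blast
  define \<sigma> where "\<sigma> = max 0 \<sigma>0"
  have \<sigma>: "\<And>h T. h > 0 \<Longrightarrow> T \<in> \<T> h \<Longrightarrow> diameter T / inball_diameter T \<le> \<sigma>" "\<sigma> \<ge> 0"
    using \<sigma>0 by (auto simp: \<sigma>_def le_max_iff_disj)
  obtain w L R where w: "L-lipschitz_on UNIV w" "\<And>x. norm x > R \<Longrightarrow> w x = 0" "V_sq s \<Omega> (\<lambda>x. u x - w x) < ennreal (\<epsilon> / 4)"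
    using Lipschitz_functions_dense[OF \<Omega> s u, unfolded Lipschitz_approximable_def, rule_format, of "\<epsilon> / 4"] \<epsilon> by auto
  have L: "L \<ge> 0" using w(1) by (rule lipschitz_on_nonneg)
  have wb: "w \<in> borel_measurable borel"
    using w(1) by (intro borel_measurable_continuous_onI lipschitz_on_continuous_on)
  obtain C where C: "C \<ge> 0" "\<forall>(v::'a \<Rightarrow> real) L m. L \<ge> 0 \<longrightarrow> (\<forall>x. \<bar>v x\<bar> \<le> m) \<longrightarrow>
     near_Lipschitz \<Omega> L v \<longrightarrow>
     V_sq s \<Omega> v \<le> ennreal (C * ((2 * m) powr (1 - s) * L powr (1 + s) + (2 * m)\<^sup>2))"
    using V_sq_Lipschitz_bound[OF \<Omega>(2) o(1) s] by blast
  define E where "E h = C * ((2 * (L * h)) powr (1 - s) * (L + L * \<sigma>) powr (1 + s) + (2 * (L * h))\<^sup>2)" for h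
  have idr: "((\<lambda>h::real. h) \<longlongrightarrow> 0) (at_right 0)" by (rule tendsto_ident_at)
  have lin: "((\<lambda>h. 2 * (L * h)) \<longlongrightarrow> 0) (at_right 0)"
    using tendsto_mult[OF tendsto_const[of "2 * L"] idr] by (simp add: mult.assoc)
  have pos: "\<forall>\<^sub>F h in at_right 0. 0 \<le> 2 * (L * h)"
    by (rule eventually_mono[OF eventually_at_right_less]) (use L in auto)
  have p1: "((\<lambda>h. (2 * (L * h)) powr (1 - s)) \<longlongrightarrow> 0) (at_right 0)"
    using tendsto_zero_powrI[OF lin tendsto_const[of "1 - s"] pos] s by simp
  have p2: "((\<lambda>h. (2 * (L * h))\<^sup>2) \<longlongrightarrow> 0\<^sup>2) (at_right 0)"
    by (rule tendsto_power[OF lin])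
  have "(E \<longlongrightarrow> C * (0 * (L + L * \<sigma>) powr (1 + s) + 0\<^sup>2)) (at_right 0)"
    unfolding E_def by (intro tendsto_mult tendsto_add p1 p2 tendsto_const)
  then have "\<forall>\<^sub>F h in at_right 0. E h < \<epsilon> / 4"
    using \<epsilon> by (auto dest: order_tendstoD(2)[where a = "\<epsilon> / 4"])
  moreover have "\<forall>\<^sub>F h in at_right 0. H h \<ge> max 1 (R + norm x0)"
    using H(2) unfolding filterlim_at_top by blast
  moreover have "\<forall>\<^sub>F h in at_right 0. (h::real) > 0" by (rule eventually_at_right_less)
  ultimately show ?thesis
  proof eventually_elim
    case (elim h)
    have out: "w x = 0" if "x \<notin> comp_domain \<Omega> (H h)" for x
    proof (rule w(2), rule ccontr)
      assume "\<not> norm x > R"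
      then have "dist x0 x \<le> H h"
        using elim(2) norm_triangle_ineq4[of x0 x] by (simp add: dist_norm)
      moreover have "x0 \<in> closure \<Omega>" using x0 closure_subset by blast
      ultimately show False using mem_comp_domain[OF o(1) \<Omega>(2) H(1)[OF elim(3)]] that by blast
    qed
    have "\<exists>v\<in>V_h_space (\<T> h). (\<forall>x. \<bar>w x - v x\<bar> \<le> L * mesh_size (\<T> h)) \<and>
     near_Lipschitz \<Omega> (L + L * \<sigma>) (\<lambda>x. w x - v x)"
      by (rule interpolant_in_V_h[OF o(1) \<Omega>(2) H(1)[OF elim(3)] _ mesh(1)[OF elim(3)] _ \<sigma>(1)[OF elim(3)] \<sigma>(2) w(1) out])
         (use elim mesh(2) in auto)
    then obtain v where v: "v \<in> V_h_space (\<T> h)" "\<And>x. \<bar>w x - v x\<bar> \<le> L * h"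
      "near_Lipschitz \<Omega> (L + L * \<sigma>) (\<lambda>x. w x - v x)"
      using mesh(2)[OF elim(3)] by auto
    have vb: "v \<in> borel_measurable borel"
      by (rule V_h_finite_energy[OF o(1) \<Omega>(2) s H(1)[OF elim(3)] mesh(1)[OF elim(3)] v(1)])
    have "V_sq s \<Omega> (\<lambda>x. w x - v x) \<le> ennreal (E h)"
      unfolding E_def by (rule C(2)[rule_format]) (use v L \<sigma>(2) in auto)
    also have "\<dots> \<le> ennreal (\<epsilon> / 4)" using elim(1) by (intro ennreal_leI) simp
    finally have wv: "V_sq s \<Omega> (\<lambda>x. w x - v x) \<le> ennreal (\<epsilon> / 4)" .
    have "V_sq s \<Omega> (\<lambda>x. u x - v x) \<le> ennreal (2 * (\<epsilon> / 4) + 2 * (\<epsilon> / 4))"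
      by (rule V_sq_triangle[OF u(1) wb vb _ _ _ _ wv]) (use w(3) o \<epsilon> in auto)
    then show ?case using v(1) by auto
  qed
qed

section \<open>The energy space and the Galerkin projection\<close>

lemma AE_lborel_pair:
  fixes P :: "'a::euclidean_space \<Rightarrow> bool"
  assumes "AE x in lborel. P x"
  shows "AE p in (lborel :: ('a \<times> 'a) measure). P (fst p) \<and> P (snd p)"
proof -
  obtain N where N: "{x. \<not> P x} \<subseteq> N" "N \<in> null_sets lborel"
    using assms by (auto simp: eventually_ae_filter)
  have "N \<times> UNIV \<in> null_sets (lborel \<Otimes>\<^sub>M (lborel :: 'a measure))" "UNIV \<times> N \<in> null_sets ((lborel :: 'a measure) \<Otimes>\<^sub>M lborel)"
    using N(2) by (auto simp: null_sets_def lborel.emeasure_pair_measure_Times)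
  then have "N \<times> UNIV \<union> UNIV \<times> N \<in> null_sets (lborel :: ('a \<times> 'a) measure)"
    by (simp add: lborel_prod null_sets.Un)
  then show ?thesis
    by (rule AE_I') (use N(1) in auto)
qed

lemma borel_representative:
  fixes u :: "'a::euclidean_space \<Rightarrow> real"
  assumes "u \<in> borel_measurable lebesgue"
  obtains u' where "u' \<in> borel_measurable borel" "AE x in lborel. u x = u' x"
  using completion_ex_borel_measurable_real[OF assms] by auto

text \<open>
  The projections are not obviously measurable between the completed measures; a Borel representative
  reduces the claim to null sets of product form.
\<close>

lemma lebesgue_measurable_fst_snd [measurable]:
  fixes u :: "'a::euclidean_space \<Rightarrow> real"
  assumes "u \<in> borel_measurable lebesgue"
  shows "(\<lambda>p::'a \<times> 'a. u (fst p)) \<in> borel_measurable lebesgue" "(\<lambda>p::'a \<times> 'a. u (snd p)) \<in> borel_measurable lebesgue"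
proof -
  obtain u' where u': "u' \<in> borel_measurable borel" "AE x in lborel. u x = u' x"
    using borel_representative[OF assms] .
  note [measurable] = u'(1)
  have ae: "AE p in (lebesgue :: ('a \<times> 'a) measure). u (fst p) = u' (fst p) \<and> u (snd p) = u' (snd p)"
    using AE_completion[OF AE_lborel_pair[OF u'(2)]] by simp
  have "(\<lambda>p::'a \<times> 'a. u' (fst p)) \<in> borel_measurable borel" "(\<lambda>p::'a \<times> 'a. u' (snd p)) \<in> borel_measurable borel"
    by measurable
  then have m: "(\<lambda>p::'a \<times> 'a. u' (fst p)) \<in> borel_measurable lebesgue" "(\<lambda>p::'a \<times> 'a. u' (snd p)) \<in> borel_measurable lebesgue"
    by (auto intro: measurable_completion)
  show "(\<lambda>p::'a \<times> 'a. u (fst p)) \<in> borel_measurable lebesgue"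
    by (rule borel_measurable_AE[OF m(1)]) (use ae in \<open>auto elim: eventually_mono\<close>)
  show "(\<lambda>p::'a \<times> 'a. u (snd p)) \<in> borel_measurable lebesgue"
    by (rule borel_measurable_AE[OF m(2)]) (use ae in \<open>auto elim: eventually_mono\<close>)
qed

lemma X_integrand_measurable [measurable]:
  fixes u v :: "'a::euclidean_space \<Rightarrow> real"
  assumes [measurable]: "u \<in> borel_measurable lebesgue" "v \<in> borel_measurable lebesgue"
  shows "X_integrand s u v \<in> borel_measurable lebesgue"
proof -
  have "(\<lambda>p::'a \<times> 'a. kern s (fst p - snd p)) \<in> borel_measurable borel" by measurable
  then have [measurable]: "(\<lambda>p::'a \<times> 'a. kern s (fst p - snd p)) \<in> borel_measurable lebesgue"
    by (auto intro: measurable_completion)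
  have "(\<lambda>p::'a \<times> 'a. (u (fst p) - u (snd p)) * (v (fst p) - v (snd p)) * kern s (fst p - snd p)) \<in> borel_measurable lebesgue"
    by measurable
  then show ?thesis by (simp add: X_integrand_kern[abs_def])
qed

lemma visible_pairs_lebesgue [measurable]: "visible_pairs \<Omega> \<in> sets lebesgue"
  using visible_pairs_borel by (simp add: sets_completionI_sets)

lemma V_space_iff:
  "v \<in> V_space s \<Omega> \<longleftrightarrow> v \<in> borel_measurable lebesgue \<and> set_integrable lebesgue \<Omega> (\<lambda>x. v x * v x) \<and>
     set_integrable lebesgue (visible_pairs \<Omega>) (X_integrand s v v)"
  by (simp add: V_space_def visible_pairs_def power2_eq_square)

lemma set_integrable_products:
  fixes s :: real
  assumes u: "u \<in> V_space s \<Omega>" and v: "v \<in> V_space s \<Omega>" and \<Omega>[measurable]: "\<Omega> \<in> sets lebesgue"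
  shows "set_integrable lebesgue \<Omega> (\<lambda>x. u x * v x)"
    and "set_integrable lebesgue (visible_pairs \<Omega>) (X_integrand s u v)"
proof -
  have [measurable]: "u \<in> borel_measurable lebesgue" "v \<in> borel_measurable lebesgue"
    using u v by (auto simp: V_space_iff)
  have ab: "\<bar>a * b\<bar> \<le> a * a + b * b" for a b :: real
    using sum_squares_bound[of "\<bar>a\<bar>" "\<bar>b\<bar>"] by (simp add: abs_mult power2_eq_square) (metis abs_ge_zero mult_nonneg_nonneg add_increasing2 order_trans mult_2 le_add_same_cancel1 mult.assoc)
  show "set_integrable lebesgue \<Omega> (\<lambda>x. u x * v x)"
  proof (rule set_integrable_bound)
    show "set_integrable lebesgue \<Omega> (\<lambda>x. u x * u x + v x * v x)"
      using u v by (intro set_integral_add) (auto simp: V_space_iff)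
    show "set_borel_measurable lebesgue \<Omega> (\<lambda>x. u x * v x)"
      unfolding set_borel_measurable_def by measurable
    show "AE x in lebesgue. x \<in> \<Omega> \<longrightarrow> norm (u x * v x) \<le> norm (u x * u x + v x * v x)"
      using ab by (intro AE_I2 impI) (metis abs_ge_self order_trans real_norm_def)
  qed
  show "set_integrable lebesgue (visible_pairs \<Omega>) (X_integrand s u v)"
  proof (rule set_integrable_bound)
    show "set_integrable lebesgue (visible_pairs \<Omega>) (\<lambda>p. X_integrand s u u p + X_integrand s v v p)"
      using u v by (intro set_integral_add) (auto simp: V_space_iff)
    show "set_borel_measurable lebesgue (visible_pairs \<Omega>) (X_integrand s u v)"
      unfolding set_borel_measurable_def by measurable
    have "\<bar>X_integrand s u v p\<bar> \<le> X_integrand s u u p + X_integrand s v v p" for p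
    proof -
      have "\<bar>X_integrand s u v p\<bar> = \<bar>(u (fst p) - u (snd p)) * (v (fst p) - v (snd p))\<bar> * kern s (fst p - snd p)"
        by (simp add: X_integrand_kern abs_mult)
      also have "\<dots> \<le> ((u (fst p) - u (snd p)) * (u (fst p) - u (snd p)) + (v (fst p) - v (snd p)) * (v (fst p) - v (snd p))) * kern s (fst p - snd p)"
        by (intro mult_right_mono ab) simp
      finally show ?thesis by (simp add: X_integrand_kern distrib_right)
    qed
    then show "AE p in lebesgue. p \<in> visible_pairs \<Omega> \<longrightarrow> norm (X_integrand s u v p) \<le> norm (X_integrand s u u p + X_integrand s v v p)"
      by (intro AE_I2 impI) (metis abs_ge_self order_trans real_norm_def)
  qed
qed

lemma X_integrand_diff:
  "X_integrand s (\<lambda>x. u x - v x) w p = X_integrand s u w p - X_integrand s v w p"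
  by (simp add: X_integrand_kern left_diff_distrib algebra_simps)

lemma X_integrand_commute: "X_integrand s u v p = X_integrand s v u p"
  by (simp add: X_integrand_kern mult.commute)

lemma X_inner_commute: "X_inner s \<Omega> u v = X_inner s \<Omega> v u"
proof -
  have "X_integrand s u v = X_integrand s v u" by (rule ext) (rule X_integrand_commute)
  then show ?thesis by (simp add: X_inner_def)
qed

lemma L2_inner_commute: "L2_inner \<Omega> u v = L2_inner \<Omega> v u"
  by (simp add: L2_inner_def mult.commute)

lemma V_space_diff:
  assumes u: "u \<in> V_space s \<Omega>" and v: "v \<in> V_space s \<Omega>" and \<Omega>: "\<Omega> \<in> sets lebesgue"
  shows "(\<lambda>x. u x - v x) \<in> V_space s \<Omega>"
proof -
  have [measurable]: "u \<in> borel_measurable lebesgue" "v \<in> borel_measurable lebesgue"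
    using u v by (auto simp: V_space_iff)
  have 1: "set_integrable lebesgue \<Omega> (\<lambda>x. (u x * u x - u x * v x) - (u x * v x - v x * v x))"
    by (intro set_integral_diff set_integrable_products[where s = s, OF _ _ \<Omega>] u v)
  have 2: "set_integrable lebesgue (visible_pairs \<Omega>) (\<lambda>p. (X_integrand s u u p - X_integrand s u v p) - (X_integrand s u v p - X_integrand s v v p))"
    by (intro set_integral_diff set_integrable_products[where s = s, OF _ _ \<Omega>] u v)
  have "X_integrand s (\<lambda>x. u x - v x) (\<lambda>x. u x - v x) = (\<lambda>p. (X_integrand s u u p - X_integrand s u v p) - (X_integrand s u v p - X_integrand s v v p))"
    by (rule ext) (simp add: X_integrand_kern algebra_simps)
  with 1 2 show ?thesis by (simp add: V_space_iff algebra_simps)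
qed

lemma inner_diff_left_V:
  assumes u: "u \<in> V_space s \<Omega>" and v: "v \<in> V_space s \<Omega>" and w: "w \<in> V_space s \<Omega>" and \<Omega>: "\<Omega> \<in> sets lebesgue"
  shows "L2_inner \<Omega> (\<lambda>x. u x - v x) w = L2_inner \<Omega> u w - L2_inner \<Omega> v w"
    and "X_inner s \<Omega> (\<lambda>x. u x - v x) w = X_inner s \<Omega> u w - X_inner s \<Omega> v w"
proof -
  show "L2_inner \<Omega> (\<lambda>x. u x - v x) w = L2_inner \<Omega> u w - L2_inner \<Omega> v w"
    unfolding L2_inner_def left_diff_distrib
    by (intro set_integral_diff set_integrable_products[where s = s, OF _ _ \<Omega>] u v w)
  have e: "X_integrand s (\<lambda>x. u x - v x) w = (\<lambda>p. X_integrand s u w p - X_integrand s v w p)"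
    by (rule ext) (rule X_integrand_diff)
  have "(LINT p:visible_pairs \<Omega>|lebesgue. X_integrand s u w p - X_integrand s v w p)
    = (LINT p:visible_pairs \<Omega>|lebesgue. X_integrand s u w p) - (LINT p:visible_pairs \<Omega>|lebesgue. X_integrand s v w p)"
    by (intro set_integral_diff set_integrable_products[where s = s, OF _ _ \<Omega>] u v w)
  then show "X_inner s \<Omega> (\<lambda>x. u x - v x) w = X_inner s \<Omega> u w - X_inner s \<Omega> v w"
    unfolding X_inner_def e visible_pairs_def by (simp add: right_diff_distrib)
qed

lemma frac_const_nonneg:
  assumes "0 < s" "s < 1"
  shows "frac_const d s \<ge> 0"
proof -
  have "Gamma (s + real d / 2) > 0" "Gamma (1 - s) > 0"
    using assms by (intro Gamma_real_pos; simp)+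
  then show ?thesis using assms by (simp add: frac_const_def)
qed

lemma V_sq_eq_inner:
  assumes v: "v \<in> V_space s \<Omega>"
  shows "L2sq_on \<Omega> v = ennreal (L2_inner \<Omega> v v)"
    and "energy s \<Omega> v = ennreal (LINT p:visible_pairs \<Omega>|lebesgue. X_integrand s v v p)"
    and "L2_inner \<Omega> v v \<ge> 0" "(LINT p:visible_pairs \<Omega>|lebesgue. X_integrand s v v p) \<ge> 0"
proof -
  have nn: "X_integrand s v v p \<ge> 0" for p
    by (simp add: X_integrand_kern)
  show "L2_inner \<Omega> v v \<ge> 0"
    unfolding L2_inner_def set_lebesgue_integral_def by (intro integral_nonneg_AE AE_I2) (simp add: indicator_def)
  show "(LINT p:visible_pairs \<Omega>|lebesgue. X_integrand s v v p) \<ge> 0"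
    unfolding set_lebesgue_integral_def using nn by (intro integral_nonneg_AE AE_I2) (simp add: indicator_def)
  have "L2sq_on \<Omega> v = (\<integral>\<^sup>+x. ennreal (indicator \<Omega> x *\<^sub>R (v x * v x)) \<partial>lebesgue)"
    unfolding L2sq_on_def nn_integral_completion by (intro nn_integral_cong) (simp add: indicator_def power2_eq_square)
  also have "\<dots> = ennreal (L2_inner \<Omega> v v)"
    using v unfolding L2_inner_def set_lebesgue_integral_def
    by (intro nn_integral_eq_integral) (auto simp: V_space_iff set_integrable_def indicator_def)
  finally show "L2sq_on \<Omega> v = ennreal (L2_inner \<Omega> v v)" .
  have "energy s \<Omega> v = (\<integral>\<^sup>+p. ennreal (indicator (visible_pairs \<Omega>) p *\<^sub>R X_integrand s v v p) \<partial>lebesgue)"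
    unfolding energy_def nn_integral_completion
    by (intro nn_integral_cong) (simp add: indicator_def power2_eq_square X_integrand_kern)
  also have "\<dots> = ennreal (LINT p:visible_pairs \<Omega>|lebesgue. X_integrand s v v p)"
    using v nn unfolding set_lebesgue_integral_def
    by (intro nn_integral_eq_integral) (auto simp: V_space_iff set_integrable_def indicator_def)
  finally show "energy s \<Omega> v = ennreal (LINT p:visible_pairs \<Omega>|lebesgue. X_integrand s v v p)" .
qed

lemma V_sq_finite:
  assumes v: "v \<in> V_space s \<Omega>"
  shows "V_sq s \<Omega> v < \<infinity>"
  by (simp add: V_sq_def V_sq_eq_inner[OF v])

lemma in_V_space_if_finite:
  assumes v[measurable]: "v \<in> borel_measurable borel" and fin: "V_sq s \<Omega> v < \<infinity>" and \<Omega>[measurable]: "\<Omega> \<in> sets borel"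
  shows "v \<in> V_space s \<Omega>"
proof -
  have nn: "X_integrand s v v p \<ge> 0" for p by (simp add: X_integrand_kern)
  have vl[measurable]: "v \<in> borel_measurable lebesgue" using v by (auto intro: measurable_completion)
  have \<Omega>l[measurable]: "\<Omega> \<in> sets lebesgue" using \<Omega> by (simp add: sets_completionI_sets)
  have "integrable lebesgue (\<lambda>x. indicator \<Omega> x *\<^sub>R (v x * v x))"
  proof (rule integrableI_nonneg)
    have "(\<integral>\<^sup>+x. ennreal (indicator \<Omega> x *\<^sub>R (v x * v x)) \<partial>lebesgue) = L2sq_on \<Omega> v"
      unfolding L2sq_on_def nn_integral_completion by (intro nn_integral_cong) (simp add: indicator_def power2_eq_square)
    then show "(\<integral>\<^sup>+x. ennreal (indicator \<Omega> x *\<^sub>R (v x * v x)) \<partial>lebesgue) < \<infinity>"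
      using fin by (simp add: V_sq_def)
  qed (auto simp: indicator_def)
  moreover have "integrable lebesgue (\<lambda>p. indicator (visible_pairs \<Omega>) p *\<^sub>R X_integrand s v v p)"
  proof (rule integrableI_nonneg)
    have "(\<integral>\<^sup>+p. ennreal (indicator (visible_pairs \<Omega>) p *\<^sub>R X_integrand s v v p) \<partial>lebesgue) = energy s \<Omega> v"
      unfolding energy_def nn_integral_completion
      by (intro nn_integral_cong) (simp add: indicator_def power2_eq_square X_integrand_kern)
    then show "(\<integral>\<^sup>+p. ennreal (indicator (visible_pairs \<Omega>) p *\<^sub>R X_integrand s v v p) \<partial>lebesgue) < \<infinity>"
      using fin by (simp add: V_sq_def)
  qed (use nn in \<open>auto simp: indicator_def\<close>)
  ultimately show ?thesis using vl by (simp add: V_space_iff set_integrable_def)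
qed

lemma V_sq_cong_AE:
  assumes "AE x in lborel. u x = v x"
  shows "V_sq s \<Omega> u = V_sq s \<Omega> v"
proof -
  have "L2sq_on \<Omega> u = L2sq_on \<Omega> v"
    unfolding L2sq_on_def using assms by (intro nn_integral_cong_AE) (auto elim: eventually_mono)
  moreover have "energy s \<Omega> u = energy s \<Omega> v"
    unfolding energy_def using AE_lborel_pair[OF assms] by (intro nn_integral_cong_AE) (auto elim: eventually_mono)
  ultimately show ?thesis by (simp add: V_sq_def)
qed

lemma V_h_space_diff:
  assumes "u \<in> V_h_space \<T>" "v \<in> V_h_space \<T>"
  shows "(\<lambda>x. u x - v x) \<in> V_h_space \<T>"
proof -
  obtain c c\<^sub>0 d d\<^sub>0 where "u = (\<lambda>x. (\<Sum>z\<in>mesh_vertices \<T>. c z * nodal_basis \<T> z x) + c\<^sub>0 * indicator (- \<Union>\<T>) x)"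
     "v = (\<lambda>x. (\<Sum>z\<in>mesh_vertices \<T>. d z * nodal_basis \<T> z x) + d\<^sub>0 * indicator (- \<Union>\<T>) x)"
    using assms by (auto simp: V_h_space_def)
  then have "(\<lambda>x. u x - v x) = (\<lambda>x. (\<Sum>z\<in>mesh_vertices \<T>. (c z - d z) * nodal_basis \<T> z x) + (c\<^sub>0 - d\<^sub>0) * indicator (- \<Union>\<T>) x)"
    by (simp add: left_diff_distrib sum_subtractf algebra_simps)
  then show ?thesis unfolding V_h_space_def by (intro CollectI exI[of _ "\<lambda>z. c z - d z"] exI[of _ "c\<^sub>0 - d\<^sub>0"])
qed

text \<open>
  With \<open>e = u - u\<^sub>h\<close> and \<open>q = v - u\<^sub>h\<close> in \<open>W\<close>, testing both problems with \<open>q\<close> gives \<open>a(e, q) = 0\<close>, hence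
  \<open>a(e - q, e - q) = a(e, e) + a(q, q)\<close>.
\<close>

lemma Galerkin_best_approximation:
  fixes s \<alpha> :: real
  assumes s: "0 < s" "s < 1" and \<alpha>: "\<alpha> > 0" and \<Omega>: "\<Omega> \<in> sets lebesgue"
    and W: "W \<subseteq> V_space s \<Omega>" "\<And>v w. v \<in> W \<Longrightarrow> w \<in> W \<Longrightarrow> (\<lambda>x. v x - w x) \<in> W"
    and u: "solves s \<Omega> \<alpha> f g (V_space s \<Omega>) u" and u\<^sub>h: "solves s \<Omega> \<alpha> f g W u\<^sub>h" and v: "v \<in> W"
  shows "X_inner s \<Omega> (\<lambda>x. u x - u\<^sub>h x) (\<lambda>x. u x - u\<^sub>h x) + \<alpha> * L2_inner \<Omega> (\<lambda>x. u x - u\<^sub>h x) (\<lambda>x. u x - u\<^sub>h x)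
    \<le> X_inner s \<Omega> (\<lambda>x. u x - v x) (\<lambda>x. u x - v x) + \<alpha> * L2_inner \<Omega> (\<lambda>x. u x - v x) (\<lambda>x. u x - v x)"
proof -
  define B where "B p q = X_inner s \<Omega> p q + \<alpha> * L2_inner \<Omega> p q" for p q
  have comm: "B p q = B q p" for p q
    by (simp add: B_def X_inner_commute[of s \<Omega> p q] L2_inner_commute[of \<Omega> p q])
  have diff: "B (\<lambda>x. p x - q x) r = B p r - B q r" if "p \<in> V_space s \<Omega>" "q \<in> V_space s \<Omega>" "r \<in> V_space s \<Omega>" for p q r
    using inner_diff_left_V[OF that \<Omega>] by (simp add: B_def right_diff_distrib)
  have nonneg: "B p p \<ge> 0" if "p \<in> V_space s \<Omega>" for p
    using V_sq_eq_inner(3,4)[OF that] frac_const_nonneg[OF s] \<alpha> unfolding visible_pairs_def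
    by (simp add: B_def X_inner_def)
  have uV: "u \<in> V_space s \<Omega>" using u by (simp add: solves_def)
  have uW: "u\<^sub>h \<in> W" using u\<^sub>h by (simp add: solves_def)
  define q where "q x = v x - u\<^sub>h x" for x
  have q: "q \<in> W" unfolding q_def using W(2) v uW by simp
  have qV: "q \<in> V_space s \<Omega>" and uhV: "u\<^sub>h \<in> V_space s \<Omega>" and vV: "v \<in> V_space s \<Omega>" using q uW v W(1) by auto
  define e where "e x = u x - u\<^sub>h x" for x
  have eV: "e \<in> V_space s \<Omega>" unfolding e_def by (rule V_space_diff[OF uV uhV \<Omega>])
  have orth: "B e q = 0"
  proof -
    have "B u q = B u\<^sub>h q" using u u\<^sub>h q qV by (simp add: solves_def B_def)
    then show ?thesis unfolding e_def using diff[OF uV uhV qV] by simp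
  qed
  have eq: "(\<lambda>x. u x - v x) = (\<lambda>x. e x - q x)" by (simp add: e_def q_def)
  have dV: "(\<lambda>x. e x - q x) \<in> V_space s \<Omega>" by (rule V_space_diff[OF eV qV \<Omega>])
  have "B (\<lambda>x. e x - q x) (\<lambda>x. e x - q x) = B e (\<lambda>x. e x - q x) - B q (\<lambda>x. e x - q x)"
    by (rule diff[OF eV qV dV])
  also have "\<dots> = (B e e - B q e) - (B e q - B q q)"
    using diff[OF eV qV eV] diff[OF eV qV qV] by (simp add: comm[of _ "\<lambda>x. e x - q x"])
  also have "\<dots> = B e e + B q q" using orth comm[of q e] by simp
  finally have "B e e \<le> B (\<lambda>x. e x - q x) (\<lambda>x. e x - q x)" using nonneg[OF qV] by simp
  then show ?thesis unfolding eq[symmetric] by (simp add: B_def e_def[abs_def])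
qed

section \<open>Convergence\<close>

theorem theorem4p1:
  fixes \<Omega> :: "(real ^ 'n) set"
    and s \<alpha> :: real
    and f g u :: "real ^ 'n \<Rightarrow> real"
    and H :: "real \<Rightarrow> real"
    and \<T> :: "real \<Rightarrow> (real ^ 'n) set set"
    and u\<^sub>h :: "real \<Rightarrow> real ^ 'n \<Rightarrow> real"
  assumes "lipschitz_domain \<Omega>" and "bounded \<Omega>"
    and "0 < s" and "s < 1" and "\<alpha> > 0"
    and "f \<in> L2_on \<Omega>" and "g \<in> L2s_dual s (ext \<Omega>)"
    and "solves s \<Omega> \<alpha> f g (V_space s \<Omega>) u"
    and "\<And>h. h > 0 \<Longrightarrow> H h > diameter \<Omega>"
    and "\<And>h. h > 0 \<Longrightarrow> is_mesh \<Omega> (H h) (\<T> h)"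
    and "\<And>h. h > 0 \<Longrightarrow> mesh_size (\<T> h) = h"
    and "shape_regular \<T>"
    and "\<And>h. h > 0 \<Longrightarrow> solves s \<Omega> \<alpha> f g (V_h_space (\<T> h)) (u\<^sub>h h)"
    and "filterlim H at_top (at_right 0)"
    and "u \<in> Linf_loc (closure (ext \<Omega>))"
  shows "((\<lambda>h. V_norm s \<Omega> (\<lambda>x. u x - u\<^sub>h h x)) \<longlongrightarrow> 0) (at_right 0)"
proof -
  note s = \<open>0 < s\<close> \<open>s < 1\<close>
  have o: "open \<Omega>" using assms(1) by (simp add: lipschitz_domain_def)
  then have \<Omega>b: "\<Omega> \<in> sets borel" by auto
  then have \<Omega>l: "\<Omega> \<in> sets lebesgue" by (simp add: sets_completionI_sets)
  have uV: "u \<in> V_space s \<Omega>" using assms(8) by (simp add: solves_def)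
  then have "u \<in> borel_measurable lebesgue" by (simp add: V_space_iff)
  \<comment> \<open>neither the norm nor the form distinguishes \<open>u\<close> from a Borel representative\<close>
  then obtain u' where u': "u' \<in> borel_measurable borel" "AE x in lborel. u x = u' x"
    by (rule borel_representative)
  have u'fin: "V_sq s \<Omega> u' < \<infinity>"
    using V_sq_finite[OF uV] V_sq_cong_AE[OF u'(2)] by simp
  define \<kappa> where "\<kappa> = frac_const CARD('n) s / 2"
  have \<kappa>: "\<kappa> \<ge> 0" using frac_const_nonneg[OF s] by (simp add: \<kappa>_def)
  \<comment> \<open>the form dominates \<open>m\<close> times the squared norm\<close>
  define m where "m = min 1 \<alpha>"
  have m: "m > 0" "m \<le> 1" "m \<le> \<alpha>" using \<open>\<alpha> > 0\<close> by (auto simp: m_def)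
  have XI: "X_inner s \<Omega> v v = \<kappa> * (LINT p:visible_pairs \<Omega>|lebesgue. X_integrand s v v p)" for v
    by (simp add: X_inner_def \<kappa>_def visible_pairs_def)
  have "\<forall>\<^sub>F h in at_right 0. \<bar>V_norm s \<Omega> (\<lambda>x. u x - u\<^sub>h h x)\<bar> < \<epsilon>" if \<epsilon>: "\<epsilon> > 0" for \<epsilon>
  proof -
    have \<kappa>\<alpha>: "\<kappa> + \<alpha> > 0" using \<kappa> \<open>\<alpha> > 0\<close> by linarith
    define \<delta> where "\<delta> = m * \<epsilon>\<^sup>2 / (2 * (\<kappa> + \<alpha>))"
    have "t * (x / (2 * t)) = x / 2" if "t > 0" for t x :: real using that by simp
    from this[OF \<kappa>\<alpha>] have "(\<kappa> + \<alpha>) * \<delta> = m * \<epsilon>\<^sup>2 / 2" unfolding \<delta>_def .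
    moreover have "m * \<epsilon>\<^sup>2 > 0" using m \<epsilon> by simp
    ultimately have \<delta>2: "(\<kappa> + \<alpha>) * \<delta> < m * \<epsilon>\<^sup>2" by linarith
    have \<delta>1: "\<delta> > 0" using \<kappa>\<alpha> m \<epsilon> by (simp add: \<delta>_def)
    note \<delta> = \<delta>1 \<delta>2
    have "\<forall>\<^sub>F h in at_right 0. \<exists>v\<in>V_h_space (\<T> h). V_sq s \<Omega> (\<lambda>x. u' x - v x) \<le> ennreal \<delta>"
      by (rule V_h_approximation[OF assms(1,2) s u'(1) u'fin assms(9,14,10,11,12) \<delta>(1)])
    moreover have "\<forall>\<^sub>F h in at_right 0. (h::real) > 0" by (rule eventually_at_right_less)
    ultimately show ?thesis
    proof eventually_elim
      case (elim h)
      then obtain v where v: "v \<in> V_h_space (\<T> h)" "V_sq s \<Omega> (\<lambda>x. u' x - v x) \<le> ennreal \<delta>" by blast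
      have W: "V_h_space (\<T> h) \<subseteq> V_space s \<Omega>"
      proof
        fix w assume "w \<in> V_h_space (\<T> h)"
        note V_h_finite_energy[OF o assms(2) s assms(9)[OF elim(2)] assms(10)[OF elim(2)] this]
        then show "w \<in> V_space s \<Omega>" by (intro in_V_space_if_finite \<Omega>b)
      qed
      define d where "d x = u x - v x" for x
      define e where "e x = u x - u\<^sub>h h x" for x
      have dV: "d \<in> V_space s \<Omega>" unfolding d_def using W v by (intro V_space_diff[OF uV _ \<Omega>l]) auto
      have "u\<^sub>h h \<in> V_h_space (\<T> h)" using assms(13)[OF elim(2)] by (simp add: solves_def)
      then have eV: "e \<in> V_space s \<Omega>" unfolding e_def using W by (intro V_space_diff[OF uV _ \<Omega>l]) auto
      have "V_sq s \<Omega> d = V_sq s \<Omega> (\<lambda>x. u' x - v x)"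
        unfolding d_def using u'(2) by (intro V_sq_cong_AE) (auto elim: eventually_mono)
      with v(2) have "V_sq s \<Omega> d \<le> ennreal \<delta>" by simp
      then have "ennreal (L2_inner \<Omega> d d) \<le> ennreal \<delta>" "ennreal (LINT p:visible_pairs \<Omega>|lebesgue. X_integrand s d d p) \<le> ennreal \<delta>"
        unfolding V_sq_def V_sq_eq_inner(1,2)[OF dV]
        by (auto intro: order_trans[rotated] simp: add_increasing add_increasing2)
      then have d: "L2_inner \<Omega> d d \<le> \<delta>" "X_inner s \<Omega> d d \<le> \<kappa> * \<delta>"
        using \<delta> \<kappa> by (auto simp: XI intro: mult_left_mono)
      have "X_inner s \<Omega> e e + \<alpha> * L2_inner \<Omega> e e \<le> X_inner s \<Omega> d d + \<alpha> * L2_inner \<Omega> d d"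
        unfolding e_def d_def
        by (rule Galerkin_best_approximation[OF s \<open>\<alpha> > 0\<close> \<Omega>l W V_h_space_diff assms(8) assms(13)[OF elim(2)] v(1)])
      also have "\<dots> \<le> \<kappa> * \<delta> + \<alpha> * \<delta>" using d \<open>\<alpha> > 0\<close> by (intro add_mono mult_left_mono) auto
      also have "\<dots> < m * \<epsilon>\<^sup>2" using \<delta>(2) by (simp add: distrib_right)
      finally have *: "X_inner s \<Omega> e e + \<alpha> * L2_inner \<Omega> e e < m * \<epsilon>\<^sup>2" .
      have Xe: "X_inner s \<Omega> e e \<ge> 0" and Le: "L2_inner \<Omega> e e \<ge> 0"
        using V_sq_eq_inner(3,4)[OF eV] \<kappa> by (auto simp: XI)
      have "m * (L2_inner \<Omega> e e + X_inner s \<Omega> e e) \<le> X_inner s \<Omega> e e + \<alpha> * L2_inner \<Omega> e e"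
        using mult_right_mono[OF m(3) Le] mult_right_mono[OF m(2) Xe] by (simp add: distrib_left)
      with * have "m * (L2_inner \<Omega> e e + X_inner s \<Omega> e e) < m * \<epsilon>\<^sup>2" by linarith
      then have "L2_inner \<Omega> e e + X_inner s \<Omega> e e < \<epsilon>\<^sup>2" using m by simp
      then have "sqrt (L2_inner \<Omega> e e + X_inner s \<Omega> e e) < \<epsilon>"
        using \<epsilon> by (intro real_less_lsqrt) auto
      moreover have "V_norm s \<Omega> e = sqrt (L2_inner \<Omega> e e + X_inner s \<Omega> e e)"
        using Xe by (simp add: V_norm_def X_seminorm_def)
      ultimately have "\<bar>V_norm s \<Omega> e\<bar> < \<epsilon>" using Xe Le by simp
      then show ?case by (simp add: e_def[abs_def])
    qed
  qed
  then show ?thesis by (intro tendstoI) (simp add: dist_real_def)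
qed

end
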